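(* Consider the branching random walk on $\mathbb{Z}^d$ described in the context, with $\beta^*>0$. Let $\beta^*>\beta_c$ and $\lambda_{\mathcal{E}}<0$. Then for all $n\in\mathbb{N}$ and $x,y\in\mathbb{Z}^d$ there are constants $D_n(x,y)$ and $D_n(x)$ (not depending on $t$) such that, as $t\to\infty$, $$m_n(t,x,y)\sim D_n(x,y)\,e^{\lambda_{\mathcal{E}}t},\qquad m_n(t,x)\sim D_n(x)\,e^{\lambda_{\mathcal{E}}t}.$$
   Context: **Random walk.** Let $d\in\mathbb{N}$. The underlying continuous-time random walk on $\mathbb{Z}^d$ has transition intensity matrix $A=(a(x,y))_{x,y\in\mathbb{Z}^d}$ with $a(x,y)\ge0$ for $x\ne y$, $a(x,x)<0$, and is regular ($\sum_y a(x,y)=0$), symmetric ($a(x,y)=a(y,x)$), spatially homogeneous ($a(x,y)=a(y-x)$, regarded as a function of one argument), time homogeneous and irreducible (every lattice point can be reached from every other). No condition on the variance of jumps is imposed. Its transition probabilities are $p(t,x,y)$; $p(h,x,y)=a(x,y)h+o(h)$ for $x\neq y$ and $p(h,x,x)=1+a(x,x)h+o(h)$ as $h\to0$. The Green's function is $G_\lambda(x,y)=\int_0^\infty e^{-\lambda t}p(t,x,y)\,dt$, $\lambda\ge0$, and $\beta_c:=1/G_0(0,0)$ (with $\beta_c=0$ if $G_0(0,0)=\infty$). **Branching and absorption.** Let $f(u)=\sum_{n\ge0}b_nu^n$, $0\le u\le1$, with $b_n\ge0$ for $n\ne1$, $b_1<0$, $\sum_nb_n=0$. A particle at $x$ during a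 short time $dt$ jumps to $y\ne x$ with probability $a(x,y)dt+o(dt)$, dies with probability $b_0dt+o(dt)$ (at every lattice point $x$), and, only if $x=0$, is replaced by $n>1$ particles at $0$ (itself included) with probability $b_ndt+o(dt)$; otherwise it stays unchanged. Particles evolve independently of each other and of the past. Put $\beta^*:=\sum_{n>1}(n-1)b_n$; throughout $\beta^*>0$. The derivatives $\beta^{(r)}:=f^{(r)}(1)$ are assumed finite for all $r\in\mathbb{N}$. **Moments.** $\mu(t,y)$ is the number of particles at $y\in\mathbb{Z}^d$ at time $t$, and $\mu(t)=\sum_y\mu(t,y)$. $\mathsf{E}_x$ is expectation when the process starts at time $0$ with one particle at $x$. $m_n(t,x,y):=\mathsf{E}_x\mu^n(t,y)$, $m_n(t,x):=\mathsf{E}_x\mu^n(t)$, $n\in\mathbb{N}$. **Evolution operator.** $(\mathcal{A}\varphi)(x)=\sum_ya(x-y)\varphi(y)$, $\Delta_0=\delta_0\delta_0^T$ (so $(\Delta_0\varphi)(x)=\varphi(0)$ if $x=0$ and $0$ otherwise), $\mathcal{E}=\mathcal{A}+\beta^*\Delta_0-b_0I$. When $\beta^*>\beta_c$, $\lambda_0>0$ denotes the unique isolated positive eigenvalue of $\mathcal{A}+\beta^*\Delta_0$ on $l^2(\mathbb{Z}^d)$, i.e. the solution of $\beta^*G_\lambda(0,0)=1$, and $\lambda_{\mathcal{E}}:=\lambda_0-b_0$ is the corresponding eigenvalue of $\mathcal{E}$. The symbol $\sim$ denotes asymptotic equivalence (the ratio tends to $1$). *)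

theory Defs
  imports "HOL-Probability.Probability" "HOL-Library.Multiset" "HOL-Library.Landau_Symbols"
begin

text \<open>
  The lattice of dimension \<open>d \<ge> 1\<close> is the type \<open>int ^ 'd\<close>, with \<open>d = CARD('d)\<close>. A particle
  configuration is a finite multiset of lattice points.
\<close>

type_synonym 'd config = "(int ^ 'd) multiset"


section \<open>Markov transition functions given by infinitesimal rates\<close>

definition transition_function :: "(real \<Rightarrow> 's \<Rightarrow> 's pmf) \<Rightarrow> bool" where
  "transition_function P \<longleftrightarrow>
     (\<forall>u. P 0 u = return_pmf u) \<and>
     (\<forall>s\<ge>0. \<forall>t\<ge>0. \<forall>u. P (s + t) u = bind_pmf (P s u) (P t))"

definition jump_rate :: "(real \<Rightarrow> 's \<Rightarrow> 's pmf) \<Rightarrow> 's \<Rightarrow> 's \<Rightarrow> real \<Rightarrow> bool" where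
  "jump_rate P u v q \<longleftrightarrow>
     (\<lambda>h. pmf (P h u) v - ((if v = u then 1 else 0) + q * h)) \<in> o[at_right 0](\<lambda>h. h)"


section \<open>The underlying random walk\<close>

definition walk_intensity :: "(int ^ 'd \<Rightarrow> int ^ 'd \<Rightarrow> real) \<Rightarrow> bool" where
  "walk_intensity a \<longleftrightarrow>
     (\<forall>x y. x \<noteq> y \<longrightarrow> 0 \<le> a x y) \<and>
     (\<forall>x. a x x < 0) \<and>
     (\<forall>x. (a x has_sum 0) UNIV) \<and>
     (\<forall>x y. a x y = a y x) \<and>
     (\<forall>x y. a x y = a 0 (y - x)) \<and>
     (\<forall>x y. (\<lambda>u v. 0 < a u v)\<^sup>*\<^sup>* x y)"

definition walk_transition ::
  "(int ^ 'd \<Rightarrow> int ^ 'd \<Rightarrow> real) \<Rightarrow> (real \<Rightarrow> int ^ 'd \<Rightarrow> (int ^ 'd) pmf) \<Rightarrow> bool" where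
  "walk_transition a p \<longleftrightarrow> transition_function p \<and> (\<forall>x y. jump_rate p x y (a x y))"

definition green ::
  "(real \<Rightarrow> int ^ 'd \<Rightarrow> (int ^ 'd) pmf) \<Rightarrow> real \<Rightarrow> int ^ 'd \<Rightarrow> int ^ 'd \<Rightarrow> ennreal" where
  "green p l x y = (\<integral>\<^sup>+ t\<in>{0..}. ennreal (exp (- l * t) * pmf (p t x) y) \<partial>lborel)"

definition beta_c :: "(real \<Rightarrow> int ^ 'd \<Rightarrow> (int ^ 'd) pmf) \<Rightarrow> real" where
  "beta_c p = (if green p 0 0 0 = \<infinity> then 0 else 1 / enn2real (green p 0 0 0))"


section \<open>Branching and absorption\<close>

definition offspring_gf :: "(nat \<Rightarrow> real) \<Rightarrow> real \<Rightarrow> real" where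
  "offspring_gf b u = (\<Sum>n. b n * u ^ n)"

text \<open>
  The generating function lives on \<open>{0..1}\<close> only (its power series may diverge to the right
  of 1), so all derivatives, in particular those at 1, are taken within \<open>{0..1}\<close>. In the last
  conjunct \<open>F r\<close> is the derivative of order \<open>r\<close>; that \<open>F r 1\<close> is a real number expresses that
  the derivative of order \<open>r\<close> at 1 is finite.
\<close>

definition offspring_rates :: "(nat \<Rightarrow> real) \<Rightarrow> bool" where
  "offspring_rates b \<longleftrightarrow>
     (\<forall>n. n \<noteq> 1 \<longrightarrow> 0 \<le> b n) \<and> b 1 < 0 \<and> b sums 0 \<and>
     (\<exists>F. F 0 = offspring_gf b \<and>
        (\<forall>r. \<forall>u\<in>{0..1}. (F r has_real_derivative F (Suc r) u) (at u within {0..1})))"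

definition beta_star :: "(nat \<Rightarrow> real) \<Rightarrow> real" where
  "beta_star b = (\<Sum>\<^sub>\<infinity>n\<in>{1<..}. (real n - 1) * b n)"


section \<open>The branching random walk\<close>

text \<open>
  Rate at which a single particle at \<open>x\<close> is replaced by the configuration \<open>C\<close>. The value at
  \<open>C = {#x#}\<close> is minus the sum of all other rates; at the origin this uses
  \<open>b 0 + (\<Sum>n>1. b n) = - b 1\<close>.
\<close>

definition particle_rate ::
  "(int ^ 'd \<Rightarrow> int ^ 'd \<Rightarrow> real) \<Rightarrow> (nat \<Rightarrow> real) \<Rightarrow> int ^ 'd \<Rightarrow> 'd config \<Rightarrow> real" where
  "particle_rate a b x C =
     (if C = {#x#} then a x x + (if x = 0 then b 1 else - b 0)
      else if C = {#} then b 0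
      else if size C = 1 then a x (THE y. C = {#y#})
      else if x = 0 \<and> C = replicate_mset (size C) 0 then b (size C)
      else 0)"

text \<open>
  The last two conjuncts express that particles evolve independently of each other: the
  descendants of two groups of particles are independent.
\<close>

definition brw_transition ::
  "(int ^ 'd \<Rightarrow> int ^ 'd \<Rightarrow> real) \<Rightarrow> (nat \<Rightarrow> real) \<Rightarrow>
     (real \<Rightarrow> 'd config \<Rightarrow> 'd config pmf) \<Rightarrow> bool" where
  "brw_transition a b P \<longleftrightarrow>
     transition_function P \<and>
     (\<forall>x C. jump_rate P {#x#} C (particle_rate a b x C)) \<and>
     (\<forall>t\<ge>0. P t {#} = return_pmf {#}) \<and>
     (\<forall>t\<ge>0. \<forall>C C'. P t (C + C') = map_pmf (\<lambda>(u, v). u + v) (pair_pmf (P t C) (P t C')))"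

text \<open>
  \<open>M x\<close> is the law of the process started from one particle at \<open>x\<close>, and \<open>X t\<close> is the
  configuration at time \<open>t\<close>. The last conjunct is the Markov property: given the
  configuration at time \<open>s\<close>, the configuration at time \<open>s + h\<close> has law \<open>P h\<close> independently of
  the configurations at any finite set \<open>T\<close> of earlier times.
\<close>

definition branching_random_walk ::
  "(int ^ 'd \<Rightarrow> int ^ 'd \<Rightarrow> real) \<Rightarrow> (nat \<Rightarrow> real) \<Rightarrow>
     (int ^ 'd \<Rightarrow> 'w measure) \<Rightarrow> (real \<Rightarrow> 'w \<Rightarrow> 'd config) \<Rightarrow> bool" where
  "branching_random_walk a b M X \<longleftrightarrow>
     (\<exists>P. brw_transition a b P \<and>
       (\<forall>x. prob_space (M x) \<and>
          (\<forall>t\<ge>0. X t \<in> measurable (M x) (count_space UNIV)) \<and>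
          (AE w in M x. X 0 w = {#x#}) \<and>
          (\<forall>T s h g C C'. finite T \<and> T \<subseteq> {0..s} \<and> 0 \<le> s \<and> 0 \<le> h \<longrightarrow>
             \<P>(w in M x. (\<forall>r\<in>T. X r w = g r) \<and> X s w = C \<and> X (s + h) w = C') =
             \<P>(w in M x. (\<forall>r\<in>T. X r w = g r) \<and> X s w = C) * pmf (P h C) C')))"

text \<open>
  These are Bochner integrals, with value 0 if the integrand is not integrable; a moment that
  is asymptotic to a positive function of time is therefore finite for all large times.
\<close>

definition local_moment ::
  "(int ^ 'd \<Rightarrow> 'w measure) \<Rightarrow> (real \<Rightarrow> 'w \<Rightarrow> 'd config) \<Rightarrow>
     nat \<Rightarrow> real \<Rightarrow> int ^ 'd \<Rightarrow> int ^ 'd \<Rightarrow> real" where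
  "local_moment M X n t x y = (\<integral>w. real (count (X t w) y) ^ n \<partial>M x)"

definition total_moment ::
  "(int ^ 'd \<Rightarrow> 'w measure) \<Rightarrow> (real \<Rightarrow> 'w \<Rightarrow> 'd config) \<Rightarrow>
     nat \<Rightarrow> real \<Rightarrow> int ^ 'd \<Rightarrow> real" where
  "total_moment M X n t x = (\<integral>w. real (size (X t w)) ^ n \<partial>M x)"


section \<open>The evolution operator and its leading eigenvalue\<close>

text \<open>For a symmetric homogeneous intensity, \<open>a x y\<close> is the function \<open>a 0\<close> evaluated at \<open>x - y\<close>.\<close>

definition walk_operator ::
  "(int ^ 'd \<Rightarrow> int ^ 'd \<Rightarrow> real) \<Rightarrow> (int ^ 'd \<Rightarrow> real) \<Rightarrow> int ^ 'd \<Rightarrow> real" where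
  "walk_operator a \<phi> x = (\<Sum>\<^sub>\<infinity>y. a x y * \<phi> y)"

definition Delta0 :: "(int ^ 'd \<Rightarrow> real) \<Rightarrow> int ^ 'd \<Rightarrow> real" where
  "Delta0 \<phi> x = (if x = 0 then \<phi> 0 else 0)"

definition l2_eigenvalue :: "(('s \<Rightarrow> real) \<Rightarrow> 's \<Rightarrow> real) \<Rightarrow> real \<Rightarrow> bool" where
  "l2_eigenvalue T l \<longleftrightarrow>
     (\<exists>\<phi>. (\<exists>x. \<phi> x \<noteq> 0) \<and> (\<lambda>x. (\<phi> x)\<^sup>2) summable_on UNIV \<and> (\<forall>x. T \<phi> x = l * \<phi> x))"

text \<open>
  For an intensity as above, the operator has at most one positive eigenvalue on the square
  summable functions (it is then an isolated point of the spectrum and solves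
  \<open>beta_star b * G_l(0, 0) = 1\<close>), and exactly one when \<open>beta_star b > beta_c p\<close>.
\<close>

definition lambda_0 :: "(int ^ 'd \<Rightarrow> int ^ 'd \<Rightarrow> real) \<Rightarrow> (nat \<Rightarrow> real) \<Rightarrow> real" where
  "lambda_0 a b =
     (THE l. 0 < l \<and> l2_eigenvalue (\<lambda>\<phi> x. walk_operator a \<phi> x + beta_star b * Delta0 \<phi> x) l)"

definition lambda_E :: "(int ^ 'd \<Rightarrow> int ^ 'd \<Rightarrow> real) \<Rightarrow> (nat \<Rightarrow> real) \<Rightarrow> real" where
  "lambda_E a b = lambda_0 a b - b 0"

end

theory Submission
  imports Defs
begin

text \<open>
  Write \<open>H = A + \<beta>\<^sup>* \<Delta>\<^sub>0\<close>, \<open>\<lambda> = \<lambda>\<^sub>\<E> = \<lambda>\<^sub>0 - b\<^sub>0\<close>, and let \<open>\<phi>\<close> be either the number of particles at \<open>y\<close> or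
  the total number of particles; both are additive functionals of the configuration.

  The population born from \<open>k\<close> particles at the origin is a sum of \<open>k\<close> independent copies, so the
  \<open>n\<close>-th moment of \<open>\<phi>\<close> over it is \<open>k\<close> times the \<open>n\<close>-th moment for one particle plus products of at
  least two moments of lower order. The backward equation therefore turns into the linear equation
  \<open>m\<^sub>n' = (H - b\<^sub>0) m\<^sub>n + h\<^sub>n \<delta>\<^sub>0\<close>, in which the source \<open>h\<^sub>n\<close> involves lower moments only, and
  \<open>m\<^sub>n(t) = e\<^bsup>t(H-b\<^sub>0)\<^esup> m\<^sub>n(0) + \<integral> e\<^bsup>(t-s)(H-b\<^sub>0)\<^esup> \<delta>\<^sub>0 h\<^sub>n(s) ds\<close> over \<open>0 \<le> s \<le> t\<close> (\<open>moment_formula\<close>).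

  The kernel \<open>e\<^bsup>-t\<lambda>\<^sub>0\<^esup> e\<^bsup>tH\<^esup>\<close> converges pointwise to a positive limit (\<open>kern_converges\<close>). By
  induction all lower moments are \<open>O(e\<^bsup>\<lambda>t\<^esup>)\<close>, hence \<open>h\<^sub>n(s) = O(e\<^bsup>2\<lambda>s\<^esup>)\<close>. Here \<open>\<lambda> < 0\<close> enters:
  \<open>e\<^bsup>-\<lambda>s\<^esup> h\<^sub>n(s)\<close> is integrable, so after division by \<open>e\<^bsup>\<lambda>t\<^esup>\<close> dominated convergence gives a limit
  for every \<open>n\<close> at the same exponential rate (\<open>moment_limit\<close>). The limit is positive because
  the contribution of \<open>m\<^sub>n(0)\<close> already is.

  The kernel converges for the following reason. Summing the resolvent series of the walk at the
  \<open>\<mu>\<close> with \<open>\<beta>\<^sup>* G\<^sub>\<mu>(0,0) = 1\<close> gives a positive summable eigenvector \<open>\<psi>\<close> of \<open>H\<close> for the eigenvalue \<open>\<mu>\<close>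
  (\<open>principal_eigenvector\<close>); a maximum principle shows that every square summable eigenvector with
  positive eigenvalue has constant sign, so that its eigenvalue is that of \<open>\<psi>\<close> and \<open>\<mu> = \<lambda>\<^sub>0\<close>
  (\<open>lambda_0_principal\<close>). The normalised kernel is a symmetric semigroup that fixes \<open>\<psi>\<close>, and such
  semigroups converge because their diagonal entries decrease (\<open>symmetric_semigroup_converges\<close>). For the total number of particles the
  initial function \<open>1\<close> is not square summable, but \<open>H 1 = \<beta>\<^sup>* \<delta>\<^sub>0\<close>, which reduces \<open>e\<^bsup>tH\<^esup> 1\<close> to a
  time integral of the kernel (\<open>total_mass_limit\<close>).

  To avoid questions of convergence, all generators are shifted by a multiple of the identity that
  makes their entries nonnegative, and all equations are read in \<open>[0,\<infinity>]\<close>. That the moments are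
  finite is part of the conclusion: the truncations \<open>(min \<phi> N)\<^sup>n\<close> satisfy the moment equation as an
  inequality with the same source, and bounded subsolutions lie below the series solution (\<open>duhamel_upper_bound\<close>).
\<close>

section \<open>Nonnegative kernels and their exponentials\<close>

abbreviation nn_sum :: "('s \<Rightarrow> ennreal) \<Rightarrow> ennreal" (binder \<open>\<Sum>\<^sub>+\<close> 10) where
  "nn_sum f \<equiv> integral\<^sup>N (count_space UNIV) f"

text \<open>
  The action of the matrix \<open>B\<close> on functions; the value \<open>\<infinity>\<close> is allowed everywhere, so that sums and
  integrals commute freely.
\<close>

definition mapp :: "('s \<Rightarrow> 's \<Rightarrow> ennreal) \<Rightarrow> ('s \<Rightarrow> ennreal) \<Rightarrow> 's \<Rightarrow> ennreal" where
  "mapp B u x = (\<Sum>\<^sub>+ y. B x y * u y)"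

text \<open>
  The function \<open>e\<^bsup>tB\<^esup> u\<close>. Since \<open>ennreal\<close> cuts off negative numbers, this is meant for \<open>t \<ge> 0\<close>.
\<close>

definition mexp :: "('s \<Rightarrow> 's \<Rightarrow> ennreal) \<Rightarrow> real \<Rightarrow> ('s \<Rightarrow> ennreal) \<Rightarrow> 's \<Rightarrow> ennreal" where
  "mexp B t u x = (\<Sum>n. ennreal (t ^ n / fact n) * (mapp B ^^ n) u x)"

abbreviation delta :: "'s \<Rightarrow> 's \<Rightarrow> ennreal" where
  "delta y \<equiv> indicator {y}"

lemma mapp_mono: "(\<And>x. u x \<le> v x) \<Longrightarrow> mapp B u x \<le> mapp B v x"
  unfolding mapp_def by (intro nn_integral_mono mult_left_mono) auto

lemma mapp_add: "mapp B (\<lambda>x. u x + v x) x = mapp B u x + mapp B v x"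
  unfolding mapp_def by (simp add: distrib_left nn_integral_add)

lemma mapp_cmult: "mapp B (\<lambda>x. c * u x) = (\<lambda>x. c * mapp B u x)"
  unfolding mapp_def by (auto simp: nn_integral_cmult[symmetric] mult_ac intro!: ext nn_integral_cong)

lemma mapp_sum: "finite A \<Longrightarrow> mapp B (\<lambda>x. \<Sum>i\<in>A. u i x) x = (\<Sum>i\<in>A. mapp B (u i) x)"
  unfolding mapp_def by (simp add: sum_distrib_left nn_integral_sum)

lemma mapp_suminf: "mapp B (\<lambda>x. \<Sum>n. u n x) x = (\<Sum>n. mapp B (u n) x)"
  unfolding mapp_def by (simp add: nn_integral_suminf flip: ennreal_suminf_cmult)

text \<open>
  A sum over a countable type is a series along \<open>from_nat\<close>.
\<close>

lemma measurable_nn_integral_count_space [measurable (raw)]: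
  fixes f :: "'a \<Rightarrow> 's::countable \<Rightarrow> ennreal"
  assumes "\<And>y. (\<lambda>r. f r y) \<in> borel_measurable N"
  shows "(\<lambda>r. \<Sum>\<^sub>+ y. f r y) \<in> borel_measurable N"
proof -
  have *: "(\<Sum>\<^sub>+ y. f r y) =
      (\<Sum>\<^sub>+ n. f r (from_nat n) * indicator (range (to_nat :: 's \<Rightarrow> nat)) n)" for r
  proof -
    have "(\<Sum>\<^sub>+ y. f r y) = (\<integral>\<^sup>+ y. f r (from_nat (to_nat y)) \<partial>count_space (UNIV::'s set))"
      by simp
    also have "\<dots> = (\<integral>\<^sup>+ n. f r (from_nat n) \<partial>count_space (range (to_nat :: 's \<Rightarrow> nat)))"
      by (rule nn_integral_bij_count_space) (simp add: bij_betw_def)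
    finally show ?thesis by (simp add: nn_integral_count_space_indicator)
  qed
  show ?thesis
    unfolding * nn_integral_count_space_nat using assms by measurable
qed

lemma mapp_measurable [measurable (raw)]:
  fixes f :: "'a \<Rightarrow> 's::countable \<Rightarrow> ennreal"
  assumes "\<And>y. (\<lambda>r. f r y) \<in> borel_measurable N"
  shows "(\<lambda>r. mapp B (f r) x) \<in> borel_measurable N"
  unfolding mapp_def by (intro measurable_nn_integral_count_space) (use assms in measurable)

lemma mapp_nn_integral:
  fixes f :: "'a \<Rightarrow> 's::countable \<Rightarrow> ennreal"
  assumes [measurable]: "\<And>y. (\<lambda>r. f r y) \<in> borel_measurable N"
  shows "mapp B (\<lambda>y. \<integral>\<^sup>+ r. f r y \<partial>N) x = (\<integral>\<^sup>+ r. mapp B (f r) x \<partial>N)"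
  unfolding mapp_def
  by (subst nn_integral_count_space_nn_integral) (auto simp: nn_integral_cmult)

lemma iter_mono: "(\<And>x. u x \<le> v x) \<Longrightarrow> (mapp B ^^ n) u x \<le> (mapp B ^^ n) v x"
  by (induction n arbitrary: x) (auto intro: mapp_mono)

lemma iter_cmult: "(mapp B ^^ n) (\<lambda>x. c * u x) = (\<lambda>x. c * (mapp B ^^ n) u x)"
  by (induction n) (auto simp: mapp_cmult)

lemma iter_measurable [measurable (raw)]:
  fixes f :: "'a \<Rightarrow> 's::countable \<Rightarrow> ennreal"
  assumes "\<And>y. (\<lambda>r. f r y) \<in> borel_measurable N"
  shows "(\<lambda>r. (mapp B ^^ n) (f r) x) \<in> borel_measurable N"
  using assms by (induction n arbitrary: x) (auto intro: mapp_measurable)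

lemma mexp_measurable [measurable (raw)]:
  fixes f :: "'a \<Rightarrow> 's::countable \<Rightarrow> ennreal"
  assumes [measurable]: "\<And>y. (\<lambda>r. f r y) \<in> borel_measurable N" "\<tau> \<in> borel_measurable N"
  shows "(\<lambda>r. mexp B (\<tau> r) (f r) x) \<in> borel_measurable N"
  unfolding mexp_def by measurable

lemma iter_nn_integral:
  fixes f :: "'a \<Rightarrow> 's::countable \<Rightarrow> ennreal"
  assumes [measurable]: "\<And>y. (\<lambda>r. f r y) \<in> borel_measurable N"
  shows "(mapp B ^^ n) (\<lambda>y. \<integral>\<^sup>+ r. f r y \<partial>N) x = (\<integral>\<^sup>+ r. (mapp B ^^ n) (f r) x \<partial>N)"
proof (induction n arbitrary: x)
  case (Suc n)
  then have "(mapp B ^^ n) (\<lambda>y. \<integral>\<^sup>+ r. f r y \<partial>N) = (\<lambda>x. \<integral>\<^sup>+ r. (mapp B ^^ n) (f r) x \<partial>N)"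
    by blast
  then show ?case by (simp add: mapp_nn_integral iter_measurable)
qed simp

lemma iter_suminf: "(mapp B ^^ n) (\<lambda>x. \<Sum>k. u k x) x = (\<Sum>k. (mapp B ^^ n) (u k) x)"
proof (induction n arbitrary: x)
  case (Suc n)
  then have "(mapp B ^^ n) (\<lambda>x. \<Sum>k. u k x) = (\<lambda>x. \<Sum>k. (mapp B ^^ n) (u k) x)"
    by blast
  then show ?case by (simp add: mapp_suminf)
qed simp

lemma nn_integral_count_space_delta:
  "(\<Sum>\<^sub>+ y. u y * delta x y) = u x"
proof -
  have "(\<Sum>\<^sub>+ y. u y * delta x y) = (\<integral>\<^sup>+ y. u y \<partial>count_space {x})"
    by (simp add: nn_integral_count_space_indicator)
  then show ?thesis by (simp add: nn_integral_count_space_finite)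
qed

text \<open>
  Write \<open>u\<close> as the superposition of the unit functions \<open>delta y\<close> with weights \<open>u y\<close>.
\<close>

lemma iter_kernel:
  fixes u :: "'s::countable \<Rightarrow> ennreal"
  shows "(mapp B ^^ n) u x = (\<Sum>\<^sub>+ y. (mapp B ^^ n) (delta y) x * u y)"
proof -
  have "u = (\<lambda>x. \<Sum>\<^sub>+ y. u y * delta x y)"
    by (simp add: nn_integral_count_space_delta)
  also have "\<dots> = (\<lambda>x. \<Sum>\<^sub>+ y. u y * delta y x)"
    by (auto intro!: ext nn_integral_cong simp: indicator_def)
  finally have "(mapp B ^^ n) u x = (mapp B ^^ n) (\<lambda>x. \<Sum>\<^sub>+ y. u y * delta y x) x"
    by simp
  also have "\<dots> = (\<Sum>\<^sub>+ y. u y * (mapp B ^^ n) (delta y) x)"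
    by (subst iter_nn_integral) (auto simp: iter_cmult)
  finally show ?thesis by (simp add: mult_ac)
qed

lemma mexp_kernel:
  fixes u :: "'s::countable \<Rightarrow> ennreal"
  shows "mexp B t u x = (\<Sum>\<^sub>+ y. mexp B t (delta y) x * u y)"
  unfolding mexp_def
  by (subst iter_kernel)
     (simp add: nn_integral_suminf mult.assoc flip: nn_integral_cmult ennreal_suminf_multc)

lemma mapp_symmetric:
  fixes u v :: "'s::countable \<Rightarrow> ennreal"
  assumes "\<And>x y. B x y = B y x"
  shows "(\<Sum>\<^sub>+ x. v x * mapp B u x) = (\<Sum>\<^sub>+ x. mapp B v x * u x)"
proof -
  have "(\<Sum>\<^sub>+ x. v x * mapp B u x) =
      (\<Sum>\<^sub>+ x. \<Sum>\<^sub>+ y. v x * (B x y * u y))"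
    unfolding mapp_def by (simp add: nn_integral_cmult)
  also have "\<dots> = (\<Sum>\<^sub>+ y. \<Sum>\<^sub>+ x. v x * (B x y * u y))"
    by (rule nn_integral_count_space_nn_integral) auto
  also have "\<dots> = (\<Sum>\<^sub>+ y. (\<Sum>\<^sub>+ x. B y x * v x) * u y)"
    by (subst nn_integral_multc[symmetric]) (auto intro!: nn_integral_cong simp: mult_ac assms)
  finally show ?thesis unfolding mapp_def .
qed

lemma iter_symmetric:
  fixes u v :: "'s::countable \<Rightarrow> ennreal"
  assumes "\<And>x y. B x y = B y x"
  shows "(\<Sum>\<^sub>+ x. v x * (mapp B ^^ n) u x) =
    (\<Sum>\<^sub>+ x. (mapp B ^^ n) v x * u x)"
proof (induction n arbitrary: v)
  case (Suc n)
  have "(\<Sum>\<^sub>+ x. v x * (mapp B ^^ Suc n) u x) =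
      (\<Sum>\<^sub>+ x. mapp B v x * (mapp B ^^ n) u x)"
    using mapp_symmetric[of B v "(mapp B ^^ n) u"] assms by simp
  also have "\<dots> = (\<Sum>\<^sub>+ x. (mapp B ^^ n) (mapp B v) x * u x)"
    by (rule Suc)
  finally show ?case by (simp add: funpow_Suc_right del: funpow.simps)
qed auto

lemma iter_delta_symmetric:
  fixes x y :: "'s::countable"
  assumes "\<And>x y. B x y = B y x"
  shows "(mapp B ^^ n) (delta y) x = (mapp B ^^ n) (delta x) y"
  using iter_symmetric[OF assms, where v="delta x" and u="delta y" and n=n]
  by (simp add: nn_integral_count_space_delta mult.commute[of "delta _ _"])

lemma mexp_delta_symmetric:
  fixes x y :: "'s::countable"
  assumes "\<And>x y. B x y = B y x"
  shows "mexp B t (delta y) x = mexp B t (delta x) y"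
  unfolding mexp_def by (subst iter_delta_symmetric[OF assms]) rule

lemma suminf_swap_ennreal:
  fixes f :: "nat \<Rightarrow> nat \<Rightarrow> ennreal"
  shows "(\<Sum>n. \<Sum>m. f n m) = (\<Sum>m. \<Sum>n. f n m)"
  unfolding nn_integral_count_space_nat[symmetric]
  by (rule nn_integral_count_space_nn_integral) auto

text \<open>
  Collect the terms of the double series along the diagonals \<open>n + m = N\<close>.
\<close>

lemma suminf_convolution_ennreal:
  fixes f :: "nat \<Rightarrow> nat \<Rightarrow> ennreal"
  shows "(\<Sum>n. \<Sum>m. f n m) = (\<Sum>N. \<Sum>n\<le>N. f n (N - n))"
proof -
  have "(\<Sum>m. f n m) = (\<Sum>N. if n \<le> N then f n (N - n) else 0)" for n
    by (subst suminf_offset[where i=n and f="\<lambda>N. if n \<le> N then f n (N - n) else 0"]) auto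
  then have "(\<Sum>n. \<Sum>m. f n m) = (\<Sum>N. \<Sum>n. if n \<le> N then f n (N - n) else 0)"
    by (simp add: suminf_swap_ennreal[of "\<lambda>n N. if n \<le> N then f n (N - n) else 0"])
  moreover have "(\<Sum>n. if n \<le> N then f n (N - n) else 0) = (\<Sum>n\<le>N. f n (N - n))" for N
    by (subst suminf_finite[of "{..N}"]) auto
  ultimately show ?thesis by simp
qed

lemma mexp_add:
  assumes "0 \<le> s" "0 \<le> t"
  shows "mexp B s (mexp B t u) x = mexp B (s + t) u x"
proof -
  have "mexp B s (mexp B t u) x =
     (\<Sum>n. ennreal (s ^ n / fact n) * (\<Sum>m. ennreal (t ^ m / fact m) * (mapp B ^^ (n + m)) u x))"
    unfolding mexp_def by (simp add: iter_suminf iter_cmult funpow_add)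
  also have "\<dots> = (\<Sum>n. \<Sum>m. ennreal (s ^ n / fact n * (t ^ m / fact m)) * (mapp B ^^ (n + m)) u x)"
  proof (intro suminf_cong)
    fix n
    have "ennreal (s ^ n / fact n) * (ennreal (t ^ m / fact m) * (mapp B ^^ (n + m)) u x) =
        ennreal (s ^ n / fact n * (t ^ m / fact m)) * (mapp B ^^ (n + m)) u x" for m
      using assms by (simp only: ennreal_mult' mult.assoc zero_le_power divide_nonneg_nonneg
          fact_ge_zero)
    then show "ennreal (s ^ n / fact n) * (\<Sum>m. ennreal (t ^ m / fact m) * (mapp B ^^ (n + m)) u x) =
        (\<Sum>m. ennreal (s ^ n / fact n * (t ^ m / fact m)) * (mapp B ^^ (n + m)) u x)"
      by (simp only: ennreal_suminf_cmult[symmetric])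
  qed
  also have "\<dots> = (\<Sum>N. \<Sum>n\<le>N. ennreal (s ^ n / fact n * (t ^ (N - n) / fact (N - n))) *
      (mapp B ^^ (n + (N - n))) u x)"
    by (rule suminf_convolution_ennreal)
  also have "\<dots> = (\<Sum>N. ennreal ((s + t) ^ N / fact N) * (mapp B ^^ N) u x)"
  proof (rule suminf_cong)
    fix N
    have "(\<Sum>n\<le>N. ennreal (s ^ n / fact n * (t ^ (N - n) / fact (N - n))) * (mapp B ^^ (n + (N - n)))
        u x) =
       (\<Sum>n\<le>N. ennreal (s ^ n / fact n * (t ^ (N - n) / fact (N - n)))) * (mapp B ^^ N) u x"
      by (simp add: sum_distrib_right)
    also have "(\<Sum>n\<le>N. ennreal (s ^ n / fact n * (t ^ (N - n) / fact (N - n)))) =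
       ennreal (\<Sum>n\<le>N. s ^ n / fact n * (t ^ (N - n) / fact (N - n)))"
      using assms by (intro sum_ennreal) auto
    also have "(\<Sum>n\<le>N. s ^ n / fact n * (t ^ (N - n) / fact (N - n))) = (s + t) ^ N / fact N"
      by (simp add: binomial_ring sum_divide_distrib binomial_fact field_simps)
    finally show "(\<Sum>n\<le>N. ennreal (s ^ n / fact n * (t ^ (N - n) / fact (N - n))) * (mapp B ^^ (n +
        (N - n))) u x) =
      ennreal ((s + t) ^ N / fact N) * (mapp B ^^ N) u x" .
  qed
  finally show ?thesis unfolding mexp_def .
qed

lemma suminf_exp_ennreal: "0 \<le> t \<Longrightarrow> (\<Sum>n. ennreal (t ^ n / fact n)) = ennreal (exp t)"
  by (rule suminf_ennreal_eq) (use exp_converges[of t] in \<open>auto simp: field_simps\<close>)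

lemma mexp_eigenvector:
  assumes "\<And>x. mapp B \<psi> x = ennreal \<theta> * \<psi> x" "0 \<le> \<theta>" "0 \<le> t"
  shows "mexp B t \<psi> x = ennreal (exp (\<theta> * t)) * \<psi> x"
proof -
  have "mapp B \<psi> = (\<lambda>x. ennreal \<theta> * \<psi> x)" using assms(1) by auto
  then have iter: "(mapp B ^^ n) \<psi> = (\<lambda>x. ennreal (\<theta> ^ n) * \<psi> x)" for n
  proof (induction n)
    case (Suc n)
    then have "(mapp B ^^ Suc n) \<psi> = (\<lambda>x. ennreal (\<theta> ^ n) * mapp B \<psi> x)"
      by (simp add: mapp_cmult)
    then show ?case using assms(1,2) by (simp add: ennreal_mult' mult_ac)
  qed simp
  have "mexp B t \<psi> x = (\<Sum>n. ennreal ((\<theta> * t) ^ n / fact n) * \<psi> x)"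
  proof -
    have "ennreal (t ^ n / fact n) * (ennreal (\<theta> ^ n) * \<psi> x) = ennreal ((\<theta> * t) ^ n / fact n) *
        \<psi> x" for n
    proof -
      have "ennreal (t ^ n / fact n) * (ennreal (\<theta> ^ n) * \<psi> x) = ennreal (t ^ n / fact n * \<theta> ^ n) * \<psi> x"
        using assms by (simp only: ennreal_mult' mult.assoc zero_le_power divide_nonneg_nonneg
            fact_ge_zero)
      then show ?thesis by (simp add: power_mult_distrib mult.commute)
    qed
    then show ?thesis unfolding mexp_def iter by simp
  qed
  also have "\<dots> = (\<Sum>n. ennreal ((\<theta> * t) ^ n / fact n)) * \<psi> x"
    by (rule ennreal_suminf_multc)
  also have "(\<Sum>n. ennreal ((\<theta> * t) ^ n / fact n)) = ennreal (exp (\<theta> * t))"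
    using assms by (intro suminf_exp_ennreal) auto
  finally show ?thesis .
qed

lemma iter_const_le:
  assumes "\<And>x. mapp B (\<lambda>_. 1) x \<le> ennreal R" "0 \<le> R"
  shows "(mapp B ^^ n) (\<lambda>_. 1) x \<le> ennreal (R ^ n)"
proof (induction n arbitrary: x)
  case (Suc n)
  have "(mapp B ^^ Suc n) (\<lambda>_. 1) x \<le> mapp B (\<lambda>_. ennreal (R ^ n) * 1) x"
    by (simp, rule mapp_mono) (use Suc in simp)
  also have "\<dots> \<le> ennreal (R ^ n) * ennreal R"
    unfolding mapp_cmult by (intro mult_left_mono assms) auto
  finally show ?case using assms(2) by (simp add: ennreal_mult'' mult_ac)
qed auto

lemma nn_integral_power_Icc:
  assumes "0 \<le> t"
  shows "(\<integral>\<^sup>+ s\<in>{0..t}. ennreal (s ^ n / fact n) \<partial>lborel) = ennreal (t ^ Suc n / fact (Suc n))"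
proof -
  have "((\<lambda>s. s ^ Suc n / fact (Suc n)) has_real_derivative s ^ n / fact n) (at s)" for s :: real
    by (rule derivative_eq_intros refl | simp add: divide_simps del: of_nat_Suc)+
  then have "(\<integral>\<^sup>+ s\<in>{0..t}. ennreal (s ^ n / fact n) \<partial>lborel) =
      ennreal (t ^ Suc n / fact (Suc n) - 0 ^ Suc n / fact (Suc n))"
    using assms by (intro nn_integral_FTC_Icc) auto
  then show ?thesis by simp
qed

lemma nn_integral_shifted_power_Icc:
  assumes "r \<le> t"
  shows "(\<integral>\<^sup>+ s\<in>{r..t}. ennreal ((s - r) ^ n / fact n) \<partial>lborel) =
      ennreal ((t - r) ^ Suc n / fact (Suc n))"
proof -
  have "((\<lambda>s. (s - r) ^ Suc n / fact (Suc n)) has_real_derivative (s - r) ^ n / fact n) (at s)" for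
      s :: real
    by (rule derivative_eq_intros refl | simp add: divide_simps del: of_nat_Suc)+
  then have "(\<integral>\<^sup>+ s\<in>{r..t}. ennreal ((s - r) ^ n / fact n) \<partial>lborel) =
      ennreal ((t - r) ^ Suc n / fact (Suc n) - (r - r) ^ Suc n / fact (Suc n))"
    using assms by (intro nn_integral_FTC_Icc) auto
  then show ?thesis by simp
qed

text \<open>
  Exchange the order of integration over the triangle \<open>0 \<le> r \<le> s \<le> t\<close>. This is what one more
  time integration does to the kernel \<open>(s - r)\<^sup>n / n!\<close> in the Picard iteration.
\<close>

lemma nn_integral_convolution_power:
  fixes \<phi> :: "real \<Rightarrow> ennreal"
  assumes [measurable]: "\<phi> \<in> borel_measurable borel"
  shows "(\<integral>\<^sup>+ s\<in>{0..t}. (\<integral>\<^sup>+ r\<in>{0..s}. ennreal ((s - r) ^ n / fact n) * \<phi> r \<partial>lborel) \<partial>lborel) =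
    (\<integral>\<^sup>+ r\<in>{0..t}. ennreal ((t - r) ^ Suc n / fact (Suc n)) * \<phi> r \<partial>lborel)"
proof -
  have "(\<integral>\<^sup>+ s\<in>{0..t}. (\<integral>\<^sup>+ r\<in>{0..s}. ennreal ((s - r) ^ n / fact n) * \<phi> r \<partial>lborel) \<partial>lborel) =
     (\<integral>\<^sup>+ s. (\<integral>\<^sup>+ r. ennreal ((s - r) ^ n / fact n) * \<phi> r * of_bool (0 \<le> r \<and> r \<le> s \<and> s \<le> t) \<partial>lborel)
         \<partial>lborel)"
    by (subst nn_integral_multc[symmetric], simp)
       (auto intro!: nn_integral_cong simp: indicator_def)
  also have "\<dots> = (\<integral>\<^sup>+ r. (\<integral>\<^sup>+ s. ennreal ((s - r) ^ n / fact n) * \<phi> r * of_bool (0 \<le> r \<and> r \<le> s \<and> s \<le>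
      t) \<partial>lborel) \<partial>lborel)"
    by (rule lborel_pair.Fubini') measurable
  also have "\<dots> = (\<integral>\<^sup>+ r\<in>{0..t}. ennreal ((t - r) ^ Suc n / fact (Suc n)) * \<phi> r \<partial>lborel)"
  proof (rule nn_integral_cong)
    fix r :: real
    show "(\<integral>\<^sup>+ s. ennreal ((s - r) ^ n / fact n) * \<phi> r * of_bool (0 \<le> r \<and> r \<le> s \<and> s \<le> t) \<partial>lborel) =
      ennreal ((t - r) ^ Suc n / fact (Suc n)) * \<phi> r * indicator {0..t} r"
    proof (cases "0 \<le> r \<and> r \<le> t")
      case True
      have "(\<integral>\<^sup>+ s. ennreal ((s - r) ^ n / fact n) * \<phi> r * of_bool (0 \<le> r \<and> r \<le> s \<and> s \<le> t) \<partial>lborel) =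
        (\<integral>\<^sup>+ s. ennreal ((s - r) ^ n / fact n) * indicator {r..t} s * \<phi> r \<partial>lborel)"
        using True by (intro nn_integral_cong) (auto simp: indicator_def)
      also have "\<dots> = ennreal ((t - r) ^ Suc n / fact (Suc n)) * \<phi> r"
        using True by (subst nn_integral_multc) (simp, simp only: nn_integral_shifted_power_Icc)
      finally show ?thesis using True by simp
    next
      case False
      then have "\<not> (0 \<le> r \<and> r \<le> s \<and> s \<le> t)" for s by auto
      then have "(\<integral>\<^sup>+ s. ennreal ((s - r) ^ n / fact n) * \<phi> r * of_bool (0 \<le> r \<and> r \<le> s \<and> s \<le>
          t) \<partial>lborel) = 0"
        by (simp only: of_bool_def if_False mult_zero_right nn_integral_const) simp
      with False show ?thesis by (auto simp: indicator_def)
    qed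
  qed
  finally show ?thesis .
qed

section \<open>Variation of constants for nonnegative kernels\<close>

text \<open>
  The \<open>k\<close>-th Picard iterate, that is, the term of order \<open>k\<close> in \<open>B\<close> of the series solution of
  \<open>u(t) = g + \<integral> (B u(s) + f(s)) ds\<close>.
\<close>

definition picard :: "('s \<Rightarrow> 's \<Rightarrow> ennreal) \<Rightarrow> ('s \<Rightarrow> ennreal) \<Rightarrow> (real \<Rightarrow> 's \<Rightarrow> ennreal) \<Rightarrow> nat \<Rightarrow> real \<Rightarrow> 's
    \<Rightarrow> ennreal" where
  "picard B g f k t x = ennreal (t ^ k / fact k) * (mapp B ^^ k) g x +
     (\<integral>\<^sup>+ r\<in>{0..t}. ennreal ((t - r) ^ k / fact k) * (mapp B ^^ k) (f r) x \<partial>lborel)"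

lemma picard_measurable [measurable (raw)]:
  fixes f :: "real \<Rightarrow> 's::countable \<Rightarrow> ennreal"
  assumes [measurable]: "\<And>y. (\<lambda>r. f r y) \<in> borel_measurable borel"
  shows "(\<lambda>t. picard B g f k t x) \<in> borel_measurable borel"
proof -
  have eq: "(\<lambda>t. \<integral>\<^sup>+ r\<in>{0..t}. ennreal ((t - r) ^ k / fact k) * (mapp B ^^ k) (f r) x \<partial>lborel) =
    (\<lambda>t. \<integral>\<^sup>+ r. ennreal ((t - r) ^ k / fact k) * (mapp B ^^ k) (f r) x * of_bool (0 \<le> r \<and> r \<le>
        t) \<partial>lborel)"
    by (auto intro!: ext nn_integral_cong simp: indicator_def)
  have [measurable]: "(\<lambda>t. \<integral>\<^sup>+ r\<in>{0..t}. ennreal ((t - r) ^ k / fact k) * (mapp B ^^ k) (f r) x \<partial>lborel)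
      \<in> borel_measurable borel"
    unfolding eq by measurable
  show ?thesis unfolding picard_def by measurable
qed

lemma picard_Suc:
  fixes f :: "real \<Rightarrow> 's::countable \<Rightarrow> ennreal"
  assumes [measurable]: "\<And>y. (\<lambda>r. f r y) \<in> borel_measurable borel" and t: "0 \<le> t"
  shows "picard B g f (Suc k) t x = (\<integral>\<^sup>+ s\<in>{0..t}. mapp B (picard B g f k s) x \<partial>lborel)"
proof -
  let ?c = "\<lambda>s. (\<integral>\<^sup>+ r\<in>{0..s}. ennreal ((s - r) ^ k / fact k) * (mapp B ^^ Suc k) (f r) x \<partial>lborel)"
  have 1: "mapp B (picard B g f k s) x = ennreal (s ^ k / fact k) * (mapp B ^^ Suc k) g x + ?c s" for s
  proof -
    have "mapp B (picard B g f k s) x = mapp B (\<lambda>x. ennreal (s ^ k / fact k) * (mapp B ^^ k) g x) x +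
       mapp B (\<lambda>x. \<integral>\<^sup>+ r\<in>{0..s}. ennreal ((s - r) ^ k / fact k) * (mapp B ^^ k) (f r) x \<partial>lborel) x"
      by (subst mapp_add[symmetric]) (simp add: picard_def[abs_def])
    also have "mapp B (\<lambda>x. \<integral>\<^sup>+ r\<in>{0..s}. ennreal ((s - r) ^ k / fact k) * (mapp B ^^ k) (f r) x
        \<partial>lborel) x =
      (\<integral>\<^sup>+ r. mapp B (\<lambda>x. ennreal ((s - r) ^ k / fact k) * indicator {0..s} r * (mapp B ^^ k) (f r)
          x) x \<partial>lborel)"
      by (subst mapp_nn_integral) (measurable, simp add: mult_ac)
    finally show ?thesis by (simp add: mapp_cmult) (simp add: mult_ac)
  qed
  have [measurable]: "(\<lambda>s. ?c s) \<in> borel_measurable borel"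
  proof -
    have "(\<lambda>s. ?c s) = (\<lambda>s. \<integral>\<^sup>+ r. ennreal ((s - r) ^ k / fact k) * (mapp B ^^ Suc k) (f r) x *
        of_bool (0 \<le> r \<and> r \<le> s) \<partial>lborel)"
      by (auto intro!: ext nn_integral_cong simp: indicator_def)
    then show ?thesis by (simp only:) measurable
  qed
  have "(\<integral>\<^sup>+ s\<in>{0..t}. mapp B (picard B g f k s) x \<partial>lborel) =
    (\<integral>\<^sup>+ s. ennreal (s ^ k / fact k) * indicator {0..t} s * (mapp B ^^ Suc k) g x +
        ?c s * indicator {0..t} s \<partial>lborel)"
    by (intro nn_integral_cong) (simp add: 1 split: split_indicator)
  also have "\<dots> = (\<integral>\<^sup>+ s. ennreal (s ^ k / fact k) * indicator {0..t} s * (mapp B ^^ Suc k) g x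
      \<partial>lborel) +
    (\<integral>\<^sup>+ s\<in>{0..t}. ?c s \<partial>lborel)"
    by (rule nn_integral_add) measurable
  also have "(\<integral>\<^sup>+ s. ennreal (s ^ k / fact k) * indicator {0..t} s * (mapp B ^^ Suc k) g x \<partial>lborel) =
     ennreal (t ^ Suc k / fact (Suc k)) * (mapp B ^^ Suc k) g x"
    by (subst nn_integral_multc) (measurable, simp only: nn_integral_power_Icc t)
  also have "(\<integral>\<^sup>+ s\<in>{0..t}. ?c s \<partial>lborel) =
     (\<integral>\<^sup>+ r\<in>{0..t}. ennreal ((t - r) ^ Suc k / fact (Suc k)) * (mapp B ^^ Suc k) (f r) x \<partial>lborel)"
    by (rule nn_integral_convolution_power) measurable
  finally show ?thesis by (simp only: picard_def[where k="Suc k"])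
qed

lemma sum_picard_step:
  fixes f :: "real \<Rightarrow> 's::countable \<Rightarrow> ennreal"
  assumes [measurable]: "\<And>y. (\<lambda>r. f r y) \<in> borel_measurable borel" and t: "0 \<le> t"
  shows "g x + (\<integral>\<^sup>+ s\<in>{0..t}. (mapp B (\<lambda>y. \<Sum>k<n. picard B g f k s y) x + f s x) \<partial>lborel) =
    (\<Sum>k<Suc n. picard B g f k t x)"
proof -
  have "(\<integral>\<^sup>+ s\<in>{0..t}. (mapp B (\<lambda>y. \<Sum>k<n. picard B g f k s y) x + f s x) \<partial>lborel) =
      (\<integral>\<^sup>+ s. (\<Sum>k<n. mapp B (picard B g f k s) x * indicator {0..t} s) + f s x * indicator {0..t} s
          \<partial>lborel)"
    by (auto intro!: nn_integral_cong simp: mapp_sum distrib_right sum_distrib_right)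
  also have "\<dots> = (\<Sum>k<n. picard B g f (Suc k) t x) + (\<integral>\<^sup>+ s\<in>{0..t}. f s x \<partial>lborel)"
  proof -
    have m: "(\<lambda>s. mapp B (picard B g f k s) x * indicator {0..t} s) \<in> borel_measurable lborel" for k
      by measurable
    have "(\<integral>\<^sup>+ s. (\<Sum>k<n. mapp B (picard B g f k s) x * indicator {0..t} s) \<partial>lborel) =
        (\<Sum>k<n. picard B g f (Suc k) t x)"
      by (simp only: nn_integral_sum[OF m] picard_Suc[where f=f, OF assms(1) t])
    then show ?thesis
      by (subst nn_integral_add) (use m in \<open>auto intro!: borel_measurable_sum\<close>)
  qed
  finally show ?thesis
    by (simp add: sum.lessThan_Suc_shift picard_def[where k=0] add_ac del: sum.lessThan_Suc)
qed

lemma suminf_picard: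
  fixes f :: "real \<Rightarrow> 's::countable \<Rightarrow> ennreal"
  assumes [measurable]: "\<And>y. (\<lambda>r. f r y) \<in> borel_measurable borel"
  shows "(\<Sum>k. picard B g f k t x) =
    mexp B t g x + (\<integral>\<^sup>+ r\<in>{0..t}. mexp B (t - r) (f r) x \<partial>lborel)"
proof -
  have "(\<integral>\<^sup>+ r\<in>{0..t}. mexp B (t - r) (f r) x \<partial>lborel) =
    (\<integral>\<^sup>+ r. (\<Sum>k. ennreal ((t - r) ^ k / fact k) * (mapp B ^^ k) (f r) x * indicator {0..t} r) \<partial>lborel)"
    unfolding mexp_def by (simp only: ennreal_suminf_multc)
  also have "\<dots> = (\<Sum>k. \<integral>\<^sup>+ r\<in>{0..t}. ennreal ((t - r) ^ k / fact k) * (mapp B ^^ k) (f r) x \<partial>lborel)"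
    by (rule nn_integral_suminf) measurable
  finally show ?thesis unfolding picard_def mexp_def by (simp add: suminf_add)
qed

text \<open>
  Iterating the inequality puts every partial sum of the Picard series below \<open>U\<close>. The bound holds
  even if \<open>U\<close> takes the value \<open>\<infinity>\<close>.
\<close>

lemma duhamel_lower_bound:
  fixes U f :: "real \<Rightarrow> 's::countable \<Rightarrow> ennreal"
  assumes [measurable]: "\<And>x. (\<lambda>t. U t x) \<in> borel_measurable borel"
      "\<And>x. (\<lambda>t. f t x) \<in> borel_measurable borel"
    and U: "\<And>t x. 0 \<le> t \<Longrightarrow>
      g x + (\<integral>\<^sup>+ s\<in>{0..t}. (mapp B (U s) x + f s x) \<partial>lborel) \<le> U t x"
    and t: "0 \<le> t"
  shows "mexp B t g x + (\<integral>\<^sup>+ r\<in>{0..t}. mexp B (t - r) (f r) x \<partial>lborel) \<le> U t x"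
proof -
  have le: "(\<Sum>k<n. picard B g f k t x) \<le> U t x" if "0 \<le> t" for n t x
    using that
  proof (induction n arbitrary: t x)
    case (Suc n)
    have "(\<Sum>k<Suc n. picard B g f k t x) =
       g x + (\<integral>\<^sup>+ s\<in>{0..t}. (mapp B (\<lambda>y. \<Sum>k<n. picard B g f k s y) x + f s x) \<partial>lborel)"
      by (rule sum_picard_step[where f=f, OF assms(2) Suc.prems, symmetric])
    also have "\<dots> \<le> g x + (\<integral>\<^sup>+ s\<in>{0..t}. (mapp B (U s) x + f s x) \<partial>lborel)"
      by (intro add_mono nn_integral_mono order_refl)
         (auto simp: indicator_def intro!: mapp_mono Suc.IH add_mono)
    also have "\<dots> \<le> U t x" by (rule U) (fact Suc.prems)
    finally show ?case .
  qed simp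
  have "(\<Sum>k. picard B g f k t x) \<le> U t x"
    by (intro suminf_le_const summableI le t)
  then show ?thesis
    by (simp only: suminf_picard[where f=f, OF assms(2)])
qed

text \<open>
  After \<open>n\<close> iterations the bound \<open>K\<close> contributes the error \<open>K (R t)\<^sup>n / n!\<close>, which tends to 0. An
  infinite \<open>U\<close> can satisfy the hypothesis on \<open>U\<close> without the conclusion, so some bound is necessary.
\<close>

lemma duhamel_upper_bound:
  fixes U f :: "real \<Rightarrow> 's::countable \<Rightarrow> ennreal"
  assumes [measurable]: "\<And>x. (\<lambda>t. U t x) \<in> borel_measurable borel"
      "\<And>x. (\<lambda>t. f t x) \<in> borel_measurable borel"
    and U: "\<And>t x. 0 \<le> t \<Longrightarrow>
      U t x \<le> g x + (\<integral>\<^sup>+ s\<in>{0..t}. (mapp B (U s) x + f s x) \<partial>lborel)"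
    and K: "\<And>t x. 0 \<le> t \<Longrightarrow> t \<le> T \<Longrightarrow> U t x \<le> ennreal K" "0 \<le> K"
    and R: "\<And>x. mapp B (\<lambda>_. 1) x \<le> ennreal R" "0 \<le> R"
    and t: "0 \<le> t" "t \<le> T"
  shows "U t x \<le> mexp B t g x + (\<integral>\<^sup>+ r\<in>{0..t}. mexp B (t - r) (f r) x \<partial>lborel)"
proof -
  define rest where "rest n t = ennreal (K * (R ^ n * (t ^ n / fact n)))" for n t
  have bound: "U t x \<le> (\<Sum>k<n. picard B g f k t x) + rest n t" if "0 \<le> t" "t \<le> T" for n t x
    using that
  proof (induction n arbitrary: t x)
    case 0
    then show ?case using K by (simp add: rest_def)
  next
    case (Suc n)
    have "U t x \<le> g x + (\<integral>\<^sup>+ s\<in>{0..t}. (mapp B (U s) x + f s x) \<partial>lborel)"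
      by (rule U) (fact Suc.prems)
    also have "\<dots> \<le> g x + (\<integral>\<^sup>+ s\<in>{0..t}. (mapp B (\<lambda>y. (\<Sum>k<n. picard B g f k s y) + rest n s) x +
        f s x) \<partial>lborel)"
      using Suc.prems by (intro add_mono nn_integral_mono order_refl)
         (auto simp: indicator_def intro!: mapp_mono Suc.IH add_mono)
    also have "\<dots> \<le> g x + (\<integral>\<^sup>+ s. (mapp B (\<lambda>y. \<Sum>k<n. picard B g f k s y) x + f s x) * indicator
        {0..t} s +
       ennreal (K * R ^ Suc n) * (ennreal (s ^ n / fact n) * indicator {0..t} s) \<partial>lborel)"
    proof (intro add_mono nn_integral_mono order_refl)
      fix s
      show "(mapp B (\<lambda>y. (\<Sum>k<n. picard B g f k s y) + rest n s) x + f s x) * indicator {0..t} s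
         \<le> (mapp B (\<lambda>y. \<Sum>k<n. picard B g f k s y) x + f s x) * indicator {0..t} s +
            ennreal (K * R ^ Suc n) * (ennreal (s ^ n / fact n) * indicator {0..t} s)"
      proof (cases "s \<in> {0..t}")
        case True
        have "mapp B (\<lambda>y. rest n s * 1) x \<le> rest n s * ennreal R"
          unfolding mapp_cmult by (intro mult_left_mono R) auto
        also have "\<dots> = ennreal (K * R ^ Suc n) * ennreal (s ^ n / fact n)"
          using True K R by (simp add: rest_def ennreal_mult'[symmetric] mult_ac)
        finally show ?thesis using True by (simp add: mapp_add add_ac add_mono)
      qed simp
    qed
    also have "\<dots> = (g x + (\<integral>\<^sup>+ s\<in>{0..t}. (mapp B (\<lambda>y. \<Sum>k<n. picard B g f k s y) x + f s x) \<partial>lborel)) +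
        ennreal (K * R ^ Suc n) * ennreal (t ^ Suc n / fact (Suc n))"
    proof -
      have m1: "(\<lambda>s. (mapp B (\<lambda>y. \<Sum>k<n. picard B g f k s y) x + f s x) * indicator {0..t} s) \<in>
          borel_measurable lborel"
        by measurable
      have m: "(\<lambda>s. ennreal (s ^ n / fact n) * indicator {0..t} s) \<in> borel_measurable lborel"
        by measurable
      have m2: "(\<lambda>s. ennreal (K * R ^ Suc n) * (ennreal (s ^ n / fact n) * indicator {0..t} s)) \<in>
          borel_measurable lborel"
        by measurable
      have "(\<integral>\<^sup>+ s. ennreal (K * R ^ Suc n) * (ennreal (s ^ n / fact n) * indicator {0..t} s) \<partial>lborel) =
          ennreal (K * R ^ Suc n) * ennreal (t ^ Suc n / fact (Suc n))"
        by (simp only: nn_integral_cmult[OF m] nn_integral_power_Icc[OF Suc.prems(1)])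
      then show ?thesis by (simp only: nn_integral_add[OF m1 m2] add.assoc)
    qed
    also have "\<dots> = (\<Sum>k<Suc n. picard B g f k t x) + rest (Suc n) t"
    proof -
      have "ennreal (K * R ^ Suc n) * ennreal (t ^ Suc n / fact (Suc n)) = rest (Suc n) t"
        unfolding rest_def using K(2) R(2) by (subst ennreal_mult'[symmetric]) (auto simp: mult.assoc)
      then show ?thesis
        using sum_picard_step[where f=f and g=g and B=B and n=n and x=x, OF assms(2) Suc.prems(1)]
            by (simp only:)
    qed
    finally show ?case .
  qed
  note le = bound[OF t]
  have "(\<lambda>n. \<Sum>k<n. picard B g f k t x) \<longlonglongrightarrow> (\<Sum>k. picard B g f k t x)"
    by (rule summable_LIMSEQ[OF summableI])
  moreover have "(\<lambda>n. rest n t) \<longlonglongrightarrow> ennreal (K * 0)"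
  proof -
    have "(\<lambda>n. (R * t) ^ n / fact n) \<longlonglongrightarrow> 0"
      using summable_LIMSEQ_zero[OF summable_exp[of "R * t"]] by (simp add: field_simps)
    then have "(\<lambda>n. K * ((R * t) ^ n / fact n)) \<longlonglongrightarrow> K * 0"
      by (intro tendsto_intros)
    then show ?thesis
      unfolding rest_def by (intro tendsto_ennrealI) (simp add: power_mult_distrib)
  qed
  ultimately have "(\<lambda>n. (\<Sum>k<n. picard B g f k t x) + rest n t) \<longlonglongrightarrow> (\<Sum>k. picard B g f k t x) +
      ennreal (K * 0)"
    by (intro tendsto_intros)
  then have "U t x \<le> (\<Sum>k. picard B g f k t x) + ennreal (K * 0)"
    by (rule LIMSEQ_le_const) (intro exI allI impI le)
  then show ?thesis by (simp only: suminf_picard[where f=f, OF assms(2)] mult_zero_right ennreal_0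
      add_0_right)
qed

section \<open>Convergence of symmetric semigroups with a fixed vector\<close>

text \<open>
  If \<open>d\<close> increased somewhere, midpoint convexity would propagate at least the same increment along
  an arithmetic progression, and \<open>d\<close> would be unbounded.
\<close>

lemma midpoint_convex_bounded_imp_antimono:
  fixes d :: "real \<Rightarrow> real"
  assumes mid: "\<And>s t. 0 \<le> s \<Longrightarrow> 0 \<le> t \<Longrightarrow> 2 * d (s + t) \<le> d (2 * s) + d (2 * t)"
    and bd: "\<And>t. 0 \<le> t \<Longrightarrow> d t \<le> C"
    and st: "0 \<le> s" "s \<le> t"
  shows "d t \<le> d s"
proof (rule ccontr)
  assume "\<not> d t \<le> d s"
  then have gap: "0 < d t - d s" by simp
  have mid': "2 * d (u / 2 + v / 2) \<le> d u + d v" if "0 \<le> u" "0 \<le> v" for u v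
    using mid[of "u / 2" "v / 2"] that by simp
  define c where "c n = d (s + real n * (t - s))" for n
  have nonneg: "0 \<le> s + real n * (t - s)" for n using st by simp
  have step: "d t - d s \<le> c (Suc n) - c n" for n
  proof (induction n)
    case (Suc n)
    have "s + real (Suc n) * (t - s) = (s + real n * (t - s)) / 2 + (s + real (Suc (Suc n)) *
        (t - s)) / 2"
      by (simp add: field_simps)
    then have "2 * c (Suc n) \<le> c n + c (Suc (Suc n))"
      using mid'[OF nonneg[of n] nonneg[of "Suc (Suc n)"]] by (simp only: c_def)
    with Suc show ?case by simp
  qed (simp add: c_def)
  have lin: "c 0 + real n * (d t - d s) \<le> c n" for n
  proof (induction n)
    case (Suc n)
    then show ?case using step[of n] by (simp add: algebra_simps)
  qed simp
  obtain n :: nat where "C - c 0 < real n * (d t - d s)"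
    using reals_Archimedean3[OF gap] by blast
  moreover have "c n \<le> C" unfolding c_def using nonneg bd by blast
  ultimately show False using lin[of n] by simp
qed

text \<open>
  The idea is that of self-adjoint contraction semigroups. With \<open>d t = k t y y\<close>, symmetry and the
  semigroup property give \<open>d (s + t) = \<Sum>\<^sub>x k s x y * k t x y\<close>. Hence \<open>d\<close> is midpoint convex; it is at
  most 1 since \<open>k t\<close> fixes the positive function \<open>\<psi>\<close>, so it decreases to a limit, and
  \<open>\<Sum>\<^sub>x (k s x y - k t x y)\<^sup>2 = d (2 s) + d (2 t) - 2 d (s + t)\<close> tends to 0. The Cauchy-Schwarz
  inequality with \<open>\<psi>\<close> keeps \<open>d\<close> away from 0, and irreducibility carries the lower bound from the
  diagonal to all entries.
\<close>

lemma symmetric_semigroup_converges: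
  fixes k :: "real \<Rightarrow> 's \<Rightarrow> 's \<Rightarrow> real" and \<psi> :: "'s \<Rightarrow> real"
  assumes nonneg: "\<And>t x y. 0 \<le> t \<Longrightarrow> 0 \<le> k t x y"
    and sym: "\<And>t x y. 0 \<le> t \<Longrightarrow> k t x y = k t y x"
    and semigroup: "\<And>s t x y. 0 \<le> s \<Longrightarrow> 0 \<le> t \<Longrightarrow> ((\<lambda>z. k s x z * k t z y) has_sum k (s + t) x y) UNIV"
    and inv: "\<And>t x. 0 \<le> t \<Longrightarrow> ((\<lambda>z. k t x z * \<psi> z) has_sum \<psi> x) UNIV"
    and pos: "\<And>x. 0 < \<psi> x"
    and l2: "(\<lambda>x. (\<psi> x)\<^sup>2) summable_on UNIV"
    and irred: "\<And>x y. \<exists>t\<ge>0. 0 < k t x y"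
  shows "\<exists>L>0. ((\<lambda>t. k t x y) \<longlongrightarrow> L) at_top"
proof -
  define d where "d t = k t y y" for t
  have bd: "d t \<le> 1" if "0 \<le> t" for t
  proof -
    have "k t y y * \<psi> y \<le> \<psi> y"
    proof (rule has_sum_mono_neutral)
      show "((\<lambda>z. k t y z * \<psi> z) has_sum k t y y * \<psi> y) {y}"
        by (rule has_sum_finiteI) auto
      show "((\<lambda>z. k t y z * \<psi> z) has_sum \<psi> y) UNIV" using inv that by blast
    qed (use nonneg[OF that] less_imp_le[OF pos] in \<open>auto intro!: mult_nonneg_nonneg\<close>)
    then show ?thesis using pos[of y] by (simp add: d_def)
  qed
  have prod: "((\<lambda>x. k s x y * k t x y) has_sum d (s + t)) UNIV" if "0 \<le> s" "0 \<le> t" for s t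
    using semigroup[OF that, of y y] sym[OF that(1)] by (simp add: d_def)
  have diff: "((\<lambda>x. (k s x y - k t x y)\<^sup>2) has_sum (d (2 * s) + d (2 * t) - 2 * d (s + t))) UNIV"
    if "0 \<le> s" "0 \<le> t" for s t
  proof -
    have "((\<lambda>x. (k s x y * k s x y + k t x y * k t x y) + (- 2) * (k s x y * k t x y)) has_sum
       ((d (s + s) + d (t + t)) + (- 2) * d (s + t))) UNIV"
      using that by (intro has_sum_add prod has_sum_cmult_right) auto
    moreover have "(k s x y - k t x y)\<^sup>2 = (k s x y * k s x y + k t x y * k t x y) +
        (- 2) * (k s x y * k t x y)" for x
      by (simp add: power2_eq_square algebra_simps)
    moreover have "d (2 * s) + d (2 * t) - 2 * d (s + t) = (d (s + s) + d (t + t)) + (- 2) * d (s + t)"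
      by simp
    ultimately show ?thesis by (simp only:)
  qed
  have mono: "d t \<le> d s" if "0 \<le> s" "s \<le> t" for s t
  proof (rule midpoint_convex_bounded_imp_antimono[OF _ bd that])
    show "2 * d (s + t) \<le> d (2 * s) + d (2 * t)" if "0 \<le> s" "0 \<le> t" for s t
      using has_sum_nonneg[OF diff[OF that]] by simp
  qed
  have d0: "0 \<le> d t" if "0 \<le> t" for t using nonneg that by (simp add: d_def)
  define S where "S = (\<Sum>\<^sub>\<infinity>x. (\<psi> x)\<^sup>2)"
  have S: "((\<lambda>x. (\<psi> x)\<^sup>2) has_sum S) UNIV" unfolding S_def using l2 by simp
  have Spos: "0 < S"
  proof -
    have "(\<psi> y)\<^sup>2 \<le> S"
      by (rule has_sum_mono_neutral[OF _ S, of _ "{y}"]) (auto intro: has_sum_finiteI)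
    then show ?thesis using pos[of y] by (smt (verit) zero_less_power2)
  qed
  have lower: "(\<psi> y)\<^sup>2 / S \<le> d (2 * t)" if "0 \<le> t" for t
  proof -
    \<comment> \<open>The weight that is optimal in \<open>2 e k \<psi> \<le> k\<^sup>2 + e\<^sup>2 \<psi>\<^sup>2\<close> after summation.\<close>
    define e where "e = \<psi> y / S"
    have a: "((\<lambda>x. k t x y * k t x y + e\<^sup>2 * (\<psi> x)\<^sup>2) has_sum (d (t + t) + e\<^sup>2 * S)) UNIV"
      using that S by (intro has_sum_add prod has_sum_cmult_right) auto
    have b: "((\<lambda>x. (2 * e) * (k t y x * \<psi> x)) has_sum (2 * e) * \<psi> y) UNIV"
      using inv[OF that] by (intro has_sum_cmult_right)
    have "(2 * e) * \<psi> y \<le> d (t + t) + e\<^sup>2 * S"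
    proof (rule has_sum_mono[OF b a])
      fix x
      have "0 \<le> (k t x y - e * \<psi> x)\<^sup>2" by simp
      then show "2 * e * (k t y x * \<psi> x) \<le> k t x y * k t x y + e\<^sup>2 * (\<psi> x)\<^sup>2"
        using sym[OF that, of x y] by (simp add: power2_eq_square algebra_simps)
    qed
    moreover have "(2 * e) * \<psi> y - e\<^sup>2 * S = (\<psi> y)\<^sup>2 / S"
      using Spos by (simp add: e_def power2_eq_square field_simps)
    moreover have "t + t = 2 * t" by simp
    ultimately show ?thesis by (simp only:)
  qed
  define c where "c = Inf (d ` {0..})"
  have bdd: "bdd_below (d ` {0..})" using d0 by (intro bdd_belowI[of _ 0]) auto
  have dlim: "(d \<longlongrightarrow> c) at_top"
  proof (rule order_tendstoI)
    fix a assume "a < c"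
    have "c \<le> d t" if "0 \<le> t" for t unfolding c_def by (rule cInf_lower[OF _ bdd]) (use that in auto)
    then show "\<forall>\<^sub>F t in at_top. a < d t"
      using \<open>a < c\<close> by (intro eventually_at_top_linorderI[of 0]) (meson less_le_trans)
  next
    fix a assume "c < a"
    then obtain t0 where "0 \<le> t0" "d t0 < a"
      unfolding c_def using cInf_lessD[of "d ` {0..}" a] by auto
    then show "\<forall>\<^sub>F t in at_top. d t < a"
      using mono by (intro eventually_at_top_linorderI[of t0]) (meson le_less_trans)
  qed
  have sq: "(k s x y - k t x y)\<^sup>2 \<le> d (2 * s) + d (2 * t) - 2 * d (s + t)" if "0 \<le> s" "0 \<le> t" for s t x
    by (rule has_sum_mono_neutral[OF _ diff[OF that], of _ "{x}"]) (auto intro: has_sum_finiteI)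
  have c_le: "c \<le> d t" if "0 \<le> t" for t unfolding c_def
      by (rule cInf_lower[OF _ bdd]) (use that in auto)
  have conv: "\<exists>L. ((\<lambda>t. k t x y) \<longlongrightarrow> L) at_top" for x
  proof -
    have "cauchy_filter (filtermap (\<lambda>t. k t x y) at_top)"
      unfolding cauchy_filter_metric_filtermap
    proof (intro allI impI)
      fix e :: real assume "0 < e"
      then have "\<forall>\<^sub>F t in at_top. d t < c + e\<^sup>2 / 2"
        by (intro order_tendstoD(2)[OF dlim]) auto
      then obtain T where T: "\<And>t. T \<le> t \<Longrightarrow> d t < c + e\<^sup>2 / 2"
        by (auto simp: eventually_at_top_linorder)
      show "\<exists>P. eventually P at_top \<and> (\<forall>s t. P s \<and> P t \<longrightarrow> dist (k s x y) (k t x y) < e)"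
      proof (intro exI conjI allI impI)
        show "\<forall>\<^sub>F t in at_top. max 0 T \<le> t" by (rule eventually_ge_at_top)
        fix s t assume st: "max 0 T \<le> s \<and> max 0 T \<le> t"
        then have "(k s x y - k t x y)\<^sup>2 \<le> d (2 * s) + d (2 * t) - 2 * d (s + t)" by (intro sq) auto
        also have "\<dots> < (c + e\<^sup>2 / 2) + (c + e\<^sup>2 / 2) - 2 * c"
          using T[of "2 * s"] T[of "2 * t"] c_le[of "s + t"] st by auto
        finally have "(k s x y - k t x y)\<^sup>2 < e\<^sup>2" by simp
        then show "dist (k s x y) (k t x y) < e"
          using \<open>0 < e\<close> power2_less_imp_less[of "\<bar>k s x y - k t x y\<bar>" e] by (simp add: dist_real_def)
      qed
    qed
    then obtain L where "filtermap (\<lambda>t. k t x y) at_top \<le> nhds L"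
      using cauchy_filter_complete_converges[of "filtermap (\<lambda>t. k t x y) at_top" UNIV] 
      by (auto simp: complete_UNIV filtermap_bot_iff)
    then show ?thesis by (auto simp: filterlim_def)
  qed
  have cpos: "0 < c"
  proof -
    have "(\<psi> y)\<^sup>2 / S \<le> c"
      unfolding c_def
    proof (rule cInf_greatest)
      fix a assume "a \<in> d ` {0..}"
      then obtain t where "0 \<le> t" "a = d t" by auto
      then show "(\<psi> y)\<^sup>2 / S \<le> a" using lower[of "t / 2"] by simp
    qed simp
    moreover have "0 < (\<psi> y)\<^sup>2 / S" using Spos pos[of y] by simp
    ultimately show ?thesis by linarith
  qed
  obtain L where L: "((\<lambda>t. k t x y) \<longlongrightarrow> L) at_top" using conv by blast
  obtain r where r: "0 \<le> r" "0 < k r x y" using irred by blast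
  have "\<forall>\<^sub>F t in at_top. k r x y * c \<le> k t x y"
  proof (rule eventually_at_top_linorderI)
    fix t assume t: "r \<le> t"
    then have "k r x y * c \<le> k r x y * k (t - r) y y"
      using c_le[of "t - r"] r by (intro mult_left_mono) (auto simp: d_def)
    also have "\<dots> \<le> k (r + (t - r)) x y"
      by (rule has_sum_mono_neutral[OF _ semigroup, of _ "{y}"])
         (use t r nonneg in \<open>auto intro: has_sum_finiteI\<close>)
    finally show "k r x y * c \<le> k t x y" by simp
  qed
  then have "k r x y * c \<le> L"
    by (intro tendsto_lowerbound[OF L]) auto
  with r cpos L show ?thesis by (meson less_le_trans mult_pos_pos)
qed

section \<open>The backward equation of a conservative jump process\<close>

lemma integrable_pmf_bounded:
  fixes f :: "'s \<Rightarrow> real"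
  assumes "\<And>w. \<bar>f w\<bar> \<le> K"
  shows "integrable (measure_pmf p) f"
  by (rule measure_pmf.integrable_const_bound[where B=K]) (use assms in auto)

text \<open>
  Apply the lower bound \<open>pmf p v * f v\<close> on the expectation to \<open>f\<close> and to \<open>K - f\<close>.
\<close>

lemma pmf_expectation_near_point:
  fixes f :: "'s \<Rightarrow> real"
  assumes "\<And>w. 0 \<le> f w" "\<And>w. f w \<le> K"
  shows "\<bar>measure_pmf.expectation p f - f v\<bar> \<le> K * (1 - pmf p v)"
proof -
  have lower: "h v - K * (1 - pmf p v) \<le> measure_pmf.expectation p h"
    if h: "\<And>w. 0 \<le> h w" "\<And>w. h w \<le> K" for h :: "'s \<Rightarrow> real"
  proof -
    have "h v * (1 - pmf p v) \<le> K * (1 - pmf p v)"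
      using h[of v] by (intro mult_right_mono) (auto simp: pmf_le_1)
    then have "h v - K * (1 - pmf p v) \<le> h v * pmf p v"
      by (simp add: algebra_simps)
    also have "\<dots> = measure_pmf.expectation p (\<lambda>w. h v * indicator {v} w)"
      by (simp add: measure_pmf_single)
    also have "\<dots> \<le> measure_pmf.expectation p h"
      using h by (intro integral_mono integrable_pmf_bounded[where K=K])
        (auto simp: indicator_def abs_le_iff intro: order_trans)
    finally show ?thesis .
  qed
  have i: "integrable (measure_pmf p) f"
    using assms by (intro integrable_pmf_bounded[where K=K]) (auto simp: abs_le_iff intro: order_trans)
  have "(K - f v) - K * (1 - pmf p v) \<le> measure_pmf.expectation p (\<lambda>w. K - f w)"
    by (rule lower) (use assms in auto)
  also have "\<dots> = K - measure_pmf.expectation p f"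
    using i by simp
  finally have "measure_pmf.expectation p f \<le> f v + K * (1 - pmf p v)" by simp
  moreover have "f v - K * (1 - pmf p v) \<le> measure_pmf.expectation p f"
    by (rule lower) (use assms in auto)
  ultimately show ?thesis by linarith
qed

lemma expectation_bind_pmf:
  fixes f :: "'s \<Rightarrow> real"
  assumes "\<And>w. 0 \<le> f w" "\<And>w. f w \<le> K"
  shows "measure_pmf.expectation (bind_pmf p N) f = measure_pmf.expectation p
      (\<lambda>w. measure_pmf.expectation (N w) f)"
proof -
  have bd: "\<And>w. \<bar>f w\<bar> \<le> K" using assms by (auto simp: abs_le_iff intro: order_trans)
  have nn: "ennreal (measure_pmf.expectation q f) = (\<integral>\<^sup>+ w. ennreal (f w) \<partial>q)" for q
    using integrable_pmf_bounded[OF bd] assms by (intro nn_integral_eq_integral[symmetric]) auto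
  have le: "measure_pmf.expectation q f \<le> K" for q
    using measure_pmf.integral_le_const[OF integrable_pmf_bounded[OF bd], where c=K] assms by auto
  have ge: "0 \<le> measure_pmf.expectation q f" for q using assms by simp
  have "ennreal (measure_pmf.expectation (bind_pmf p N) f) =
      (\<integral>\<^sup>+ w. ennreal (measure_pmf.expectation (N w) f) \<partial>p)"
    by (simp add: nn)
  also have "\<dots> = ennreal (measure_pmf.expectation p (\<lambda>w. measure_pmf.expectation (N w) f))"
    using le ge by (intro nn_integral_eq_integral integrable_pmf_bounded[where K=K]) (auto simp:
        abs_le_iff intro: order_trans[OF _ ge])
  finally show ?thesis using ge by (subst (asm) ennreal_inj) (auto intro!: integral_nonneg)
qed

text \<open>
  The argument of Scheffe's lemma: the difference quotients and their pointwise limit \<open>r\<close> have the same sum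
  \<open>\<kappa>\<close>, so the sum of the absolute differences is twice the sum of the positive parts of
  \<open>r - rh\<close>. These are dominated by \<open>r\<close> off the diagonal, because \<open>rh\<close> is nonnegative there.
\<close>

lemma rates_converge_in_mean:
  fixes P :: "real \<Rightarrow> 's::countable \<Rightarrow> 's pmf"
  assumes rate: "\<And>v. jump_rate P u v (r v - (if v = u then \<kappa> else 0))"
    and r0: "\<And>v. 0 \<le> r v"
    and rsum: "(\<Sum>\<^sub>+ v. ennreal (r v)) = ennreal \<kappa>" "0 \<le> \<kappa>"
  shows "((\<lambda>h. \<integral> v. \<bar>pmf (P h u) v / h + (if v = u then \<kappa> - 1 / h else 0) - r v\<bar> \<partial>count_space UNIV) \<longlongrightarrow> 0)
    (at_right 0)"
proof -
  define rh where "rh h v = pmf (P h u) v / h + (if v = u then \<kappa> - 1 / h else 0)" for h v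
  have int_r: "integrable (count_space UNIV) r" and sum_r: "integral\<^sup>L (count_space UNIV) r = \<kappa>"
    using integrableI_nn_integral_finite[OF _ _ rsum(1)] integral_eq_nn_integral[of r "count_space
        UNIV"] r0 rsum
    by auto
  have int_ind: "integrable (count_space UNIV) (\<lambda>v. if v = u then c else (0::real))" and
    sum_ind: "(\<integral> v. (if v = u then c else (0::real)) \<partial>count_space UNIV) = c" for c
  proof -
    have "(\<lambda>v. if v = u then c else (0::real)) = (\<lambda>v. indicator {u} v * c)"
        by (auto simp: indicator_def)
    then show "integrable (count_space UNIV) (\<lambda>v. if v = u then c else (0::real))"
      "(\<integral> v. (if v = u then c else (0::real)) \<partial>count_space UNIV) = c" by auto
  qed
  have int_p: "integrable (count_space UNIV) (pmf p)" for p :: "'s pmf"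
    by (rule integrable_pmf)
  have int_rh: "integrable (count_space UNIV) (rh h)" and sum_rh: "integral\<^sup>L (count_space UNIV)
      (rh h) = \<kappa>" if "0 < h" for h
  proof -
    show "integrable (count_space UNIV) (rh h)" unfolding rh_def[abs_def]
      by (intro Bochner_Integration.integrable_add integrable_divide int_p int_ind)
    have "integral\<^sup>L (count_space UNIV) (rh h) = (\<integral> v. pmf (P h u) v / h \<partial>count_space UNIV) +
        (\<kappa> - 1 / h)"
      unfolding rh_def[abs_def]
      by (subst Bochner_Integration.integral_add) (auto simp: int_ind sum_ind intro!:
          integrable_divide int_p)
    then show "integral\<^sup>L (count_space UNIV) (rh h) = \<kappa>" by (simp add: integral_pmf)
  qed
  have ptw: "((\<lambda>h. rh h v) \<longlongrightarrow> r v) (at_right 0)" for v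
  proof -
    have "((\<lambda>h. (pmf (P h u) v - ((if v = u then 1 else 0) + (r v - (if v = u then \<kappa> else 0)) * h))
        / h) \<longlongrightarrow> 0) (at_right 0)"
      using rate[of v] unfolding jump_rate_def by (rule smalloD_tendsto)
    then have "((\<lambda>h. rh h v - r v) \<longlongrightarrow> 0) (at_right 0)"
      by (rule Lim_transform_eventually)
         (auto simp: eventually_at_right_less rh_def field_simps intro!: eventually_mono[OF
             eventually_at_right_less])
    then show ?thesis by (simp add: LIM_zero_iff)
  qed
  have abs_eq: "(\<integral> v. \<bar>rh h v - r v\<bar> \<partial>count_space UNIV) =
      2 * (\<integral> v. max 0 (r v - rh h v) \<partial>count_space UNIV)"
    and int_max: "integrable (count_space UNIV) (\<lambda>v. max 0 (r v - rh h v))" if "0 < h" for h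
  proof -
    show im: "integrable (count_space UNIV) (\<lambda>v. max 0 (r v - rh h v))"
      using int_r int_rh[OF that] by simp
    have "(\<integral> v. \<bar>rh h v - r v\<bar> \<partial>count_space UNIV) = (\<integral> v. 2 * max 0 (r v - rh h v) - (r v - rh h v)
        \<partial>count_space UNIV)"
      by (intro Bochner_Integration.integral_cong) (auto simp: max_def abs_if)
    also have "\<dots> = 2 * (\<integral> v. max 0 (r v - rh h v) \<partial>count_space UNIV) - (\<kappa> - \<kappa>)"
      using im int_r int_rh[OF that] by (simp add: sum_r sum_rh[OF that])
    finally show "(\<integral> v. \<bar>rh h v - r v\<bar> \<partial>count_space UNIV) =
        2 * (\<integral> v. max 0 (r v - rh h v) \<partial>count_space UNIV)"
      by simp
  qed
  have "((\<lambda>h. \<integral> v. \<bar>rh h v - r v\<bar> \<partial>count_space UNIV) \<longlongrightarrow> 0) (at_right 0)"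
  proof (rule tendsto_at_right_sequentially[of 0 1])
    fix S :: "nat \<Rightarrow> real" assume S: "\<And>n. 0 < S n" "S \<longlonglongrightarrow> 0"
    then have "filterlim S (at_right 0) sequentially"
      using S(1) by (auto simp: filterlim_at less_imp_neq[OF S(1), symmetric])
    then have lim: "(\<lambda>n. rh (S n) v) \<longlonglongrightarrow> r v" for v
      using ptw filterlim_compose by blast
    have "(\<lambda>n. \<integral> v. max 0 (r v - rh (S n) v) \<partial>count_space UNIV) \<longlonglongrightarrow> (\<integral> v. (0::real) \<partial>count_space
        (UNIV :: 's set))"
    proof -
      have "\<forall>\<^sub>F n in sequentially. dist (rh (S n) u) (r u) < 1"
        using lim[of u] by (rule tendstoD) simp
      then obtain N where N: "\<And>n. N \<le> n \<Longrightarrow> \<bar>rh (S n) u - r u\<bar> < 1"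
        by (auto simp: eventually_sequentially dist_real_def)
      have "(\<lambda>n. \<integral> v. max 0 (r v - rh (S (n + N)) v) \<partial>count_space UNIV) \<longlonglongrightarrow> (\<integral> v. (0::real)
          \<partial>count_space (UNIV :: 's set))"
      proof (rule integral_dominated_convergence[where w="\<lambda>v. r v + (if v = u then 1 else 0)"])
        show "integrable (count_space UNIV) (\<lambda>v. r v + (if v = u then 1 else 0))"
          by (intro Bochner_Integration.integrable_add int_r int_ind)
        show "AE v in count_space UNIV. (\<lambda>n. max 0 (r v - rh (S (n + N)) v)) \<longlonglongrightarrow> 0"
        proof (rule AE_I2)
          fix v
          have "(\<lambda>n. max 0 (r v - rh (S (n + N)) v)) \<longlonglongrightarrow> max 0 (r v - r v)"
            using LIMSEQ_ignore_initial_segment[OF lim[of v], of N] by (intro tendsto_intros)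
          then show "(\<lambda>n. max 0 (r v - rh (S (n + N)) v)) \<longlonglongrightarrow> 0" by simp
        qed
        show "AE v in count_space UNIV. norm (max 0 (r v - rh (S (n + N)) v)) \<le> r v + (if v =
            u then 1 else 0)" for n
        proof (rule AE_I2)
          fix v
          show "norm (max 0 (r v - rh (S (n + N)) v)) \<le> r v + (if v = u then 1 else 0)"
          proof (cases "v = u")
            case True
            then show ?thesis using N[of "n + N"] r0[of u] by auto
          next
            case False
            then have "0 \<le> rh (S (n + N)) v" using S(1)[of "n + N"] by (simp add: rh_def)
            then show ?thesis using False r0[of v] by auto
          qed
        qed
      qed auto
      then show ?thesis by (rule LIMSEQ_offset)
    qed
    then have "(\<lambda>n. 2 * (\<integral> v. max 0 (r v - rh (S n) v) \<partial>count_space UNIV)) \<longlonglongrightarrow> 2 * 0"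
      by (intro tendsto_intros) simp
    then show "(\<lambda>n. \<integral> v. \<bar>rh (S n) v - r v\<bar> \<partial>count_space UNIV) \<longlonglongrightarrow> 0"
      using S(1) by (simp add: abs_eq)
  qed simp
  then show ?thesis unfolding rh_def .
qed

text \<open>
  The rates out of \<open>u\<close> are written as \<open>r\<close> minus \<open>\<kappa>\<close> times the identity. Multiplying by \<open>e\<^bsup>\<kappa>t\<^esup>\<close>
  absorbs the negative term, so that the integrated equation has nonnegative terms only.
\<close>

lemma backward_equation_bounded:
  fixes P :: "real \<Rightarrow> 's::countable \<Rightarrow> 's pmf" and g :: "'s \<Rightarrow> real"
  assumes tf: "transition_function P"
    and rate: "\<And>v. jump_rate P u v (r v - (if v = u then \<kappa> else 0))"
    and r0: "\<And>v. 0 \<le> r v"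
    and rsum: "(\<Sum>\<^sub>+ v. ennreal (r v)) = ennreal \<kappa>" "0 \<le> \<kappa>"
    and cont: "\<And>v. ((\<lambda>h. pmf (P h v) v) \<longlongrightarrow> 1) (at_right 0)"
    and g: "\<And>v. 0 \<le> g v" "\<And>v. g v \<le> K"
    and t: "0 \<le> t"
  shows "continuous_on {0..} (\<lambda>s. measure_pmf.expectation (P s v) g)"
    and "ennreal (exp (\<kappa> * t)) * (\<integral>\<^sup>+ w. ennreal (g w) \<partial>P t u) = ennreal (g u) +
      (\<integral>\<^sup>+ s\<in>{0..t}. ennreal (exp (\<kappa> * s)) * (\<Sum>\<^sub>+ v. ennreal (r v) * (\<integral>\<^sup>+ w. ennreal (g w) \<partial>P s v))
          \<partial>lborel)"
proof -
  define U where "U s v = measure_pmf.expectation (P s v) g" for s v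
  have K: "0 \<le> K" using g[of u] by linarith
  have bd: "\<And>w. \<bar>g w\<bar> \<le> K" using g by (auto simp: abs_le_iff intro: order_trans)
  have U0: "0 \<le> U s v" for s v using g by (simp add: U_def)
  have UK: "U s v \<le> K" for s v
    unfolding U_def using measure_pmf.integral_le_const[OF integrable_pmf_bounded[OF bd], where c=K]
        g by auto
  have nnU: "(\<integral>\<^sup>+ w. ennreal (g w) \<partial>P s v) = ennreal (U s v)" for s v
    unfolding U_def using integrable_pmf_bounded[OF bd] g by (intro nn_integral_eq_integral) auto
  have ck: "U (h + s) v = measure_pmf.expectation (P h v) (U s)" if "0 \<le> h" "0 \<le> s" for h s v
    using tf that by (simp add: U_def[abs_def] transition_function_def expectation_bind_pmf[OF g])
  have near: "\<bar>U (h + s) v - U s v\<bar> \<le> K * (1 - pmf (P h v) v)" if "0 \<le> h" "0 \<le> s" for h s v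
    unfolding ck[OF that] by (rule pmf_expectation_near_point) (use U0 UK in auto)
  have contU: "continuous_on {0..} (\<lambda>s. U s v)" for v
    unfolding continuous_on_iff
  proof (intro ballI allI impI)
    fix s e :: real assume "s \<in> {0..}" "0 < e"
    have "((\<lambda>h. K * (1 - pmf (P h v) v)) \<longlongrightarrow> K * (1 - 1)) (at_right 0)"
      by (intro tendsto_intros cont)
    then have "\<forall>\<^sub>F h in at_right 0. K * (1 - pmf (P h v) v) < e"
      using \<open>0 < e\<close> by (intro order_tendstoD) auto
    then obtain d where d: "0 < d" "\<And>h. 0 < h \<Longrightarrow> h < d \<Longrightarrow> K * (1 - pmf (P h v) v) < e"
      by (auto simp: eventually_at_right_field)
    show "\<exists>d>0. \<forall>s'\<in>{0..}. dist s' s < d \<longrightarrow> dist (U s' v) (U s v) < e"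
    proof (intro exI conjI ballI impI)
      fix s' assume s': "s' \<in> {0..}" "dist s' s < d"
      consider "s = s'" | "s < s'" | "s' < s" by linarith
      then show "dist (U s' v) (U s v) < e"
      proof cases
        case 2
        then show ?thesis
          using near[of "s' - s" s v] d(2)[of "s' - s"] s' \<open>s \<in> {0..}\<close> by (auto simp: dist_real_def)
      next
        case 3
        then show ?thesis
          using near[of "s - s'" s' v] d(2)[of "s - s'"] s' \<open>s \<in> {0..}\<close>
              by (auto simp: dist_real_def abs_minus_commute)
      qed (use \<open>0 < e\<close> in auto)
    qed (fact d)
  qed
  then show "continuous_on {0..} (\<lambda>s. measure_pmf.expectation (P s v) g)"
    by (simp add: U_def)
  have int_r: "integrable (count_space UNIV) r"
    using integrableI_nn_integral_finite[OF _ _ rsum(1)] r0 by auto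
  have int_rU: "integrable (count_space UNIV) (\<lambda>v. r v * U s v)" for s
    by (rule Bochner_Integration.integrable_bound[OF integrable_mult_left[OF int_r, of K]])
       (use r0 U0 UK K in \<open>auto intro!: mult_left_mono simp: abs_mult\<close>)
  define W where "W s = (\<integral> v. r v * U s v \<partial>count_space UNIV)" for s
  have W0: "0 \<le> W s" for s unfolding W_def using r0 U0 by simp
  have nnW: "(\<Sum>\<^sub>+ v. ennreal (r v) * ennreal (U s v)) = ennreal (W s)" for s
    unfolding W_def using nn_integral_eq_integral[OF int_rU] r0 U0 by (simp add: ennreal_mult'')
  have contW: "continuous_on {0..} W"
    unfolding continuous_on_sequentially
  proof (intro allI ballI impI, elim conjE)
    fix x s assume s: "s \<in> {0..}" "\<forall>n. x n \<in> {0::real..}" "x \<longlonglongrightarrow> s"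
    have "(\<lambda>n. \<integral> v. r v * U (x n) v \<partial>count_space UNIV) \<longlonglongrightarrow> (\<integral> v. r v * U s v \<partial>count_space UNIV)"
    proof (rule integral_dominated_convergence[where w="\<lambda>v. r v * K"])
      show "AE v in count_space UNIV. (\<lambda>n. r v * U (x n) v) \<longlonglongrightarrow> r v * U s v"
        using contU s unfolding continuous_on_sequentially comp_def
            by (intro AE_I2 tendsto_intros) blast
    qed (use int_r r0 U0 UK in \<open>auto simp: abs_mult intro!: mult_left_mono\<close>)
    then show "(W \<circ> x) \<longlonglongrightarrow> W s" by (simp add: W_def comp_def)
  qed
  define \<epsilon> where "\<epsilon> h = (\<integral> v. \<bar>pmf (P h u) v / h + (if v = u then \<kappa> - 1 / h else 0) - r v\<bar>
      \<partial>count_space UNIV)" for h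
  have \<epsilon>: "(\<epsilon> \<longlongrightarrow> 0) (at_right 0)"
    unfolding \<epsilon>_def by (rule rates_converge_in_mean[OF rate r0 rsum])
  define D where "D s = W s - \<kappa> * U s u" for s
  have step: "\<bar>(U (h + s) u - U s u) / h - D s\<bar> \<le> K * \<epsilon> h" if h: "0 < h" and s: "0 \<le> s" for h s
  proof -
    define q where "q v = pmf (P h u) v / h + (if v = u then \<kappa> - 1 / h else 0) - r v" for v
    have int_ind: "integrable (count_space UNIV) (\<lambda>v. if v = u then c else (0::real))"
      and sum_ind: "(\<integral> v. (if v = u then c else (0::real)) \<partial>count_space UNIV) = c" for c
    proof -
      have "(\<lambda>v. if v = u then c else (0::real)) = (\<lambda>v. indicator {u} v * c)"
          by (auto simp: indicator_def)
      then show "integrable (count_space UNIV) (\<lambda>v. if v = u then c else (0::real))"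
        "(\<integral> v. (if v = u then c else (0::real)) \<partial>count_space UNIV) = c" by auto
    qed
    have int_q: "integrable (count_space UNIV) q" unfolding q_def[abs_def]
      by (intro Bochner_Integration.integrable_add Bochner_Integration.integrable_diff
          integrable_divide integrable_pmf int_ind int_r)
    have int_pU: "integrable (count_space UNIV) (\<lambda>v. pmf (P h u) v * U s v)"
      by (rule Bochner_Integration.integrable_bound[OF integrable_mult_left[where c=K, OF
          integrable_pmf[where M="P h u"]]])
         (use U0 UK K in \<open>auto intro!: mult_left_mono simp: abs_mult\<close>)
    have "U (h + s) u = (\<integral> v. pmf (P h u) v * U s v \<partial>count_space UNIV)"
      using h s by (simp add: ck measure_pmf_eq_density integral_density)
    then have "(U (h + s) u - U s u) / h - D s =
       (\<integral> v. (pmf (P h u) v * U s v) / h + (if v = u then (\<kappa> - 1 / h) * U s u else 0) - r v *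
           U s v \<partial>count_space UNIV)"
      using int_pU int_rU int_ind
      by (simp add: sum_ind D_def W_def algebra_simps diff_divide_distrib)
    also have "\<dots> = (\<integral> v. q v * U s v \<partial>count_space UNIV)"
      by (intro Bochner_Integration.integral_cong) (auto simp: q_def algebra_simps)
    finally have eq: "(U (h + s) u - U s u) / h - D s = (\<integral> v. q v * U s v \<partial>count_space UNIV)" .
    have "\<bar>\<integral> v. q v * U s v \<partial>count_space UNIV\<bar> \<le> (\<integral> v. \<bar>q v * U s v\<bar> \<partial>count_space UNIV)"
      using integral_norm_bound[of "count_space UNIV" "\<lambda>v. q v * U s v"] by simp
    also have "\<dots> \<le> (\<integral> v. K * \<bar>q v\<bar> \<partial>count_space UNIV)"
    proof (rule integral_mono')
      show "integrable (count_space UNIV) (\<lambda>v. K * \<bar>q v\<bar>)" using int_q by simp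
      show "\<bar>q v * U s v\<bar> \<le> K * \<bar>q v\<bar>" for v
        using mult_right_mono[OF UK[of s v] abs_ge_zero[of "q v"]] U0[of s v]
            by (simp add: abs_mult mult.commute)
    qed (use K in auto)
    finally show ?thesis unfolding eq by (simp add: \<epsilon>_def q_def)
  qed
  have contD: "continuous_on {0..} D"
    unfolding D_def by (intro continuous_intros contW contU)
  \<comment> \<open>Left difference quotients are right ones taken at the earlier time; continuity of \<open>D\<close> compares the
    two times.\<close>
  have derivU: "((\<lambda>s. U s u) has_real_derivative D s) (at s within {0..})" if s: "0 \<le> s" for s
    unfolding has_field_derivative_iff
  proof -
    have "filterlim (\<lambda>y. \<bar>y - s\<bar>) (at_right 0) (at s within {0..})"
    proof -
      have "((\<lambda>y. \<bar>y - s\<bar>) \<longlongrightarrow> \<bar>s - s\<bar>) (at s within {0..})" by (intro tendsto_intros)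
      moreover have "\<forall>\<^sub>F y in at s within {0..}. \<bar>y - s\<bar> \<in> {0<..} \<and> \<bar>y - s\<bar> \<noteq> 0"
        by (simp add: eventually_at_filter)
      ultimately show ?thesis by (simp add: filterlim_at)
    qed
    then have "((\<lambda>y. \<epsilon> \<bar>y - s\<bar>) \<longlongrightarrow> 0) (at s within {0..})"
      by (rule filterlim_compose[OF \<epsilon>])
    moreover have "(D \<longlongrightarrow> D s) (at s within {0..})"
      using contD s by (auto simp: continuous_on_def)
    ultimately have lim: "((\<lambda>y. K * \<epsilon> \<bar>y - s\<bar> + \<bar>D y - D s\<bar>) \<longlongrightarrow> K * 0 + \<bar>D s - D s\<bar>) (at s within {0..})"
      by (intro tendsto_intros)
    have "((\<lambda>y. (U y u - U s u) / (y - s) - D s) \<longlongrightarrow> 0) (at s within {0..})"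
    proof (rule Lim_null_comparison)
      show "\<forall>\<^sub>F y in at s within {0..}. norm ((U y u - U s u) / (y - s) - D s) \<le> K * \<epsilon> \<bar>y - s\<bar> +
          \<bar>D y - D s\<bar>"
        unfolding eventually_at_filter
      proof (intro always_eventually allI impI)
        fix y assume y: "y \<noteq> s" "y \<in> {0..}"
        show "norm ((U y u - U s u) / (y - s) - D s) \<le> K * \<epsilon> \<bar>y - s\<bar> + \<bar>D y - D s\<bar>"
        proof (cases "s < y")
          case True
          then show ?thesis using step[of "y - s" s] s by simp
        next
          case False
          then have "\<bar>(U s u - U y u) / (s - y) - D y\<bar> \<le> K * \<epsilon> (s - y)"
            using step[of "s - y" y] y by simp
          moreover have "(U s u - U y u) / (s - y) = (U y u - U s u) / (y - s)"
            using y by (simp add: field_simps)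
          ultimately show ?thesis using False by simp
        qed
      qed
      show "((\<lambda>y. K * \<epsilon> \<bar>y - s\<bar> + \<bar>D y - D s\<bar>) \<longlongrightarrow> 0) (at s within {0..})"
        using lim by simp
    qed
    then show "((\<lambda>y. (U y u - U s u) / (y - s)) \<longlongrightarrow> D s) (at s within {0..})"
      by (simp add: LIM_zero_iff)
  qed
  have deriv: "((\<lambda>s. exp (\<kappa> * s) * U s u) has_real_derivative exp (\<kappa> * s) * W s) (at s within {0..t})"
    if "s \<in> {0..t}" for s
  proof -
    have "((\<lambda>s. exp (\<kappa> * s) * U s u) has_real_derivative
        exp (\<kappa> * s) * D s + exp (\<kappa> * s) * \<kappa> * U s u) (at s within {0..t})"
      using that by (auto intro!: derivative_eq_intros DERIV_subset[OF derivU])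
    then show ?thesis by (simp add: D_def algebra_simps)
  qed
  have "((\<lambda>s. exp (\<kappa> * s) * W s) has_integral (exp (\<kappa> * t) * U t u - exp (\<kappa> * 0) * U 0 u)) {0..t}"
    using t deriv by (intro fundamental_theorem_of_calculus) (auto simp flip:
        has_real_derivative_iff_has_vector_derivative)
  then have int: "(\<integral>\<^sup>+ s\<in>{0..t}. ennreal (exp (\<kappa> * s) * W s) \<partial>lborel) =
      ennreal (exp (\<kappa> * t) * U t u - exp (\<kappa> * 0) * U 0 u)"
    using W0 by (intro nn_integral_has_integral_lebesgue') auto
  then have diff0: "0 \<le> exp (\<kappa> * t) * U t u - exp (\<kappa> * 0) * U 0 u"
    by (metis (no_types, lifting) \<open>((\<lambda>s. exp (\<kappa> * s) * W s) has_integral (exp (\<kappa> * t) * U t u - exp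
        (\<kappa> * 0) * U 0 u)) {0..t}\<close> W0 exp_ge_zero has_integral_nonneg zero_le_mult_iff)
  have "U 0 u = g u" using tf by (simp add: U_def transition_function_def)
  then have "ennreal (exp (\<kappa> * t) * U t u) = ennreal (g u) + ennreal (exp (\<kappa> * t) * U t u - exp (\<kappa> *
      0) * U 0 u)"
    using diff0 g by (subst ennreal_plus[symmetric]) auto
  then show "ennreal (exp (\<kappa> * t)) * (\<integral>\<^sup>+ w. ennreal (g w) \<partial>P t u) = ennreal (g u) +
      (\<integral>\<^sup>+ s\<in>{0..t}. ennreal (exp (\<kappa> * s)) * (\<Sum>\<^sub>+ v. ennreal (r v) * (\<integral>\<^sup>+ w. ennreal (g w) \<partial>P s v))
          \<partial>lborel)"
    unfolding nnU nnW int[symmetric] using U0 W0 by (simp add: ennreal_mult'')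
qed

text \<open>
  Pass to the limit of monotone convergence along the truncations \<open>min g N\<close>. Times are written
  \<open>max 0 s\<close> to have measurability on the whole line, as nothing is known at negative times.
\<close>

lemma backward_equation:
  fixes P :: "real \<Rightarrow> 's::countable \<Rightarrow> 's pmf" and g :: "'s \<Rightarrow> ennreal"
  assumes tf: "transition_function P"
    and rate: "\<And>v. jump_rate P u v (r v - (if v = u then \<kappa> else 0))"
    and r0: "\<And>v. 0 \<le> r v"
    and rsum: "(\<Sum>\<^sub>+ v. ennreal (r v)) = ennreal \<kappa>" "0 \<le> \<kappa>"
    and cont: "\<And>v. ((\<lambda>h. pmf (P h v) v) \<longlongrightarrow> 1) (at_right 0)"
    and g: "\<And>v. g v \<noteq> \<infinity>"
    and t: "0 \<le> t"
  shows "(\<lambda>s. \<integral>\<^sup>+ w. g w \<partial>P (max 0 s) v) \<in> borel_measurable borel" (is ?meas)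
    and "ennreal (exp (\<kappa> * t)) * (\<integral>\<^sup>+ w. g w \<partial>P t u) = g u +
      (\<integral>\<^sup>+ s\<in>{0..t}. ennreal (exp (\<kappa> * s)) * (\<Sum>\<^sub>+ v. ennreal (r v) * (\<integral>\<^sup>+ w. g w \<partial>P (max 0 s) v))
          \<partial>lborel)"
proof -
  define gN where "gN N w = min (enn2real (g w)) (real N)" for N w
  have gN0: "0 \<le> gN N w" "gN N w \<le> real N" for N w by (auto simp: gN_def)
  have inc: "incseq (\<lambda>N. ennreal (gN N w))" for w
    by (auto intro!: incseq_SucI ennreal_leI simp: gN_def)
  have sup: "(SUP N. ennreal (gN N w)) = g w" for w
  proof (rule antisym)
    show "(SUP N. ennreal (gN N w)) \<le> g w"
    proof (rule SUP_least)
      fix N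
      have "ennreal (gN N w) \<le> ennreal (enn2real (g w))" by (intro ennreal_leI) (simp add: gN_def)
      also have "\<dots> = g w" using g[of w] by (simp add: less_top)
      finally show "ennreal (gN N w) \<le> g w" .
    qed
    obtain N where "enn2real (g w) \<le> real N" using real_arch_simple by blast
    then have "g w = ennreal (gN N w)" using g[of w] by (simp add: gN_def min_def less_top)
    then show "g w \<le> (SUP N. ennreal (gN N w))" by (auto intro: SUP_upper2)
  qed
  define V where "V N s v = (\<integral>\<^sup>+ w. ennreal (gN N w) \<partial>P (max 0 s) v)" for N s v
  have incV: "incseq (\<lambda>N. V N s v)" for s v
    unfolding V_def using inc by (auto simp: incseq_def intro!: nn_integral_mono)
  have supV: "(SUP N. V N s v) = (\<integral>\<^sup>+ w. g w \<partial>P (max 0 s) v)" for s v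
    unfolding V_def by (subst nn_integral_monotone_convergence_SUP[symmetric]) (use inc in \<open>auto
        simp: sup incseq_def le_fun_def\<close>)
  note be = backward_equation_bounded[OF tf rate r0 rsum cont gN0]
  have measV: "(\<lambda>s. V N s v) \<in> borel_measurable borel" for N v
  proof -
    have "continuous_on UNIV ((\<lambda>s. measure_pmf.expectation (P s v) (gN N)) \<circ> max 0)"
      by (rule continuous_on_compose) (auto intro!: continuous_intros continuous_on_subset[OF
          be(1)[OF order_refl]])
    then have "(\<lambda>s. measure_pmf.expectation (P (max 0 s) v) (gN N)) \<in> borel_measurable borel"
      by (intro borel_measurable_continuous_onI) (simp add: comp_def)
    moreover have "V N s v = ennreal (measure_pmf.expectation (P (max 0 s) v) (gN N))" for s
      unfolding V_def using gN0 integrable_pmf_bounded[of "gN N" "real N"]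
          by (intro nn_integral_eq_integral) (auto simp: abs_le_iff intro: order_trans)
    ultimately show ?thesis by simp
  qed
  then have "(\<lambda>s. SUP N. V N s v) \<in> borel_measurable borel" for v by measurable
  then show ?meas by (simp add: supV)
  have measI: "(\<lambda>s. \<Sum>\<^sub>+ v. ennreal (r v) * V N s v) \<in> borel_measurable borel" for N
    by (intro measurable_nn_integral_count_space borel_measurable_times_ennreal
        borel_measurable_const measV)
  have eqN: "ennreal (exp (\<kappa> * t)) * V N t u = ennreal (gN N u) +
      (\<integral>\<^sup>+ s\<in>{0..t}. ennreal (exp (\<kappa> * s)) * (\<Sum>\<^sub>+ v. ennreal (r v) * V N s v) \<partial>lborel)" for N
  proof -
    have "(\<integral>\<^sup>+ s\<in>{0..t}. ennreal (exp (\<kappa> * s)) * (\<Sum>\<^sub>+ v. ennreal (r v) * V N s v) \<partial>lborel) =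
      (\<integral>\<^sup>+ s\<in>{0..t}. ennreal (exp (\<kappa> * s)) * (\<Sum>\<^sub>+ v. ennreal (r v) * (\<integral>\<^sup>+ w. ennreal (gN N w) \<partial>P s
          v)) \<partial>lborel)"
      by (intro nn_integral_cong) (auto simp: V_def max_def split: split_indicator)
    then show ?thesis using be(2)[OF t, of N] t by (simp add: V_def)
  qed
  have "ennreal (exp (\<kappa> * t)) * (\<integral>\<^sup>+ w. g w \<partial>P t u) = (SUP N. ennreal (exp (\<kappa> * t)) * V N t u)"
    using supV[of t u] t by (simp add: SUP_mult_left_ennreal[symmetric])
  also have "\<dots> = (SUP N. ennreal (gN N u)) + (SUP N. \<integral>\<^sup>+ s\<in>{0..t}. ennreal (exp (\<kappa> * s)) *
      (\<Sum>\<^sub>+ v. ennreal (r v) * V N s v) \<partial>lborel)"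
    unfolding eqN
    by (rule ennreal_SUP_add)
       (use inc incV in \<open>auto simp: incseq_def intro!: nn_integral_mono mult_right_mono mult_left_mono\<close>)
  also have "(SUP N. \<integral>\<^sup>+ s\<in>{0..t}. ennreal (exp (\<kappa> * s)) * (\<Sum>\<^sub>+ v. ennreal (r v) * V N s v) \<partial>lborel)
      = (\<integral>\<^sup>+ s. (SUP N. ennreal (exp (\<kappa> * s)) * (\<Sum>\<^sub>+ v. ennreal (r v) * V N s v)
         * indicator {0..t} s) \<partial>lborel)"
    by (rule nn_integral_monotone_convergence_SUP[symmetric])
       (use incV measI in \<open>auto simp: incseq_def le_fun_def intro!: nn_integral_mono mult_right_mono
           mult_left_mono\<close>)
  also have "\<dots> = (\<integral>\<^sup>+ s\<in>{0..t}. ennreal (exp (\<kappa> * s)) * (\<Sum>\<^sub>+ v. ennreal (r v) *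
      (\<integral>\<^sup>+ w. g w \<partial>P (max 0 s) v)) \<partial>lborel)"
  proof (rule nn_integral_cong)
    fix s
    have "(SUP N. \<Sum>\<^sub>+ v. ennreal (r v) * V N s v) = (\<Sum>\<^sub>+ v. (SUP N. ennreal (r v) * V N s v))"
      by (rule nn_integral_monotone_convergence_SUP[symmetric])
         (use incV in \<open>auto simp: incseq_def le_fun_def intro!: mult_left_mono\<close>)
    also have "\<dots> = (\<Sum>\<^sub>+ v. ennreal (r v) * (\<integral>\<^sup>+ w. g w \<partial>P (max 0 s) v))"
      by (simp add: SUP_mult_left_ennreal[symmetric] supV)
    finally show "(SUP N. ennreal (exp (\<kappa> * s)) * (\<Sum>\<^sub>+ v. ennreal (r v) * V N s v) * indicator
        {0..t} s) =
       ennreal (exp (\<kappa> * s)) * (\<Sum>\<^sub>+ v. ennreal (r v) * (\<integral>\<^sup>+ w. g w \<partial>P (max 0 s) v)) * indicator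
           {0..t} s"
      by (simp add: SUP_mult_left_ennreal[symmetric] SUP_mult_right_ennreal[symmetric])
  qed
  finally show "ennreal (exp (\<kappa> * t)) * (\<integral>\<^sup>+ w. g w \<partial>P t u) = g u +
      (\<integral>\<^sup>+ s\<in>{0..t}. ennreal (exp (\<kappa> * s)) * (\<Sum>\<^sub>+ v. ennreal (r v) * (\<integral>\<^sup>+ w. g w \<partial>P (max 0 s) v))
          \<partial>lborel)"
    by (simp add: sup)
qed

section \<open>Finiteness of the offspring moments\<close>

text \<open>
  On \<open>(0,1)\<close> the given derivative \<open>F r\<close> is the power series of the \<open>r\<close>-th formal derivative, whose
  coefficients are nonnegative for \<open>r \<ge> 2\<close>. Continuity of \<open>F r\<close> at 1 bounds the partial sums of these
  coefficients by \<open>F r 1\<close>, and the coefficients of all formal derivatives together control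
  \<open>k\<^sup>m b\<^sub>k\<close>.
\<close>

lemma offspring_moments_summable:
  assumes "offspring_rates b"
  shows "summable (\<lambda>k. real k ^ m * b k)"
proof -
  define c where "c r = (diffs ^^ r) b" for r
  have c0: "c 0 = b" and cSuc: "c (Suc r) = diffs (c r)" for r by (auto simp: c_def)
  have b: "\<And>n. n \<noteq> 1 \<Longrightarrow> 0 \<le> b n" "b sums 0" using assms by (auto simp: offspring_rates_def)
  obtain F where F0: "F 0 = offspring_gf b"
    and F: "\<And>r u. u \<in> {0..1} \<Longrightarrow> (F r has_real_derivative F (Suc r) u) (at u within {0..1})"
    using assms unfolding offspring_rates_def by blast
  have cnn: "0 \<le> c r n" if "2 \<le> r + n" for r n
    using that
  proof (induction r arbitrary: n)
    case 0
    then show ?case using b by (simp add: c0)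
  next
    case (Suc r)
    then show ?case using Suc.IH[of "Suc n"] by (simp add: cSuc diffs_def del: of_nat_Suc)
  qed
  have summ: "summable (\<lambda>n. c r n * u ^ n)" if "norm u < 1" for r and u :: real
    using that
  proof (induction r arbitrary: u)
    case 0
    have "summable (\<lambda>n. b n * 1 ^ n)" using b(2) by (simp add: sums_summable)
    then show ?case using 0 powser_inside[of b 1 u] by (simp add: c0)
  next
    case (Suc r)
    show ?case unfolding cSuc using termdiff_converges[of u 1 "c r"] Suc by auto
  qed
  have Feq: "F r u = (\<Sum>n. c r n * u ^ n)" if "0 < u" "u < 1" for r u
    using that
  proof (induction r arbitrary: u)
    case 0
    then show ?case by (simp add: F0 offspring_gf_def c0)
  next
    case (Suc r)
    have "((\<lambda>u. \<Sum>n. c r n * u ^ n) has_real_derivative (\<Sum>n. diffs (c r) n * u ^ n)) (at u)"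
      by (rule termdiffs_strong'[where K=1]) (use summ Suc in auto)
    moreover have "((\<lambda>u. \<Sum>n. c r n * u ^ n) has_real_derivative F (Suc r) u) (at u)"
    proof (rule has_field_derivative_transform_within_open[where S="{0<..<1}"])
      show "(F r has_real_derivative F (Suc r) u) (at u)"
        using F[of u r] Suc.prems at_within_interior[of u "{0..1}"] by auto
    qed (use Suc in auto)
    ultimately show ?case by (simp add: cSuc DERIV_unique)
  qed
  have sum_c: "summable (c r)" if r: "2 \<le> r" for r
  proof (rule summableI_nonneg_bounded)
    show "0 \<le> c r n" for n using cnn r by simp
    show "(\<Sum>n<N. c r n) \<le> F r 1" for N
    proof (rule tendsto_le[of "at 1 within {0..1}"])
      show "((\<lambda>u. F r u) \<longlongrightarrow> F r 1) (at 1 within {0..1})"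
        using DERIV_continuous[OF F[of 1 r]] by (simp add: continuous_within)
      have "((\<lambda>u. \<Sum>n<N. c r n * u ^ n) \<longlongrightarrow> (\<Sum>n<N. c r n * 1 ^ n)) (at 1 within {0..1})"
        by (intro tendsto_intros)
      then show "((\<lambda>u. \<Sum>n<N. c r n * u ^ n) \<longlongrightarrow> (\<Sum>n<N. c r n)) (at 1 within {0..1})" by simp
      have "\<forall>\<^sub>F u::real in at 1 within {0..1}. 0 < u"
      proof -
        have "((\<lambda>u. u) \<longlongrightarrow> (1::real)) (at 1 within {0..1})" by (rule tendsto_ident_at)
        then show ?thesis by (rule order_tendstoD) simp
      qed
      moreover have "\<forall>\<^sub>F u::real in at 1 within {0..1}. u \<noteq> 1 \<and> u \<in> {0..1}"
        by (simp add: eventually_at_filter)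
      ultimately show "\<forall>\<^sub>F u in at 1 within {0..1}. (\<Sum>n<N. c r n * u ^ n) \<le> F r u"
      proof eventually_elim
        case (elim u)
        then have u: "0 < u" "u < 1" by auto
        show ?case unfolding Feq[OF u]
          by (rule sum_le_suminf[OF summ]) (use u cnn r in auto)
      qed
      show "at 1 within {0..1} \<noteq> (bot :: real filter)"
        by (simp add: trivial_limit_within islimpt_Icc)
    qed
  qed
  have main: "summable (\<lambda>k. real (Suc k) ^ m * c r k)" if "2 \<le> r" for r m
    using that
  proof (induction m arbitrary: r)
    case 0
    then show ?case using sum_c by simp
  next
    case (Suc m)
    have "summable (\<lambda>j. 2 ^ Suc m * (real (Suc j) ^ m * c (Suc r) j))"
      by (intro summable_mult Suc.IH) (use Suc.prems in simp)
    then have "summable (\<lambda>j. real (Suc (Suc j)) ^ Suc m * c r (Suc j))"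
    proof (rule summable_comparison_test'[where N=0])
      fix j
      have "real (Suc (Suc j)) ^ m \<le> (2 * real (Suc j)) ^ m"
        by (intro power_mono) auto
      then have 1: "real (Suc (Suc j)) ^ m * c (Suc r) j \<le> (2 * real (Suc j)) ^ m * c (Suc r) j"
        by (rule mult_right_mono) (use cnn Suc.prems in simp)
      have "real (Suc (Suc j)) * c r (Suc j) \<le> (2 * real (Suc j)) * c r (Suc j)"
        by (rule mult_right_mono) (use cnn[of r "Suc j"] Suc.prems in auto)
      also have "\<dots> = 2 * c (Suc r) j" by (simp add: cSuc diffs_def)
      finally have "real (Suc (Suc j)) ^ m * (real (Suc (Suc j)) * c r (Suc j)) \<le>
          real (Suc (Suc j)) ^ m * (2 * c (Suc r) j)"
        by (rule mult_left_mono) simp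
      then have "real (Suc (Suc j)) ^ Suc m * c r (Suc j) \<le> 2 * (real (Suc (Suc j)) ^ m * c (Suc r) j)"
        by (simp add: mult_ac)
      also have "\<dots> \<le> 2 * ((2 * real (Suc j)) ^ m * c (Suc r) j)" using 1 by linarith
      also have "\<dots> = 2 ^ Suc m * (real (Suc j) ^ m * c (Suc r) j)"
        by (simp only: power_mult_distrib power_Suc mult_ac)
      finally show "norm (real (Suc (Suc j)) ^ Suc m * c r (Suc j)) \<le>
          2 ^ Suc m * (real (Suc j) ^ m * c (Suc r) j)"
        using cnn[of r "Suc j"] Suc.prems by (simp del: of_nat_Suc)
    qed
    then show ?case by (subst summable_Suc_iff[symmetric])
  qed
  have "summable (\<lambda>j. 2 ^ m * (real (Suc j) ^ m * c 2 j))"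
    by (intro summable_mult main) simp
  then have "summable (\<lambda>j. real (j + 2) ^ m * b (j + 2))"
  proof (rule summable_comparison_test'[where N=0])
    fix j
    have c2: "c 2 j = real (Suc j) * (real (Suc (Suc j)) * b (j + 2))"
      by (simp add: numeral_2_eq_2 cSuc c0 diffs_def)
    have bj: "0 \<le> b (j + 2)" using b by simp
    have "b (j + 2) \<le> c 2 j"
      unfolding c2 using bj mult_mono[of 1 "real (Suc j) * real (Suc (Suc j))" "b (j + 2)" "b (j + 2)"]
      by (simp add: mult.assoc[symmetric] del: of_nat_Suc) (simp add: algebra_simps)
    moreover have "real (j + 2) ^ m \<le> (2 * real (Suc j)) ^ m" by (intro power_mono) auto
    ultimately have "real (j + 2) ^ m * b (j + 2) \<le> (2 * real (Suc j)) ^ m * c 2 j"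
      using bj by (intro mult_mono) auto
    also have "(2 * real (Suc j)) ^ m * c 2 j = 2 ^ m * (real (Suc j) ^ m * c 2 j)"
      by (simp only: power_mult_distrib mult_ac)
    finally show "norm (real (j + 2) ^ m * b (j + 2)) \<le> 2 ^ m * (real (Suc j) ^ m * c 2 j)"
      using bj by simp
  qed
  then show ?thesis by (subst summable_iff_shift[of _ 2, symmetric])
qed

section \<open>Sums over countable types\<close>

text \<open>
  Countability of the set of configurations makes sums over configurations measurable functions of
  time.
\<close>

instance multiset :: (countable) countable
proof
  have "inj (\<lambda>M :: 'a multiset. to_nat (SOME xs. mset xs = M))"
  proof (rule injI)
    fix M N :: "'a multiset"
    assume "to_nat (SOME xs. mset xs = M) = to_nat (SOME xs. mset xs = N)"
    then have "(SOME xs. mset xs = M) = (SOME xs. mset xs = N)" by simp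
    moreover have "mset (SOME xs. mset xs = M) = M" "mset (SOME xs. mset xs = N) = N"
      by (rule someI_ex[OF ex_mset])+
    ultimately show "M = N" by metis
  qed
  then show "\<exists>f :: 'a multiset \<Rightarrow> nat. inj f" by blast
qed

lemma nn_integral_count_space_inj:
  assumes "inj j" "\<And>C. C \<notin> range j \<Longrightarrow> f C = 0"
  shows "(\<Sum>\<^sub>+ C. f C) = (\<Sum>\<^sub>+ y. f (j y))"
proof -
  have "(\<Sum>\<^sub>+ C. f C) = (\<Sum>\<^sub>+ C. f C * indicator (range j) C)"
    by (intro nn_integral_cong) (use assms(2) in \<open>auto simp: indicator_def\<close>)
  also have "\<dots> = (\<integral>\<^sup>+ C. f C \<partial>count_space (range j))"
    by (simp add: nn_integral_count_space_indicator)
  also have "\<dots> = (\<Sum>\<^sub>+ y. f (j y))"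
    by (rule nn_integral_bij_count_space[symmetric]) (use assms(1) in \<open>simp add: bij_betw_def\<close>)
  finally show ?thesis .
qed

lemma nn_integral_count_space_single:
  "(\<And>y. y \<noteq> x \<Longrightarrow> f y = 0) \<Longrightarrow> (\<Sum>\<^sub>+ y. f y) = f x"
proof -
  assume "\<And>y. y \<noteq> x \<Longrightarrow> f y = 0"
  then have "(\<Sum>\<^sub>+ y. f y) = (\<Sum>\<^sub>+ y. f y * delta x y)"
    by (intro nn_integral_cong) (auto simp: indicator_def)
  then show ?thesis by (simp add: nn_integral_count_space_delta)
qed

lemma nn_integral_count_space_has_sum:
  fixes f :: "'s \<Rightarrow> real"
  assumes "(f has_sum s) UNIV" "\<And>x. 0 \<le> f x"
  shows "(\<Sum>\<^sub>+ x. ennreal (f x)) = ennreal s"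
proof -
  have "f summable_on UNIV" using assms(1) by (rule has_sum_imp_summable)
  then have "(\<lambda>x. norm (f x)) summable_on UNIV" using assms(2) by simp
  then have "Infinite_Set_Sum.abs_summable_on f UNIV" by (simp only: abs_summable_equivalent)
  then show ?thesis using assms infsetsum_infsum[of f UNIV] infsumI[OF assms(1)]
    by (subst nn_integral_eq_integral) (auto simp: infsetsum_def Infinite_Set_Sum.abs_summable_on_def)
qed

section \<open>The random walk\<close>

lemma jump_rate_imp_continuous:
  assumes "jump_rate P v v q"
  shows "((\<lambda>h. pmf (P h v) v) \<longlongrightarrow> 1) (at_right 0)"
proof -
  have "((\<lambda>h. (pmf (P h v) v - (1 + q * h)) / h) \<longlongrightarrow> 0) (at_right 0)"
    using assms unfolding jump_rate_def by (simp add: smalloD_tendsto)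
  then have "((\<lambda>h. (pmf (P h v) v - (1 + q * h)) / h * h + (1 + q * h)) \<longlongrightarrow> 0 * 0 +
      (1 + q * 0)) (at_right 0)"
    by (intro tendsto_intros)
  then have "((\<lambda>h. (pmf (P h v) v - (1 + q * h)) / h * h + (1 + q * h)) \<longlongrightarrow> 1) (at_right 0)"
    by simp
  then show ?thesis
    by (rule Lim_transform_eventually) (rule eventually_mono[OF eventually_at_right_less[of 0]], simp)
qed

locale walk =
  fixes a :: "int ^ 'd::finite \<Rightarrow> int ^ 'd \<Rightarrow> real"
  assumes intensity: "walk_intensity a"
begin

definition hold :: real where "hold = - a 0 0"

text \<open>
  The generator \<open>A\<close> shifted by the total jump rate \<open>hold\<close>, which cancels its diagonal.
\<close>

definition Q :: "int ^ 'd \<Rightarrow> int ^ 'd \<Rightarrow> ennreal" where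
  "Q x y = ennreal (if x = y then 0 else a x y)"

lemma a_diag: "a x x = - hold"
proof -
  have "a x x = a 0 (x - x)" using intensity unfolding walk_intensity_def by blast
  then show ?thesis by (simp add: hold_def)
qed

lemma hold_pos: "0 < hold"
  using intensity unfolding walk_intensity_def hold_def by simp

lemma a_nonneg: "x \<noteq> y \<Longrightarrow> 0 \<le> a x y"
  using intensity unfolding walk_intensity_def by blast

lemma a_sym: "a x y = a y x"
  using intensity unfolding walk_intensity_def by blast

lemma Q_sym: "Q x y = Q y x"
  unfolding Q_def using a_sym[of x y] by (cases "x = y") auto

lemma Q_row: "(\<Sum>\<^sub>+ y. Q x y) = ennreal hold"
proof -
  have "(a x has_sum 0) UNIV" using intensity unfolding walk_intensity_def by blast
  moreover have "((\<lambda>y. if y \<in> {x} then hold else 0) has_sum hold) UNIV"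
    by (rule iffD1[OF has_sum_cong_neutral has_sum_finiteI[of "{x}" hold "\<lambda>_. hold"]]) auto
  ultimately have "((\<lambda>y. a x y + (if y \<in> {x} then hold else 0)) has_sum (0 + hold)) UNIV"
    by (rule has_sum_add)
  moreover have "(\<lambda>y. a x y + (if y \<in> {x} then hold else 0)) = (\<lambda>y. if x = y then 0 else a x y)"
    by (simp add: fun_eq_iff a_diag)
  ultimately have "((\<lambda>y. if x = y then 0 else a x y) has_sum hold) UNIV" by (simp only: add_0_left)
  then show ?thesis
    unfolding Q_def by (rule nn_integral_count_space_has_sum) (auto simp: a_nonneg)
qed

text \<open>
  A path of positive rates from \<open>x\<close> to \<open>y\<close> contributes a positive term to a power of \<open>Q\<close>.
\<close>

lemma irreducible_iter: "\<exists>n. 0 < (mapp Q ^^ n) (delta y) x"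
proof -
  have "(\<lambda>u v. 0 < a u v)\<^sup>*\<^sup>* x y" using intensity unfolding walk_intensity_def by blast
  then show ?thesis
  proof (induction rule: converse_rtranclp_induct)
    case base
    then show ?case by (intro exI[of _ 0]) simp
  next
    case (step u z)
    then obtain n where n: "0 < (mapp Q ^^ n) (delta y) z" by blast
    have "u \<noteq> z" using step(1) a_diag[of u] hold_pos by auto
    then have "0 < Q u z * (mapp Q ^^ n) (delta y) z"
      using step(1) n by (simp add: Q_def ennreal_zero_less_mult_iff)
    also have "\<dots> = (\<Sum>\<^sub>+ w. Q u w * (mapp Q ^^ n) (delta y) w * delta z w)"
      by (simp add: nn_integral_count_space_delta)
    also have "\<dots> \<le> (mapp Q ^^ Suc n) (delta y) u"
      unfolding funpow.simps comp_def mapp_def[of Q "(mapp Q ^^ n) (delta y)"]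
      by (intro nn_integral_mono) (auto simp: indicator_def)
    finally show ?case by blast
  qed
qed

text \<open>
  Transition probabilities are bounded, so the backward equation has the exponential series as its
  only solution.
\<close>

lemma walk_transition_exp:
  assumes p: "walk_transition a p" and t: "0 \<le> t"
  shows "ennreal (exp (hold * t)) * ennreal (pmf (p t x) y) = mexp Q t (delta y) x"
proof -
  have tf: "transition_function p" and jr: "\<And>x y. jump_rate p x y (a x y)"
    using p by (auto simp: walk_transition_def)
  define U where "U s x = ennreal (exp (hold * s)) * (\<integral>\<^sup>+ w. delta y w \<partial>p (max 0 s) x)" for s x
  have cont: "((\<lambda>h. pmf (p h v) v) \<longlongrightarrow> 1) (at_right 0)" for v
    using jr[of v v] by (rule jump_rate_imp_continuous)
  have rate: "jump_rate p u v ((if u = v then 0 else a u v) - (if v = u then hold else 0))" for u v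
    using jr[of u v] by (cases "u = v") (auto simp: a_diag)
  note be = backward_equation[OF tf rate _ Q_row[unfolded Q_def] less_imp_le[OF hold_pos] cont,
      where g="delta y"]
  have Umeas: "(\<lambda>s. U s x) \<in> borel_measurable borel" for x
  proof -
    have "(\<lambda>s. \<integral>\<^sup>+ w. delta y w \<partial>p (max 0 s) x) \<in> borel_measurable borel"
      by (rule be(1)[where t=0]) (use a_nonneg in \<open>auto simp: indicator_def\<close>)
    then show ?thesis unfolding U_def by measurable
  qed
  have Ueq: "U t x = delta y x + (\<integral>\<^sup>+ s\<in>{0..t}. (mapp Q (U s) x + 0) \<partial>lborel)" if "0 \<le> t" for t x
  proof -
    have m: "mapp Q (U s) x = ennreal (exp (hold * s)) *
        (\<Sum>\<^sub>+ v. ennreal (if x = v then 0 else a x v) * (\<integral>\<^sup>+ w. delta y w \<partial>p (max 0 s) v))" for s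
      by (simp only: U_def[abs_def] mapp_cmult) (simp only: mapp_def Q_def)
    show ?thesis
      unfolding m add_0_right U_def max_absorb2[OF that]
      by (rule be(2)) (use a_nonneg that in \<open>auto simp: indicator_def\<close>)
  qed
  have rows: "mapp Q (\<lambda>_. 1) x \<le> ennreal hold" for x
    using Q_row[of x] by (simp add: mapp_def)
  have zero: "(\<integral>\<^sup>+ r\<in>{0..t}. mexp Q (t - r) (\<lambda>_. 0) x \<partial>lborel) = 0"
  proof -
    have "mexp Q s (\<lambda>_. 0) x = 0" for s
      using mexp_kernel[of Q s "\<lambda>_. 0" x] by simp
    then show ?thesis by simp
  qed
  have Ubound: "U s x \<le> ennreal (exp (hold * t))" if "0 \<le> s" "s \<le> t" for s x
  proof -
    have "(\<integral>\<^sup>+ w. delta y w \<partial>p (max 0 s) x) \<le> 1"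
      by (simp add: measure_pmf.emeasure_le_1)
    then have "U s x \<le> ennreal (exp (hold * s)) * 1"
      unfolding U_def by (intro mult_left_mono) auto
    also have "\<dots> \<le> ennreal (exp (hold * t))"
      using that hold_pos by (simp add: ennreal_leI)
    finally show ?thesis .
  qed
  have "U t x = mexp Q t (delta y) x"
  proof (rule antisym)
    have "U t x \<le> mexp Q t (delta y) x + (\<integral>\<^sup>+ r\<in>{0..t}. mexp Q (t - r) (\<lambda>_. 0) x \<partial>lborel)"
      by (rule duhamel_upper_bound[where f="\<lambda>_ _. 0" and T=t and K="exp (hold * t)" and R=hold])
         (use Umeas Ueq Ubound rows hold_pos t in auto)
    then show "U t x \<le> mexp Q t (delta y) x" by (simp add: zero)
    have "mexp Q t (delta y) x + (\<integral>\<^sup>+ r\<in>{0..t}. mexp Q (t - r) (\<lambda>_. 0) x \<partial>lborel) \<le> U t x"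
      by (rule duhamel_lower_bound[where f="\<lambda>_ _. 0"]) (use Umeas Ueq t in auto)
    then show "mexp Q t (delta y) x \<le> U t x" by (simp add: zero)
  qed
  then show ?thesis using t by (simp add: U_def emeasure_pmf_single)
qed

end

section \<open>Transition rates of the branching walk\<close>

locale branching_walk = walk a for a :: "int ^ 'd::finite \<Rightarrow> int ^ 'd \<Rightarrow> real" +
  fixes b :: "nat \<Rightarrow> real" and P :: "real \<Rightarrow> 'd config \<Rightarrow> 'd config pmf"
  assumes offspring: "offspring_rates b"
    and brw: "brw_transition a b P"
begin

text \<open>
  \<open>split\<close> is the total rate of branching at the origin and \<open>exit\<close> the total rate of all events there;
  \<open>exit\<close> bounds the rates at all sites. With this shift the generator of the mean numbers,
  \<open>A + \<beta>\<^sup>* \<Delta>\<^sub>0 - b\<^sub>0 + exit\<close>, is the matrix \<open>B\<close> below: its diagonal part is \<open>exit - hold - b\<^sub>0 = split\<close>.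
\<close>

definition split :: real where "split = - b 0 - b 1"
definition exit :: real where "exit = hold - b 1"

lemma b_nonneg: "n \<noteq> 1 \<Longrightarrow> 0 \<le> b n"
  using offspring unfolding offspring_rates_def by blast

lemma b_sums: "b sums 0" and b1_neg: "b 1 < 0"
  using offspring unfolding offspring_rates_def by auto

lemma split_sums: "(\<lambda>k. b (k + 2)) sums split"
  using b_sums sums_iff_shift[of b 2 split] by (simp add: split_def numeral_2_eq_2)

lemma split_nonneg: "0 \<le> split"
  using split_sums sums_le[OF _ sums_zero split_sums] b_nonneg by simp

lemma exit_nonneg: "0 \<le> exit"
  using hold_pos b1_neg by (simp add: exit_def)

lemma suminf_split: "(\<Sum>k. ennreal (b (k + 2))) = ennreal split"
  by (rule suminf_ennreal_eq) (use split_sums b_nonneg in auto)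

text \<open>
  This is where \<open>\<beta>\<^sup>*\<close> enters the mean: \<open>\<Sum> k b\<^sub>k = \<Sum> (k - 1) b\<^sub>k + \<Sum> b\<^sub>k\<close> over \<open>k \<ge> 2\<close>.
\<close>

lemma suminf_mean: "(\<Sum>k. ennreal (real (k + 2) * b (k + 2))) = ennreal (beta_star b + split)"
  and beta_star_nonneg: "0 \<le> beta_star b"
proof -
  have s1: "summable (\<lambda>k. real k * b k)" using offspring_moments_summable[OF offspring, of 1] by simp
  then have s2: "summable (\<lambda>k. real (k + 2) * b (k + 2))"
    by (subst (asm) summable_iff_shift[of _ 2, symmetric])
  have s3: "(\<lambda>k. (real (k + 2) - 1) * b (k + 2)) sums ((\<Sum>k. real (k + 2) * b (k + 2)) - split)"
    using sums_diff[OF summable_sums[OF s2] split_sums] by (simp add: algebra_simps)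
  have hs: "((\<lambda>k. (real (k + 2) - 1) * b (k + 2)) has_sum ((\<Sum>k. real (k + 2) * b (k + 2)) - split))
      UNIV"
    by (rule norm_summable_imp_has_sum) (use s3 b_nonneg in \<open>auto simp: sums_iff\<close>)
  have "beta_star b = (\<Sum>\<^sub>\<infinity>n\<in>range (\<lambda>k. k + 2). (real n - 1) * b n)"
  proof -
    have "{1<..} = range (\<lambda>k::nat. k + 2)" by (auto simp: image_iff) presburger
    then show ?thesis by (simp add: beta_star_def)
  qed
  also have "\<dots> = (\<Sum>\<^sub>\<infinity>k. (real (k + 2) - 1) * b (k + 2))"
    by (subst infsum_reindex) (auto simp: inj_def comp_def)
  finally have eq: "beta_star b = (\<Sum>k. real (k + 2) * b (k + 2)) - split"
    using infsumI[OF hs] by simp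
  show "0 \<le> beta_star b"
    unfolding eq by (rule sums_le[OF _ sums_zero s3]) (use b_nonneg in simp)
  show "(\<Sum>k. ennreal (real (k + 2) * b (k + 2))) = ennreal (beta_star b + split)"
    using s2 b_nonneg unfolding eq by (subst suminf_ennreal_eq[OF _ summable_sums]) auto
qed

definition B :: "int ^ 'd \<Rightarrow> int ^ 'd \<Rightarrow> ennreal" where
  "B x y = Q x y + ennreal split * delta x y + (if x = 0 then ennreal (beta_star b) * delta 0 y else 0)"

lemma B_sym: "B x y = B y x"
  by (auto simp: B_def Q_sym[of x y] indicator_def)

lemma mapp_B: "mapp B u x = mapp Q u x + ennreal split * u x + (if x = 0 then ennreal (beta_star b)
    * u 0 else 0)"
proof -
  have "mapp B u x = (\<Sum>\<^sub>+ y. Q x y * u y + ennreal split * u y * delta x y +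
      (if x = 0 then ennreal (beta_star b) else 0) * u y * delta 0 y)"
    unfolding mapp_def B_def by (intro nn_integral_cong) (auto simp: distrib_right distrib_left mult_ac)
  also have "\<dots> = mapp Q u x + ennreal split * u x + (if x = 0 then ennreal (beta_star b) else 0) * u 0"
    by (simp add: nn_integral_add nn_integral_count_space_delta mapp_def)
  finally show ?thesis by simp
qed

text \<open>
  Adding \<open>exit\<close> to the diagonal makes all rates nonnegative.
\<close>

definition rate :: "int ^ 'd \<Rightarrow> 'd config \<Rightarrow> real" where
  "rate x C = particle_rate a b x C + (if C = {#x#} then exit else 0)"

text \<open>
  The three summands are the jumps, the death, and the branching; off the origin the diagonal keeps
  the slack \<open>split\<close> in place of the branching.
\<close>

lemma rate_decomposition:
  "ennreal (rate x C) = (if size C = 1 then Q x (THE y. C = {#y#}) else 0) + (if C =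
      {#} then ennreal (b 0) else 0) +
    (if x = 0 then (if 2 \<le> size C \<and> C = replicate_mset (size C) 0 then ennreal (b (size C)) else 0)
     else (if C = {#x#} then ennreal split else 0))"
  and rate_nonneg: "0 \<le> rate x C"
proof -
  have the: "(THE y. {#z#} = {#y#}) = z" for z :: "int ^ 'd" by auto
  consider "C = {#}" | y where "C = {#y#}" | "2 \<le> size C"
  proof -
    assume *: "C = {#} \<Longrightarrow> thesis" "\<And>y. C = {#y#} \<Longrightarrow> thesis" "2 \<le> size C \<Longrightarrow> thesis"
    show thesis
    proof (cases "size C")
      case 0
      then show ?thesis using *(1) by simp
    next
      case (Suc n)
      then show ?thesis using * size_1_singleton_mset[of C] by (cases n) auto
    qed
  qed
  note cases = this
  show "ennreal (rate x C) = (if size C = 1 then Q x (THE y. C = {#y#}) else 0) + (if C =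
      {#} then ennreal (b 0) else 0) +
    (if x = 0 then (if 2 \<le> size C \<and> C = replicate_mset (size C) 0 then ennreal (b (size C)) else 0)
     else (if C = {#x#} then ennreal split else 0))"
  proof (cases rule: cases)
    case 1
    then show ?thesis by (simp add: rate_def particle_rate_def)
  next
    case (2 y)
    then show ?thesis
      by (auto simp: rate_def particle_rate_def the Q_def exit_def split_def a_diag)
  next
    case 3
    then have "C \<noteq> {#}" "C \<noteq> {#x#}" "size C \<noteq> 1" by auto
    then show ?thesis using 3 by (simp add: rate_def particle_rate_def)
  qed
  show "0 \<le> rate x C"
  proof (cases rule: cases)
    case 1
    then show ?thesis by (simp add: rate_def particle_rate_def b_nonneg)
  next
    case (2 y)
    then show ?thesis using split_nonneg
      by (auto simp: rate_def particle_rate_def the exit_def split_def a_diag a_nonneg)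
  next
    case 3
    then have "C \<noteq> {#}" "C \<noteq> {#x#}" "size C \<noteq> 1" by auto
    then show ?thesis using 3 by (simp add: rate_def particle_rate_def b_nonneg)
  qed
qed

lemma rate_sum:
  "(\<Sum>\<^sub>+ C. ennreal (rate x C) * V C) =
     mapp Q (\<lambda>y. V {#y#}) x + ennreal (b 0) * V {#} +
     (if x = 0 then (\<Sum>k. ennreal (b (k + 2)) * V (replicate_mset (k + 2) 0)) else ennreal split *
         V {#x#})"
proof -
  have the: "(THE y. {#z#} = {#y#}) = z" for z :: "int ^ 'd" by auto
  have single: "C \<in> range (\<lambda>y. {#y#})" if "size C = 1" for C :: "'d config"
    using size_1_singleton_mset[OF that] by blast
  have 1: "(\<Sum>\<^sub>+ C. (if size C = 1 then Q x (THE y. C = {#y#}) else 0) * V C) = mapp Q (\<lambda>y. V {#y#}) x"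
    unfolding mapp_def
    by (subst nn_integral_count_space_inj[where j="\<lambda>y. {#y#}"])
       (use single in \<open>auto simp: inj_def the\<close>)
  have 2: "(\<Sum>\<^sub>+ C. (if C = {#} then ennreal (b 0) else 0) * V C) = ennreal (b 0) * V {#}"
    by (subst nn_integral_count_space_single[where x="{#}"]) auto
  have 3: "(\<Sum>\<^sub>+ C. (if C = {#x#} then ennreal split else 0) * V C) = ennreal split * V {#x#}"
    by (subst nn_integral_count_space_single[where x="{#x#}"]) auto
  have 4: "(\<Sum>\<^sub>+ C. (if 2 \<le> size C \<and> C = replicate_mset (size C) 0 then ennreal (b (size C)) else 0)
      * V C) =
      (\<Sum>k. ennreal (b (k + 2)) * V (replicate_mset (k + 2) 0))"
  proof -
    let ?f = "\<lambda>C :: 'd config. (if 2 \<le> size C \<and> C = replicate_mset (size C) 0 then ennreal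
        (b (size C)) else 0) * V C"
    have "inj (\<lambda>k. replicate_mset (k + 2) (0 :: int ^ 'd))"
      by (rule injI, drule arg_cong[of _ _ size]) simp
    moreover have "?f C = 0" if C: "C \<notin> range (\<lambda>k. replicate_mset (k + 2) 0)" for C
    proof -
      have "\<not> (2 \<le> size C \<and> C = replicate_mset (size C) 0)"
      proof
        assume *: "2 \<le> size C \<and> C = replicate_mset (size C) 0"
        then have "size C - 2 + 2 = size C" by linarith
        then have "C = replicate_mset (size C - 2 + 2) 0" using * by presburger
        then show False using C by blast
      qed
      then show ?thesis by (simp only: if_False mult_zero_left)
    qed
    ultimately have "(\<Sum>\<^sub>+ C. ?f C) = (\<Sum>\<^sub>+ k. ?f (replicate_mset (k + 2) 0))"
      by (rule nn_integral_count_space_inj)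
    also have "\<dots> = (\<Sum>\<^sub>+ k. ennreal (b (k + 2)) * V (replicate_mset (k + 2) 0))"
      by (rule nn_integral_cong) (simp only: size_replicate_mset le_add2 simp_thms if_True)
    finally show ?thesis by (simp only: nn_integral_count_space_nat)
  qed
  note add = nn_integral_add[OF borel_measurable_count_space borel_measurable_count_space]
  show ?thesis
  proof (cases "x = 0")
    case True
    show ?thesis
      unfolding rate_decomposition distrib_right if_P[OF True] by (simp only: add 1 2 4)
  next
    case False
    show ?thesis
      unfolding rate_decomposition distrib_right if_not_P[OF False] by (simp only: add 1 2 3)
  qed
qed

lemma rate_total: "(\<Sum>\<^sub>+ C. ennreal (rate x C)) = ennreal exit"
proof -
  have "(\<Sum>\<^sub>+ C. ennreal (rate x C)) = ennreal hold + ennreal (b 0) + ennreal split"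
    using rate_sum[of x "\<lambda>_. 1"] by (simp only: mult_1_right suminf_split mapp_def Q_row if_cancel)
  also have "\<dots> = ennreal (hold + b 0 + split)"
    using less_imp_le[OF hold_pos] b_nonneg[OF zero_neq_one] split_nonneg
        by (simp only: ennreal_plus add_nonneg_nonneg)
  also have "hold + b 0 + split = exit" by (simp add: exit_def split_def)
  finally show ?thesis .
qed

lemma transition: "transition_function P"
  and no_particles: "0 \<le> t \<Longrightarrow> P t {#} = return_pmf {#}"
  and branching: "0 \<le> t \<Longrightarrow> P t (C + C') = map_pmf (\<lambda>(u, v). u + v) (pair_pmf (P t C) (P t C'))"
  and jump: "jump_rate P {#x#} C (particle_rate a b x C)"
  using brw unfolding brw_transition_def by auto

text \<open>
  Rates are prescribed only for single particles. By independence, a configuration stays unchanged at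
  least with the probability that each of its particles does.
\<close>

lemma stay_put: "((\<lambda>h. pmf (P h C) C) \<longlongrightarrow> 1) (at_right 0)"
proof (induction C)
  case empty
  have "\<forall>\<^sub>F h in at_right 0. 1 = pmf (P h {#}) {#}"
    by (rule eventually_mono[OF eventually_at_right_less[of 0]]) (simp add: no_particles)
  then show ?case by (rule Lim_transform_eventually[OF tendsto_const])
next
  case (add x C)
  have "((\<lambda>h. pmf (P h {#x#}) {#x#} * pmf (P h C) C) \<longlongrightarrow> 1 * 1) (at_right 0)"
    by (intro tendsto_intros add.IH jump_rate_imp_continuous[OF jump])
  then have lim: "((\<lambda>h. pmf (P h {#x#}) {#x#} * pmf (P h C) C) \<longlongrightarrow> 1) (at_right 0)" by simp
  show ?case
  proof (rule tendsto_sandwich[OF _ _ lim tendsto_const])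
    show "\<forall>\<^sub>F h in at_right 0. pmf (P h {#x#}) {#x#} * pmf (P h C) C \<le> pmf (P h (add_mset x C))
        (add_mset x C)"
    proof (rule eventually_mono[OF eventually_at_right_less[of 0]])
      fix h :: real assume "0 < h"
      then have "P h (add_mset x C) = map_pmf (\<lambda>(u, v). u + v) (pair_pmf (P h {#x#}) (P h C))"
        using branching[of h "{#x#}" C] by simp
      then have "pmf (P h (add_mset x C)) (add_mset x C) =
          measure (pair_pmf (P h {#x#}) (P h C)) ((\<lambda>(u, v). u + v) -` {add_mset x C})"
        by (simp add: pmf_map)
      also have "\<dots> \<ge> measure (pair_pmf (P h {#x#}) (P h C)) {({#x#}, C)}"
        by (rule measure_pmf.finite_measure_mono) auto
      finally show "pmf (P h {#x#}) {#x#} * pmf (P h C) C \<le> pmf (P h (add_mset x C)) (add_mset x C)"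
        by (simp add: measure_pmf_single pmf_pair)
    qed
  qed (simp add: pmf_le_1)
qed

lemma backward:
  fixes g :: "'d config \<Rightarrow> ennreal"
  assumes "\<And>v. g v \<noteq> \<infinity>"
  shows "(\<lambda>s. \<integral>\<^sup>+ w. g w \<partial>P (max 0 s) C) \<in> borel_measurable borel"
    and "0 \<le> t \<Longrightarrow> ennreal (exp (exit * t)) * (\<integral>\<^sup>+ w. g w \<partial>P (max 0 t) {#x#}) = g {#x#} +
      (\<integral>\<^sup>+ s\<in>{0..t}. ennreal (exp (exit * s)) * (\<Sum>\<^sub>+ C. ennreal (rate x C) *
          (\<integral>\<^sup>+ w. g w \<partial>P (max 0 s) C)) \<partial>lborel)"
proof -
  have jr: "jump_rate P {#x#} C (rate x C - (if C = {#x#} then exit else 0))" for x C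
    using jump[of x C] by (simp add: rate_def)
  note be = backward_equation[OF transition jr rate_nonneg rate_total exit_nonneg stay_put, where g=g]
  show "(\<lambda>s. \<integral>\<^sup>+ w. g w \<partial>P (max 0 s) C) \<in> borel_measurable borel"
    by (rule be(1)[where t=0]) (use assms in auto)
  assume t: "0 \<le> t"
  show "ennreal (exp (exit * t)) * (\<integral>\<^sup>+ w. g w \<partial>P (max 0 t) {#x#}) = g {#x#} +
      (\<integral>\<^sup>+ s\<in>{0..t}. ennreal (exp (exit * s)) * (\<Sum>\<^sub>+ C. ennreal (rate x C) *
          (\<integral>\<^sup>+ w. g w \<partial>P (max 0 s) C)) \<partial>lborel)"
    unfolding max_absorb2[OF t] by (rule be(2)[OF assms t])
qed

end

section \<open>Moments of additive functionals\<close>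

lemma mexp_cmult: "mexp B t (\<lambda>x. c * u x) x = c * mexp B t u x"
  unfolding mexp_def by (simp add: iter_cmult mult.left_commute flip: ennreal_suminf_cmult)

lemma binomial_split_ends:
  fixes x y :: "'a::comm_semiring_1"
  assumes "1 \<le> n"
  shows "(x + y) ^ n = x ^ n + y ^ n + (\<Sum>j\<in>{1..<n}. of_nat (n choose j) * x ^ j * y ^ (n - j))"
proof -
  have "{..n} = insert 0 (insert n {1..<n})" using assms by auto
  then have "(\<Sum>j\<le>n. of_nat (n choose j) * x ^ j * y ^ (n - j)) =
      of_nat (n choose 0) * x ^ 0 * y ^ (n - 0) + (of_nat (n choose n) * x ^ n * y ^ (n - n) +
        (\<Sum>j\<in>{1..<n}. of_nat (n choose j) * x ^ j * y ^ (n - j)))"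
    using assms by (simp del: binomial_n_n binomial_n_0)
  then show ?thesis by (simp add: binomial_ring ac_simps)
qed

lemma min_add_power_le:
  fixes x y :: nat
  assumes "1 \<le> n"
  shows "min (x + y) N ^ n \<le> min x N ^ n + min y N ^ n + (\<Sum>j\<in>{1..<n}. (n choose j) * x ^ j *
      y ^ (n - j))"
proof -
  have "min (x + y) N ^ n \<le> (min x N + min y N) ^ n" by (intro power_mono) auto
  also have "\<dots> = min x N ^ n + min y N ^ n + (\<Sum>j\<in>{1..<n}. (n choose j) * min x N ^ j * min y N ^
      (n - j))"
    using binomial_split_ends[OF assms, of "min x N" "min y N"] by simp
  also have "\<dots> \<le> min x N ^ n + min y N ^ n + (\<Sum>j\<in>{1..<n}. (n choose j) * x ^ j * y ^ (n - j))"
    by (intro add_mono order_refl sum_mono mult_mono power_mono) auto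
  finally show ?thesis .
qed

text \<open>
  Instances are the number of particles at a given site and the total number of particles.
\<close>

locale additive_functional = branching_walk a b P for a :: "int ^ 'd::finite \<Rightarrow> int ^ 'd \<Rightarrow> real" and
    b P +
  fixes phi :: "'d config \<Rightarrow> nat"
  assumes phi_add: "phi (C + C') = phi C + phi C'"
begin

lemma phi_empty: "phi {#} = 0"
  using phi_add[of "{#}" "{#}"] by simp

definition moment :: "nat \<Rightarrow> real \<Rightarrow> 'd config \<Rightarrow> ennreal" where
  "moment n t C = (\<integral>\<^sup>+ w. of_nat (phi w) ^ n \<partial>P (max 0 t) C)"

definition truncated_moment :: "nat \<Rightarrow> nat \<Rightarrow> real \<Rightarrow> 'd config \<Rightarrow> ennreal" where
  "truncated_moment N n t C = (\<integral>\<^sup>+ w. of_nat (min (phi w) N) ^ n \<partial>P (max 0 t) C)"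

text \<open>
  The part of the \<open>n\<close>-th moment of \<open>k\<close> independent populations that involves lower moments: the
  mixed binomial terms that arise when the populations are added one at a time.
\<close>

definition cross :: "nat \<Rightarrow> real \<Rightarrow> nat \<Rightarrow> ennreal" where
  "cross n t k = (\<Sum>i<k. \<Sum>j\<in>{1..<n}. of_nat (n choose j) * moment j t (replicate_mset i 0) *
      moment (n - j) t {#0#})"

text \<open>
  The rate at which branching at the origin feeds products of lower moments into the \<open>n\<close>-th moment.
\<close>

definition source :: "nat \<Rightarrow> real \<Rightarrow> ennreal" where
  "source n t = (\<Sum>k. ennreal (b (k + 2)) * cross n t (k + 2))"

lemma nn_integral_branching:
  "(\<integral>\<^sup>+ w. g w \<partial>P (max 0 t) (C + C')) = (\<integral>\<^sup>+ u. \<integral>\<^sup>+ v. g (u + v) \<partial>P (max 0 t) C' \<partial>P (max 0 t) C)"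
  by (simp add: branching nn_integral_pair_pmf' split_beta)

lemma moment_empty: "1 \<le> n \<Longrightarrow> moment n t {#} = 0" and truncated_moment_empty: "1 \<le> n \<Longrightarrow>
    truncated_moment N n t {#} = 0"
  by (simp_all add: moment_def truncated_moment_def no_particles phi_empty)

lemma moment_add:
  assumes "1 \<le> n"
  shows "moment n t (C + C') = moment n t C + moment n t C' +
    (\<Sum>j\<in>{1..<n}. of_nat (n choose j) * moment j t C * moment (n - j) t C')"
  unfolding moment_def nn_integral_branching phi_add of_nat_add binomial_split_ends[OF assms]
  by (simp add: nn_integral_add nn_integral_sum nn_integral_cmult nn_integral_multc)

text \<open>
  Truncation is subadditive; in the mixed terms it is simply dropped, which leaves the same
  \<open>cross\<close> term as for the untruncated moments.
\<close>

lemma truncated_moment_add_le: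
  assumes "1 \<le> n"
  shows "truncated_moment N n t (C + C') \<le> truncated_moment N n t C + truncated_moment N n t C' +
    (\<Sum>j\<in>{1..<n}. of_nat (n choose j) * moment j t C * moment (n - j) t C')"
proof -
  have "(of_nat (min (phi u + phi v) N) ^ n :: ennreal) \<le> of_nat (min (phi u) N) ^ n +
      of_nat (min (phi v) N) ^ n +
      (\<Sum>j\<in>{1..<n}. of_nat (n choose j) * of_nat (phi u) ^ j * of_nat (phi v) ^ (n - j))" for u v
    using of_nat_mono[OF min_add_power_le[OF assms, of "phi u" "phi v" N], where 'a=ennreal] by simp
  then have "truncated_moment N n t (C + C') \<le> (\<integral>\<^sup>+ u. \<integral>\<^sup>+ v. of_nat (min (phi u) N) ^ n +
      of_nat (min (phi v) N) ^ n +
      (\<Sum>j\<in>{1..<n}. of_nat (n choose j) * of_nat (phi u) ^ j * of_nat (phi v) ^ (n - j)) \<partial>P (max 0 t)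
          C' \<partial>P (max 0 t) C)"
    unfolding truncated_moment_def nn_integral_branching phi_add by (intro nn_integral_mono)
  also have "\<dots> = truncated_moment N n t C + truncated_moment N n t C' +
    (\<Sum>j\<in>{1..<n}. of_nat (n choose j) * moment j t C * moment (n - j) t C')"
    unfolding moment_def truncated_moment_def
    by (simp add: nn_integral_add nn_integral_sum nn_integral_cmult nn_integral_multc)
  finally show ?thesis .
qed

lemma moment_replicate:
  assumes "1 \<le> n"
  shows "moment n t (replicate_mset k 0) = of_nat k * moment n t {#0#} + cross n t k"
proof (induction k)
  case 0
  then show ?case using assms by (simp add: moment_empty cross_def)
next
  case (Suc k)
  have "moment n t (replicate_mset (Suc k) 0) = moment n t (replicate_mset k 0 + {#0#})" by simp
  then show ?case unfolding moment_add[OF assms] Suc by (simp add: cross_def distrib_right add_ac)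
qed

lemma truncated_moment_replicate_le:
  assumes "1 \<le> n"
  shows "truncated_moment N n t (replicate_mset k 0) \<le> of_nat k * truncated_moment N n t {#0#} +
      cross n t k"
proof (induction k)
  case 0
  then show ?case using assms by (simp add: truncated_moment_empty cross_def)
next
  case (Suc k)
  have "truncated_moment N n t (replicate_mset (Suc k) 0) = truncated_moment N n t (replicate_mset k
      0 + {#0#})" by simp
  also have "\<dots> \<le> truncated_moment N n t (replicate_mset k 0) + truncated_moment N n t {#0#} +
    (\<Sum>j\<in>{1..<n}. of_nat (n choose j) * moment j t (replicate_mset k 0) * moment (n - j) t {#0#})"
    by (rule truncated_moment_add_le[OF assms])
  also have "\<dots> \<le> (of_nat k * truncated_moment N n t {#0#} + cross n t k) +
      truncated_moment N n t {#0#} +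
    (\<Sum>j\<in>{1..<n}. of_nat (n choose j) * moment j t (replicate_mset k 0) * moment (n - j) t {#0#})"
    by (intro add_mono Suc order_refl)
  also have "\<dots> = of_nat (Suc k) * truncated_moment N n t {#0#} + cross n t (Suc k)"
    by (simp add: cross_def distrib_right add_ac)
  finally show ?case .
qed

lemma offspring_sum:
  "(\<Sum>k. ennreal (b (k + 2)) * (of_nat (k + 2) * v + K (k + 2))) =
    ennreal (beta_star b + split) * v + (\<Sum>k. ennreal (b (k + 2)) * K (k + 2))"
proof -
  have "ennreal (b (k + 2)) * (of_nat (k + 2) * v + K (k + 2)) =
      ennreal (real (k + 2) * b (k + 2)) * v + ennreal (b (k + 2)) * K (k + 2)" for k
  proof -
    have "ennreal (real (k + 2) * b (k + 2)) = of_nat (k + 2) * ennreal (b (k + 2))"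
      by (simp only: ennreal_mult' of_nat_0_le_iff ennreal_of_nat_eq_real_of_nat)
    then show ?thesis by (simp only: distrib_left mult_ac)
  qed
  then show ?thesis
    by (simp only: suminf_add[OF summableI summableI, symmetric] ennreal_suminf_multc suminf_mean)
qed

text \<open>
  The branching rates weighted with \<open>k\<close> produce \<open>\<beta>\<^sup>* + split\<close> at the origin. Together with the slack
  \<open>split\<close> at the other sites this is the matrix \<open>B\<close>.
\<close>

lemma rate_sum_moment:
  assumes "V {#} = 0"
  shows "(\<And>k. V (replicate_mset k 0) = of_nat k * V {#0#} + K k) \<Longrightarrow>
    (\<Sum>\<^sub>+ C. ennreal (rate x C) * V C) =
     mapp B (\<lambda>y. V {#y#}) x + (\<Sum>k. ennreal (b (k + 2)) * K (k + 2)) * delta 0 x"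
    and "(\<And>k. V (replicate_mset k 0) \<le> of_nat k * V {#0#} + K k) \<Longrightarrow>
    (\<Sum>\<^sub>+ C. ennreal (rate x C) * V C) \<le>
     mapp B (\<lambda>y. V {#y#}) x + (\<Sum>k. ennreal (b (k + 2)) * K (k + 2)) * delta 0 x"
proof -
  have plus: "ennreal (beta_star b + split) = ennreal (beta_star b) + ennreal split"
    by (rule ennreal_plus[OF beta_star_nonneg split_nonneg])
  show "(\<Sum>\<^sub>+ C. ennreal (rate x C) * V C) =
     mapp B (\<lambda>y. V {#y#}) x + (\<Sum>k. ennreal (b (k + 2)) * K (k + 2)) * delta 0 x"
    if V: "\<And>k. V (replicate_mset k 0) = of_nat k * V {#0#} + K k"
    unfolding rate_sum mapp_B V offspring_sum plus
    by (cases "x = 0") (simp_all only: assms mult_zero_right if_True if_False indicator_simps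
        insertI1 empty_iff insert_iff mult_1_right add_0_right add_0_left distrib_right add_ac
            simp_thms)
  show "(\<Sum>\<^sub>+ C. ennreal (rate x C) * V C) \<le>
     mapp B (\<lambda>y. V {#y#}) x + (\<Sum>k. ennreal (b (k + 2)) * K (k + 2)) * delta 0 x"
    if V: "\<And>k. V (replicate_mset k 0) \<le> of_nat k * V {#0#} + K k"
  proof -
    have "(\<Sum>k. ennreal (b (k + 2)) * V (replicate_mset (k + 2) 0)) \<le>
        (\<Sum>k. ennreal (b (k + 2)) * (of_nat (k + 2) * V {#0#} + K (k + 2)))"
      by (intro suminf_le mult_left_mono V summableI) auto
    then have "(\<Sum>k. ennreal (b (k + 2)) * V (replicate_mset (k + 2) 0)) \<le>
        ennreal (beta_star b) * V {#0#} + ennreal split * V {#0#} + (\<Sum>k. ennreal (b (k + 2)) *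
            K (k + 2))"
      by (simp only: offspring_sum plus distrib_right)
    then have *: "mapp Q (\<lambda>y. V {#y#}) 0 + (\<Sum>k. ennreal (b (k + 2)) * V (replicate_mset (k + 2) 0)) \<le>
        mapp Q (\<lambda>y. V {#y#}) 0 + (ennreal (beta_star b) * V {#0#} + ennreal split * V {#0#} +
            (\<Sum>k. ennreal (b (k + 2)) * K (k + 2)))"
      by (rule add_left_mono)
    show ?thesis
    proof (cases "x = 0")
      case True
      then show ?thesis using *
        unfolding rate_sum mapp_B by (simp only: assms mult_zero_right if_True indicator_simps
            insertI1 mult_1_right add_0_right add_0_left add_ac simp_thms)
    next
      case False
      then show ?thesis
        unfolding rate_sum mapp_B by (simp only: assms mult_zero_right if_False add_0_right
            add_0_left simp_thms indicator_simps insert_iff empty_iff order_refl)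
    qed
  qed
qed

lemma finite_power_of_nat: "(of_nat k ^ n :: ennreal) \<noteq> \<infinity>"
  by (simp add: power_eq_top_ennreal)

lemma moment_measurable [measurable]: "(\<lambda>t. moment n t C) \<in> borel_measurable borel"
  unfolding moment_def by (rule backward(1)) (rule finite_power_of_nat)

lemma truncated_moment_measurable [measurable]: "(\<lambda>t. truncated_moment N n t C) \<in> borel_measurable
    borel"
  unfolding truncated_moment_def by (rule backward(1)) (rule finite_power_of_nat)

lemma cross_measurable [measurable]: "(\<lambda>t. cross n t k) \<in> borel_measurable borel"
  unfolding cross_def by measurable

lemma source_measurable [measurable]: "(\<lambda>t. source n t) \<in> borel_measurable borel"
  unfolding source_def by measurable

lemma mapp_B_one: "mapp B (\<lambda>_. 1) x \<le> ennreal (hold + split + beta_star b)"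
proof -
  have "mapp B (\<lambda>_. 1) x = ennreal hold + ennreal split + (if x = 0 then ennreal (beta_star b) else 0)"
    unfolding mapp_B by (simp add: mapp_def Q_row)
  also have "\<dots> \<le> ennreal hold + ennreal split + ennreal (beta_star b)"
    by (intro add_mono) auto
  also have "\<dots> = ennreal (hold + split + beta_star b)"
    using less_imp_le[OF hold_pos] split_nonneg beta_star_nonneg
        by (simp only: ennreal_plus add_nonneg_nonneg)
  finally show ?thesis .
qed

text \<open>
  The exact equation gives the lower bound. For the upper bound, the truncated moments are bounded
  and satisfy the same equation with \<open>\<le>\<close>; then let the truncation level tend to infinity.
\<close>

lemma moment_formula:
  assumes n: "1 \<le> n" and t: "0 \<le> t"
  shows "ennreal (exp (exit * t)) * moment n t {#x#} = mexp B t (\<lambda>x. of_nat (phi {#x#}) ^ n) x +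
    (\<integral>\<^sup>+ r\<in>{0..t}. mexp B (t - r) (delta 0) x * (ennreal (exp (exit * r)) * source n r) \<partial>lborel)"
proof -
  define f where "f s x = ennreal (exp (exit * s)) * source n s * delta 0 x" for s and x :: "int ^ 'd"
  define g where "g x = (of_nat (phi {#x#}) ^ n :: ennreal)" for x
  define U where "U s x = ennreal (exp (exit * s)) * moment n s {#x#}" for s x
  define W where "W N s x = ennreal (exp (exit * s)) * truncated_moment N n s {#x#}" for N s x
  have fm: "\<And>x. (\<lambda>s. f s x) \<in> borel_measurable borel" unfolding f_def by measurable
  have Um: "\<And>x. (\<lambda>s. U s x) \<in> borel_measurable borel" unfolding U_def by measurable
  have Wm: "\<And>N x. (\<lambda>s. W N s x) \<in> borel_measurable borel" unfolding W_def by measurable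
  have "U t x = g x + (\<integral>\<^sup>+ s\<in>{0..t}. (mapp B (U s) x + f s x) \<partial>lborel)" if "0 \<le> t" for t x
  proof -
    have "ennreal (exp (exit * s)) * (\<Sum>\<^sub>+ C. ennreal (rate x C) * moment n s C) = mapp B (U s) x +
        f s x" for s
      by (simp only: rate_sum_moment(1)[where V="moment n s", OF moment_empty[OF n]
          moment_replicate[OF n]]
         source_def[symmetric] f_def U_def[abs_def] mapp_cmult distrib_left mult.assoc)
    moreover have "U t x = g x + (\<integral>\<^sup>+ s\<in>{0..t}. ennreal (exp (exit * s)) *
        (\<Sum>\<^sub>+ C. ennreal (rate x C) * moment n s C) \<partial>lborel)"
      unfolding U_def moment_def g_def by (rule backward(2)[OF finite_power_of_nat that])
    ultimately show ?thesis by (simp only:)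
  qed
  note Ueq = this
  have Wle: "W N t x \<le> g x + (\<integral>\<^sup>+ s\<in>{0..t}. (mapp B (W N s) x + f s x) \<partial>lborel)" if "0 \<le> t" for N t x
  proof -
    have *: "ennreal (exp (exit * s)) * (\<Sum>\<^sub>+ C. ennreal (rate x C) * truncated_moment N n s C) \<le>
        mapp B (W N s) x + f s x" for s
    proof -
      have "ennreal (exp (exit * s)) * (\<Sum>\<^sub>+ C. ennreal (rate x C) * truncated_moment N n s C) \<le>
          ennreal (exp (exit * s)) * (mapp B (\<lambda>y. truncated_moment N n s {#y#}) x +
              source n s * delta 0 x)"
        unfolding source_def
        by (intro mult_left_mono rate_sum_moment(2)[where V="truncated_moment N n s"]
            truncated_moment_empty[OF n] truncated_moment_replicate_le[OF n]) auto
      also have "\<dots> = mapp B (W N s) x + f s x"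
        by (simp only: f_def W_def[abs_def] mapp_cmult distrib_left mult.assoc)
      finally show ?thesis .
    qed
    have "W N t x = of_nat (min (phi {#x#}) N) ^ n + (\<integral>\<^sup>+ s\<in>{0..t}. ennreal (exp (exit * s)) *
        (\<Sum>\<^sub>+ C. ennreal (rate x C) * truncated_moment N n s C) \<partial>lborel)"
      unfolding W_def truncated_moment_def by (rule backward(2)[OF finite_power_of_nat that])
    also have "\<dots> \<le> g x + (\<integral>\<^sup>+ s\<in>{0..t}. (mapp B (W N s) x + f s x) \<partial>lborel)"
      unfolding g_def by (intro add_mono nn_integral_mono mult_right_mono * power_mono) auto
    finally show ?thesis .
  qed
  have Wbd: "W N s x \<le> ennreal (exp (exit * t) * real N ^ n)" if "0 \<le> s" "s \<le> t" for N s x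
  proof -
    have "truncated_moment N n s {#x#} \<le> (\<integral>\<^sup>+ w. of_nat N ^ n \<partial>P (max 0 s) {#x#})"
      unfolding truncated_moment_def by (intro nn_integral_mono power_mono) auto
    also have "\<dots> = of_nat N ^ n" by (simp add: measure_pmf.emeasure_space_1)
    also have "\<dots> = ennreal (real N ^ n)" by (simp add: ennreal_power[symmetric]
        ennreal_of_nat_eq_real_of_nat)
    finally have "W N s x \<le> ennreal (exp (exit * s)) * ennreal (real N ^ n)"
      unfolding W_def by (intro mult_left_mono) auto
    also have "\<dots> \<le> ennreal (exp (exit * t) * real N ^ n)"
      using that exit_nonneg by (simp add: ennreal_mult'[symmetric] ennreal_leI mult_left_mono
          mult_right_mono)
    finally show ?thesis .
  qed
  define V where "V = mexp B t g x + (\<integral>\<^sup>+ r\<in>{0..t}. mexp B (t - r) (f r) x \<partial>lborel)"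
  have "V \<le> U t x"
    unfolding V_def
    by (rule duhamel_lower_bound[where f=f and g=g and U=U and B=B, OF Um fm _ t]) (simp only: Ueq
        order_refl)
  moreover have "W N t x \<le> V" for N
    unfolding V_def
    by (rule duhamel_upper_bound[where f=f and g=g and U="W N" and B=B and T=t, OF Wm fm Wle Wbd _
        mapp_B_one _ t order_refl])
       (use less_imp_le[OF hold_pos] split_nonneg beta_star_nonneg in \<open>auto intro: add_nonneg_nonneg\<close>)
  then have "(SUP N. W N t x) \<le> V" by (rule SUP_least)
  moreover have "(SUP N. W N t x) = U t x"
  proof -
    have "(SUP N. (of_nat (min (phi w) N) ^ n :: ennreal)) = of_nat (phi w) ^ n" for w
    proof (rule antisym)
      show "(SUP N. (of_nat (min (phi w) N) ^ n :: ennreal)) \<le> of_nat (phi w) ^ n"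
        by (intro SUP_least power_mono) auto
      show "of_nat (phi w) ^ n \<le> (SUP N. (of_nat (min (phi w) N) ^ n :: ennreal))"
        by (rule SUP_upper2[of "phi w"]) auto
    qed
    then have "moment n t {#x#} = (\<integral>\<^sup>+ w. (SUP N. of_nat (min (phi w) N) ^ n) \<partial>P (max 0 t) {#x#})"
      unfolding moment_def by simp
    also have "\<dots> = (SUP N. truncated_moment N n t {#x#})"
      unfolding truncated_moment_def
      by (rule nn_integral_monotone_convergence_SUP) (auto simp: incseq_def le_fun_def intro!:
          power_mono)
    finally show ?thesis unfolding U_def W_def by (simp add: SUP_mult_left_ennreal)
  qed
  ultimately have "U t x = V" by auto
  moreover have "mexp B (t - r) (f r) x = mexp B (t - r) (delta 0) x * (ennreal (exp (exit * r)) *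
      source n r)" for r
    unfolding f_def mexp_cmult by (simp only: mult_ac)
  ultimately show ?thesis unfolding U_def V_def g_def by (simp only: mult.assoc)
qed

end

section \<open>The resolvent at the critical level\<close>

lemma has_sum_nn_integral:
  fixes f :: "'s \<Rightarrow> real"
  assumes "(\<Sum>\<^sub>+ x. ennreal (f x)) = ennreal s" "\<And>x. 0 \<le> f x" "0 \<le> s"
  shows "(f has_sum s) UNIV"
proof -
  have i: "integrable (count_space UNIV) f"
    by (rule integrableI_nn_integral_finite[OF _ _ assms(1)]) (use assms in auto)
  have v: "integral\<^sup>L (count_space UNIV) f = s"
    using integral_eq_nn_integral[of f "count_space UNIV"] assms by simp
  have as: "Infinite_Set_Sum.abs_summable_on f UNIV" using i
      by (simp add: Infinite_Set_Sum.abs_summable_on_def)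
  then have "(\<lambda>x. norm (f x)) summable_on UNIV" by (simp only: abs_summable_equivalent)
  then have "f summable_on UNIV" using assms(2) by simp
  moreover have "infsum f UNIV = s" using infsetsum_infsum[OF as] v by (simp add: infsetsum_def)
  ultimately show ?thesis by (metis has_sum_infsum)
qed

text \<open>
  The Erlang density has integral 1.
\<close>

lemma nn_integral_exp_power:
  assumes "0 < l"
  shows "(\<integral>\<^sup>+ t\<in>{0..}. ennreal (exp (- l * t) * (t ^ n / fact n)) \<partial>lborel) = ennreal (1 / l ^ Suc n)"
proof -
  have "(\<integral>\<^sup>+ t. ennreal (erlang_density n l t) \<partial>lborel) = 1"
    using nn_integral_erlang_ith_moment[OF assms, of n 0] by simp
  moreover have "ennreal (exp (- l * t) * (t ^ n / fact n)) * indicator {0..} t =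
      ennreal (1 / l ^ Suc n) * ennreal (erlang_density n l t)" for t
    using assms by (auto simp: erlang_density_def ennreal_mult'[symmetric] indicator_def field_simps)
  ultimately show ?thesis by (simp add: nn_integral_cmult)
qed

context walk
begin

lemma iter_Q_one: "(mapp Q ^^ n) (\<lambda>_. 1) x \<le> ennreal (hold ^ n)"
  by (rule iter_const_le) (use hold_pos Q_row in \<open>auto simp: mapp_def\<close>)

text \<open>
  By symmetry, a column sum of a power of \<open>Q\<close> is a row sum.
\<close>

lemma iter_Q_total: "(\<Sum>\<^sub>+ x. (mapp Q ^^ n) (delta y) x) \<le> ennreal (hold ^ n)"
proof -
  have "(\<Sum>\<^sub>+ x. (mapp Q ^^ n) (delta y) x) = (\<Sum>\<^sub>+ x. 1 * (mapp Q ^^ n) (delta y) x)"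
    by simp
  also have "\<dots> = (\<Sum>\<^sub>+ x. (mapp Q ^^ n) (\<lambda>_. 1) x * delta y x)"
    by (rule iter_symmetric) (rule Q_sym)
  also have "\<dots> = (mapp Q ^^ n) (\<lambda>_. 1) y"
    by (subst nn_integral_count_space_single[where x=y]) auto
  finally show ?thesis using iter_Q_one by simp
qed

lemma iter_Q_le: "(mapp Q ^^ n) (delta y) x \<le> ennreal (hold ^ n)"
proof -
  have "(mapp Q ^^ n) (delta y) x \<le> (mapp Q ^^ n) (\<lambda>_. 1) x"
    by (rule iter_mono) (simp add: indicator_def)
  then show ?thesis using iter_Q_one[of n x] by (rule order_trans)
qed

text \<open>
  The Green function at the origin is \<open>\<Sum> return_coeff n / (\<lambda> + hold)\<^bsup>n+1\<^esup>\<close>, a power series in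
  \<open>1 / (\<lambda> + hold)\<close>.
\<close>

definition return_coeff :: "nat \<Rightarrow> real" where
  "return_coeff n = enn2real ((mapp Q ^^ n) (delta 0) 0)"

lemma ennreal_return_coeff: "ennreal (return_coeff n) = (mapp Q ^^ n) (delta 0) 0"
  unfolding return_coeff_def by (intro ennreal_enn2real) (rule le_less_trans[OF iter_Q_le
      ennreal_less_top])

lemma return_coeff: "0 \<le> return_coeff n" "return_coeff n \<le> hold ^ n"
proof -
  show "0 \<le> return_coeff n" by (simp add: return_coeff_def)
  show "return_coeff n \<le> hold ^ n"
    using iter_Q_le[of n 0 0] hold_pos unfolding ennreal_return_coeff[symmetric]
        by (simp add: ennreal_le_iff)
qed

lemma green_series:
  assumes p: "walk_transition a p"
  shows "green p 0 0 0 = (\<Sum>n. ennreal (return_coeff n / hold ^ Suc n))"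
proof -
  have "green p 0 0 0 = (\<integral>\<^sup>+ t. (\<Sum>n. ennreal (exp (- hold * t) * (t ^ n / fact n)) * indicator {0..}
      t * ennreal (return_coeff n)) \<partial>lborel)"
    unfolding green_def
  proof (rule nn_integral_cong)
    fix t :: real
    show "ennreal (exp (- 0 * t) * pmf (p t 0) 0) * indicator {0..} t =
       (\<Sum>n. ennreal (exp (- hold * t) * (t ^ n / fact n)) * indicator {0..} t *
           ennreal (return_coeff n))"
    proof (cases "0 \<le> t")
      case True
      have "ennreal (pmf (p t 0) 0) = ennreal (exp (- hold * t)) * (ennreal (exp (hold * t)) *
          ennreal (pmf (p t 0) 0))"
      proof -
        have "ennreal (exp (- hold * t)) * ennreal (exp (hold * t)) = ennreal (exp (- hold * t) *
            exp (hold * t))"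
          by (rule ennreal_mult'[symmetric]) simp
        also have "exp (- hold * t) * exp (hold * t) = 1" by (simp flip: exp_add)
        finally show ?thesis by (simp only: mult.assoc[symmetric] ennreal_1 mult_1_left)
      qed
      also have "\<dots> = ennreal (exp (- hold * t)) * (\<Sum>n. ennreal (t ^ n / fact n) *
          ennreal (return_coeff n))"
        by (simp only: walk_transition_exp[OF p True] mexp_def ennreal_return_coeff)
      also have "\<dots> = (\<Sum>n. ennreal (exp (- hold * t)) * (ennreal (t ^ n / fact n) *
          ennreal (return_coeff n)))"
        by (rule ennreal_suminf_cmult[symmetric])
      also have "\<dots> = (\<Sum>n. ennreal (exp (- hold * t) * (t ^ n / fact n)) * indicator {0..} t *
          ennreal (return_coeff n))"
      proof (intro suminf_cong)
        fix n
        have "ennreal (exp (- hold * t) * (t ^ n / fact n)) = ennreal (exp (- hold * t)) *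
            ennreal (t ^ n / fact n)"
          by (rule ennreal_mult') simp
        then show "ennreal (exp (- hold * t)) * (ennreal (t ^ n / fact n) * ennreal (return_coeff n)) =
            ennreal (exp (- hold * t) * (t ^ n / fact n)) * indicator {0..} t *
                ennreal (return_coeff n)"
          using True by (simp only: mult.assoc indicator_simps atLeast_iff mult_1_left)
      qed
      finally show ?thesis using True by simp
    qed simp
  qed
  also have "\<dots> = (\<Sum>n. \<integral>\<^sup>+ t. ennreal (exp (- hold * t) * (t ^ n / fact n)) * indicator {0..} t *
      ennreal (return_coeff n) \<partial>lborel)"
    by (rule nn_integral_suminf) measurable
  also have "\<dots> = (\<Sum>n. ennreal (1 / hold ^ Suc n) * ennreal (return_coeff n))"
    by (intro suminf_cong, subst nn_integral_multc) (measurable, simp only: nn_integral_exp_power[OF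
        hold_pos])
  finally show ?thesis
    using hold_pos return_coeff(1) by (simp add: ennreal_mult'[symmetric])
qed

lemma resolvent_summable:
  assumes "hold < \<theta>"
  shows "summable (\<lambda>n. return_coeff n / \<theta> ^ Suc n)"
proof (rule summable_comparison_test'[where N=0])
  show "summable (\<lambda>n. 1 / \<theta> * (hold / \<theta>) ^ n)"
    using assms hold_pos by (intro summable_mult summable_geometric) auto
  show "norm (return_coeff n / \<theta> ^ Suc n) \<le> 1 / \<theta> * (hold / \<theta>) ^ n" for n
    using assms hold_pos return_coeff[of n] by (simp add: power_divide divide_simps)
qed

text \<open>
  The intermediate value theorem: by supercriticality the series exceeds \<open>1 / \<beta>\<close> near \<open>\<theta> = hold\<close>,
  where already a finite partial sum does, and it is at most \<open>1 / (\<theta> - hold)\<close> by \<open>return_coeff n \<le>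
  hold\<^sup>n\<close>.
\<close>

lemma critical_resolvent:
  assumes p: "walk_transition a p" and \<beta>: "0 < \<beta>" "beta_c p < \<beta>"
  obtains \<theta> where "hold < \<theta>" "\<beta> * (\<Sum>n. return_coeff n / \<theta> ^ Suc n) = 1"
proof -
  define g where "g \<theta> = (\<Sum>n. return_coeff n / \<theta> ^ Suc n)" for \<theta>
  have "ennreal (1 / \<beta>) < (\<Sum>n. ennreal (return_coeff n / hold ^ Suc n))"
  proof (cases "green p 0 0 0 = \<infinity>")
    case True
    then show ?thesis unfolding green_series[OF p, symmetric] by simp
  next
    case False
    then have G: "green p 0 0 0 = ennreal (enn2real (green p 0 0 0))" by (simp add: less_top)
    have "ennreal (return_coeff 0 / hold ^ Suc 0) \<le> green p 0 0 0"
      unfolding green_series[OF p]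
      using sum_le_suminf[of "\<lambda>n. ennreal (return_coeff n / hold ^ Suc n)" "{0}"] by simp
    moreover have "return_coeff 0 = 1" by (simp add: return_coeff_def)
    ultimately have pos: "0 < enn2real (green p 0 0 0)"
    proof -
      have "1 / hold \<le> enn2real (green p 0 0 0)"
        using \<open>ennreal (return_coeff 0 / hold ^ Suc 0) \<le> green p 0 0 0\<close> \<open>return_coeff 0 = 1\<close>
        using hold_pos by (subst (asm) G) (auto simp: ennreal_le_iff2)
      moreover have "0 < 1 / hold" using hold_pos by simp
      ultimately show ?thesis by linarith
    qed
    have "1 / enn2real (green p 0 0 0) < \<beta>" using \<beta>(2) False by (simp add: beta_c_def)
    then have "1 / \<beta> < enn2real (green p 0 0 0)" using pos \<beta>(1) by (simp add: field_simps)
    then show ?thesis unfolding green_series[OF p, symmetric] using G \<beta> by (metis ennreal_lessI pos)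
  qed
  then obtain N where "ennreal (1 / \<beta>) < (\<Sum>n<N. ennreal (return_coeff n / hold ^ Suc n))"
    unfolding suminf_eq_SUP less_SUP_iff by blast
  then have N: "1 / \<beta> < (\<Sum>n<N. return_coeff n / hold ^ Suc n)"
    using return_coeff(1) hold_pos \<beta>(1) by (subst (asm) sum_ennreal) (auto simp: ennreal_less_iff)
  have "((\<lambda>\<theta>. \<Sum>n<N. return_coeff n / \<theta> ^ Suc n) \<longlongrightarrow> (\<Sum>n<N. return_coeff n / hold ^ Suc n)) (at_right
      hold)"
    using hold_pos by (intro tendsto_intros) auto
  then have "\<forall>\<^sub>F \<theta> in at_right hold. 1 / \<beta> < (\<Sum>n<N. return_coeff n / \<theta> ^ Suc n)"
    by (rule order_tendstoD(1)[OF _ N])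
  then obtain d where d: "hold < d" "\<And>\<theta>. hold < \<theta> \<Longrightarrow> \<theta> < d \<Longrightarrow> 1 / \<beta> < (\<Sum>n<N. return_coeff n / \<theta> ^ Suc n)"
    by (auto simp: eventually_at_right_field)
  define l where "l = (hold + d) / 2"
  have l: "hold < l" "l < d" using d(1) by (auto simp: l_def)
  have gl: "1 / \<beta> \<le> g l"
  proof -
    have "(\<Sum>n<N. return_coeff n / l ^ Suc n) \<le> g l"
      unfolding g_def by (rule sum_le_suminf[OF resolvent_summable[OF l(1)]]) (use return_coeff(1) l
          hold_pos in auto)
    then show ?thesis using d(2)[OF l] by linarith
  qed
  define u where "u = max l (hold + \<beta>)"
  have u: "hold < u" "l \<le> u" using \<beta> by (auto simp: u_def)
  have gu: "g u \<le> 1 / \<beta>"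
  proof -
    have "g u \<le> (\<Sum>n. 1 / u * (hold / u) ^ n)"
      unfolding g_def
    proof (rule suminf_le[OF _ resolvent_summable[OF u(1)]])
      show "return_coeff n / u ^ Suc n \<le> 1 / u * (hold / u) ^ n" for n
        using u hold_pos return_coeff[of n] by (simp add: power_divide divide_simps)
      show "summable (\<lambda>n. 1 / u * (hold / u) ^ n)"
        using u hold_pos by (intro summable_mult summable_geometric) auto
    qed
    also have "\<dots> = 1 / u * (1 / (1 - hold / u))"
      using u hold_pos by (subst suminf_mult) (auto intro!: summable_geometric simp: suminf_geometric)
    also have "\<dots> = 1 / (u - hold)" using u hold_pos by (simp add: field_simps)
    also have "\<dots> \<le> 1 / \<beta>" using \<beta> by (intro divide_left_mono) (auto simp: u_def)
    finally show ?thesis .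
  qed
  have cont: "continuous_on {l..u} g"
  proof -
    \<comment> \<open>A point below \<open>l\<close> at which the power series in \<open>1 / \<theta>\<close> still converges.\<close>
    define m where "m = (hold + l) / 2"
    have m: "hold < m" "m < l" using l by (auto simp: m_def)
    have sm: "summable (\<lambda>n. return_coeff n * (1 / m) ^ n)"
      using summable_mult[OF resolvent_summable[OF m(1)], of m] m hold_pos by (simp add: power_divide)
    have "isCont (\<lambda>\<theta>. 1 / \<theta> * (\<Sum>n. return_coeff n * (1 / \<theta>) ^ n)) \<theta>" if "\<theta> \<in> {l..u}" for \<theta>
    proof -
      have \<theta>: "0 < m" "m < \<theta>" using that m hold_pos by auto
      then have "\<bar>1 / \<theta>\<bar> < \<bar>1 / m\<bar>" by (simp add: divide_strict_left_mono)
      then have B: "isCont (\<lambda>z. \<Sum>n. return_coeff n * z ^ n) (1 / \<theta>)"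
        by (intro isCont_powser[OF sm]) simp
      have A: "isCont (\<lambda>\<theta>. 1 / \<theta>) \<theta>" using \<theta> by (intro isCont_divide continuous_const
          continuous_ident) auto
      show ?thesis
        by (rule isCont_mult[OF A isCont_o2[where f="\<lambda>\<theta>. 1 / \<theta>" and g="\<lambda>z. \<Sum>n. return_coeff n *
            z ^ n", OF A B]])
    qed
    then have "continuous_on {l..u} (\<lambda>\<theta>. 1 / \<theta> * (\<Sum>n. return_coeff n * (1 / \<theta>) ^ n))"
      by (intro continuous_at_imp_continuous_on ballI)
    moreover have "1 / \<theta> * (\<Sum>n. return_coeff n * (1 / \<theta>) ^ n) = g \<theta>" if "\<theta> \<in> {l..u}" for \<theta>
    proof -
      have "summable (\<lambda>n. return_coeff n * (1 / \<theta>) ^ n)"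
        using summable_mult[OF resolvent_summable[of \<theta>], of \<theta>] that l hold_pos
            by (simp add: power_divide)
      then show ?thesis unfolding g_def by (subst suminf_mult[symmetric]) (auto simp: power_divide)
    qed
    ultimately show ?thesis by (rule continuous_on_eq)
  qed
  obtain \<theta> where "l \<le> \<theta>" "\<theta> \<le> u" "g \<theta> = 1 / \<beta>"
    using IVT2'[OF gu gl u(2) cont] by blast
  then show thesis
    using that[of \<theta>] l \<beta> by (auto simp: g_def)
qed

end

section \<open>The principal eigenvector and the eigenvalue\<close>

lemma summable_on_lower_bound_finite:
  fixes f :: "'s \<Rightarrow> real"
  assumes "f summable_on UNIV" "\<And>x. 0 \<le> f x" "0 < c"
  shows "finite {x. c \<le> f x}"
proof (rule conjunct1[OF finite_if_finite_subsets_card_bdd])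
  fix F assume F: "F \<subseteq> {x. c \<le> f x}" "finite F"
  have "real (card F) * c = (\<Sum>x\<in>F. c)" by simp
  also have "\<dots> \<le> (\<Sum>x\<in>F. f x)" using F by (intro sum_mono) auto
  also have "\<dots> \<le> infsum f UNIV" using assms F by (intro finite_sum_le_infsum) auto
  finally have "real (card F) \<le> infsum f UNIV / c" using assms(3) by (simp add: field_simps)
  then show "card F \<le> nat \<lceil>infsum f UNIV / c\<rceil>" by linarith
qed

lemma le_infsum_single:
  fixes f :: "'s \<Rightarrow> real"
  assumes "f summable_on UNIV" "\<And>x. 0 \<le> f x"
  shows "f x \<le> infsum f UNIV"
  using finite_sum_le_infsum[of f UNIV "{x}"] assms by simp

context branching_walk
begin

text \<open>
  The function \<open>\<psi> = \<Sum> Q\<^sup>n \<delta>\<^sub>0 / \<theta>\<^bsup>n+1\<^esup>\<close> solves \<open>Q \<psi> + \<delta>\<^sub>0 = \<theta> \<psi>\<close>, and the choice of \<open>\<theta>\<close> makes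
  \<open>\<beta>\<^sup>* \<psi>(0) = 1\<close>.
\<close>

lemma principal_eigenvector:
  assumes p: "walk_transition a p" and \<beta>: "0 < beta_star b" "beta_c p < beta_star b"
  obtains \<theta> \<psi> where "hold < \<theta>" "\<And>x. 0 < \<psi> x" "\<psi> summable_on UNIV"
    "\<And>x. mapp B (\<lambda>x. ennreal (\<psi> x)) x = ennreal (\<theta> + split) * ennreal (\<psi> x)"
    "\<And>x. mapp Q (\<lambda>x. ennreal (\<psi> x)) x + (if x = 0 then ennreal (beta_star b) * ennreal (\<psi> 0) else 0)
        = ennreal \<theta> * ennreal (\<psi> x)"
proof -
  obtain \<theta> where \<theta>: "hold < \<theta>" "beta_star b * (\<Sum>n. return_coeff n / \<theta> ^ Suc n) = 1"
    using critical_resolvent[OF p \<beta>] by blast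
  have \<theta>0: "0 < \<theta>" using \<theta>(1) hold_pos by simp
  define \<Psi> where "\<Psi> x = (\<Sum>n. ennreal (1 / \<theta> ^ Suc n) * (mapp Q ^^ n) (delta 0) x)" for x
  have total: "(\<Sum>\<^sub>+ x. \<Psi> x) \<le> ennreal (1 / (\<theta> - hold))"
  proof -
    have "(\<Sum>\<^sub>+ x. \<Psi> x) = (\<Sum>n. ennreal (1 / \<theta> ^ Suc n) * (\<Sum>\<^sub>+ x. (mapp Q ^^ n) (delta 0) x))"
      unfolding \<Psi>_def by (simp add: nn_integral_suminf nn_integral_cmult)
    also have "\<dots> \<le> (\<Sum>n. ennreal (1 / \<theta> ^ Suc n) * ennreal (hold ^ n))"
      by (intro suminf_le mult_left_mono iter_Q_total summableI) auto
    also have "\<dots> = (\<Sum>n. ennreal (1 / \<theta> * (hold / \<theta>) ^ n))"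
      using \<theta>0 hold_pos by (intro suminf_cong) (simp add: ennreal_mult'[symmetric] power_divide)
    also have "\<dots> = ennreal (1 / \<theta> * (1 / (1 - hold / \<theta>)))"
      using \<theta> \<theta>0 hold_pos by (intro suminf_ennreal_eq sums_mult geometric_sums) auto
    also have "1 / \<theta> * (1 / (1 - hold / \<theta>)) = 1 / (\<theta> - hold)"
      using \<theta> \<theta>0 by (simp add: field_simps)
    finally show ?thesis .
  qed
  have fin: "\<Psi> x < \<top>" for x
  proof -
    have "\<Psi> x = (\<Sum>\<^sub>+ y. \<Psi> y * delta x y)" by (simp add: nn_integral_count_space_delta)
    also have "\<dots> \<le> (\<Sum>\<^sub>+ y. \<Psi> y)"
      by (intro nn_integral_mono) (simp add: indicator_def)
    also have "\<dots> < \<top>" by (rule le_less_trans[OF total ennreal_less_top])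
    finally show ?thesis .
  qed
  define \<psi> where "\<psi> x = enn2real (\<Psi> x)" for x
  have \<psi>: "ennreal (\<psi> x) = \<Psi> x" for x unfolding \<psi>_def using fin by simp
  have pos: "0 < \<psi> x" for x
  proof -
    obtain n where n: "0 < (mapp Q ^^ n) (delta 0) x" using irreducible_iter by blast
    have "ennreal (1 / \<theta> ^ Suc n) * (mapp Q ^^ n) (delta 0) x \<le> \<Psi> x"
      unfolding \<Psi>_def using sum_le_suminf[of "\<lambda>n. ennreal (1 / \<theta> ^ Suc n) * (mapp Q ^^ n) (delta 0)
          x" "{n}"] by simp
    moreover have "0 < ennreal (1 / \<theta> ^ Suc n) * (mapp Q ^^ n) (delta 0) x"
      using n \<theta>0 by (simp add: ennreal_zero_less_mult_iff)
    ultimately have "0 < \<Psi> x" by (rule less_le_trans[rotated])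
    then show ?thesis unfolding \<psi>[symmetric] by simp
  qed
  have summ: "\<psi> summable_on UNIV"
  proof -
    have "(\<Sum>\<^sub>+ x. ennreal (\<psi> x)) = ennreal (enn2real (\<Sum>\<^sub>+ x. \<Psi> x))"
      unfolding \<psi> using le_less_trans[OF total ennreal_less_top] by simp
    then have "(\<psi> has_sum enn2real (\<Sum>\<^sub>+ x. \<Psi> x)) UNIV"
      by (rule has_sum_nn_integral) (use less_imp_le[OF pos] in auto)
    then show ?thesis by (rule has_sum_imp_summable)
  qed
  have \<psi>0: "ennreal (beta_star b) * ennreal (\<psi> 0) = 1"
  proof -
    have "\<Psi> 0 = (\<Sum>n. ennreal (return_coeff n / \<theta> ^ Suc n))"
      unfolding \<Psi>_def ennreal_return_coeff[symmetric] using \<theta>0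
      by (intro suminf_cong) (simp add: ennreal_mult'[symmetric] return_coeff)
    also have "\<dots> = ennreal (\<Sum>n. return_coeff n / \<theta> ^ Suc n)"
      using \<theta>0 return_coeff by (intro suminf_ennreal_eq summable_sums resolvent_summable \<theta>) auto
    finally have "ennreal (beta_star b) * ennreal (\<psi> 0) = ennreal (beta_star b * (\<Sum>n. return_coeff n
        / \<theta> ^ Suc n))"
      unfolding \<psi> using \<beta>(1) by (simp add: ennreal_mult')
    then show ?thesis using \<theta>(2) by simp
  qed
  have resolvent: "mapp Q \<Psi> x + delta 0 x = ennreal \<theta> * \<Psi> x" for x
  proof -
    let ?t = "\<lambda>n. ennreal (1 / \<theta> ^ n) * (mapp Q ^^ n) (delta 0) x"
    have "mapp Q \<Psi> x = (\<Sum>n. mapp Q (\<lambda>x. ennreal (1 / \<theta> ^ Suc n) * (mapp Q ^^ n) (delta 0) x) x)"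
      unfolding \<Psi>_def[abs_def] by (rule mapp_suminf)
    also have "\<dots> = (\<Sum>n. ?t (Suc n))" by (simp only: mapp_cmult funpow.simps comp_def)
    finally have "mapp Q \<Psi> x + delta 0 x = (\<Sum>n. ?t (Suc n)) + ?t 0" by simp
    also have "\<dots> = (\<Sum>n. ?t n)"
      using suminf_offset[of ?t 1] by (simp add: add.commute)
    also have "\<dots> = ennreal \<theta> * \<Psi> x"
      unfolding \<Psi>_def ennreal_suminf_cmult[symmetric]
    proof (rule suminf_cong)
      fix n
      have "ennreal \<theta> * ennreal (1 / \<theta> ^ Suc n) = ennreal (\<theta> * (1 / \<theta> ^ Suc n))"
        using \<theta>0 by (intro ennreal_mult'[symmetric]) simp
      also have "\<theta> * (1 / \<theta> ^ Suc n) = 1 / \<theta> ^ n" using \<theta>0 by simp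
      finally show "?t n = ennreal \<theta> * (ennreal (1 / \<theta> ^ Suc n) * (mapp Q ^^ n) (delta 0) x)"
        by (simp only: mult.assoc[symmetric])
    qed
    finally show ?thesis .
  qed
  have eigQ: "mapp Q (\<lambda>x. ennreal (\<psi> x)) x + (if x = 0 then ennreal (beta_star b) * ennreal (\<psi> 0)
      else 0) = ennreal \<theta> * ennreal (\<psi> x)" for x
    using resolvent[of x] unfolding \<psi>0 unfolding \<psi> by (auto simp: indicator_def split: if_splits)
  have eigB: "mapp B (\<lambda>x. ennreal (\<psi> x)) x = ennreal (\<theta> + split) * ennreal (\<psi> x)" for x
  proof -
    have "mapp B (\<lambda>x. ennreal (\<psi> x)) x = ennreal \<theta> * ennreal (\<psi> x) + ennreal split * ennreal (\<psi> x)"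
      unfolding mapp_B eigQ[symmetric] by (simp only: add_ac)
    then show ?thesis using ennreal_plus[OF less_imp_le[OF \<theta>0] split_nonneg]
        by (simp only: distrib_right)
  qed
  show thesis by (rule that[OF \<theta>(1) pos summ eigB eigQ])
qed

text \<open>
  A square summable function with a negative value attains its minimum, where the walk operator is
  nonnegative; as \<open>\<phi> 0 \<ge> 0\<close>, this contradicts the eigenvalue equation, so \<open>\<phi> \<ge> 0\<close>. Pairing \<open>\<phi>\<close> with the positive
  eigenvector \<open>\<psi>\<close> and moving the symmetric matrix to the other side identifies the eigenvalues.
\<close>

lemma nonneg_eigenvalue_unique:
  assumes \<psi>: "\<And>x. 0 < \<psi> x" "\<psi> summable_on UNIV"
    and eig: "\<And>x. mapp Q (\<lambda>x. ennreal (\<psi> x)) x + (if x = 0 then ennreal (beta_star b) *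
        ennreal (\<psi> 0) else 0) = ennreal \<theta> * ennreal (\<psi> x)"
    and \<theta>: "0 < \<theta>"
    and \<phi>: "\<phi> x0 \<noteq> 0" "(\<lambda>x. (\<phi> x)\<^sup>2) summable_on UNIV"
    and l: "0 < l"
    and eig': "\<And>x. walk_operator a \<phi> x + beta_star b * Delta0 \<phi> x = l * \<phi> x"
    and \<phi>0: "0 \<le> \<phi> 0"
  shows "l = \<theta> - hold"
proof -
  define K where "K = sqrt (infsum (\<lambda>x. (\<phi> x)\<^sup>2) UNIV)"
  have K: "\<bar>\<phi> x\<bar> \<le> K" for x
    unfolding K_def using le_infsum_single[OF \<phi>(2), of x] by (intro real_le_rsqrt) simp
  have a0: "(a x has_sum 0) UNIV" for x using intensity unfolding walk_intensity_def by blast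
  have asum: "(\<lambda>y. a x y * \<phi> y) summable_on UNIV" for x
  proof -
    have "(\<lambda>y. norm (a x y)) summable_on UNIV"
      using has_sum_imp_summable[OF a0[of x]] by (rule iffD1[OF summable_on_iff_abs_summable_on_real])
    then have "(\<lambda>y. norm (a x y) * K) summable_on UNIV" by (rule summable_on_cmult_left)
    then have "(\<lambda>y. norm (a x y * \<phi> y)) summable_on UNIV"
      by (rule summable_on_comparison_test) (use K in \<open>auto simp: abs_mult intro!: mult_left_mono\<close>)
    then show ?thesis by (rule abs_summable_summable)
  qed
  have hs: "((\<lambda>y. a x y * \<phi> y) has_sum walk_operator a \<phi> x) UNIV" for x
    unfolding walk_operator_def using asum by simp
  have \<phi>nn: "0 \<le> \<phi> x" for x
  proof (rule ccontr)
    assume "\<not> 0 \<le> \<phi> x"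
    then have neg: "\<phi> x < 0" by simp
    \<comment> \<open>The level set is finite, hence contains a global minimum point of \<open>\<phi>\<close>.\<close>
    define S where "S = {y. \<phi> y \<le> \<phi> x}"
    have "S \<subseteq> {y. (\<phi> x)\<^sup>2 \<le> (\<phi> y)\<^sup>2}"
      using neg by (auto simp: S_def abs_le_square_iff[symmetric])
    moreover have "finite {y. (\<phi> x)\<^sup>2 \<le> (\<phi> y)\<^sup>2}"
      by (rule summable_on_lower_bound_finite[OF \<phi>(2)]) (use neg in auto)
    ultimately have "finite S" by (rule finite_subset)
    moreover have "S \<noteq> {}" by (auto simp: S_def)
    ultimately have "Min (\<phi> ` S) \<in> \<phi> ` S" by (intro Min_in) auto
    then obtain z where z: "z \<in> S" "\<phi> z = Min (\<phi> ` S)" by (metis imageE)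
    then have "\<phi> z \<le> \<phi> y" if "y \<in> S" for y
      using that \<open>finite S\<close> by simp
    note z = z(1) this
    have zmin: "\<phi> z \<le> \<phi> y" for y
    proof (cases "y \<in> S")
      case False
      then have "\<phi> x < \<phi> y" by (simp add: S_def)
      moreover have "\<phi> z \<le> \<phi> x" using z(1) by (simp add: S_def)
      ultimately show ?thesis by linarith
    qed (rule z(2))
    have "((\<lambda>y. a z y * \<phi> y + a z y * (- \<phi> z)) has_sum (walk_operator a \<phi> z + 0 * (- \<phi> z))) UNIV"
      by (intro has_sum_add hs has_sum_cmult_left a0)
    moreover have "0 \<le> a z y * \<phi> y + a z y * (- \<phi> z)" for y
    proof (cases "z = y")
      case False
      then have "a z y * \<phi> z \<le> a z y * \<phi> y" using zmin a_nonneg by (intro mult_left_mono) auto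
      then show ?thesis by simp
    qed simp
    ultimately have "0 \<le> walk_operator a \<phi> z + 0 * (- \<phi> z)" by (rule has_sum_nonneg)
    moreover have "0 \<le> beta_star b * Delta0 \<phi> z"
      using \<phi>0 beta_star_nonneg by (simp add: Delta0_def)
    ultimately have "0 \<le> l * \<phi> z" using eig'[of z] by simp
    moreover have "\<phi> z < 0" using z(1) neg by (simp add: S_def)
    ultimately show False using l by (simp add: zero_le_mult_iff)
  qed
  have eigphi: "mapp Q (\<lambda>x. ennreal (\<phi> x)) x + (if x = 0 then ennreal (beta_star b) * ennreal (\<phi> 0)
      else 0) = ennreal (l + hold) * ennreal (\<phi> x)" for x
  proof -
    have "((\<lambda>y. a x y * \<phi> y + (if y = x then hold * \<phi> x else 0)) has_sum (walk_operator a \<phi> x +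
        hold * \<phi> x)) UNIV"
    proof (rule has_sum_add[OF hs])
      show "((\<lambda>y. if y = x then hold * \<phi> x else 0) has_sum hold * \<phi> x) UNIV"
        by (rule iffD1[OF has_sum_cong_neutral has_sum_finiteI[of "{x}" "hold * \<phi> x"
            "\<lambda>_. hold * \<phi> x"]]) auto
    qed
    moreover have "(\<lambda>y. a x y * \<phi> y + (if y = x then hold * \<phi> x else 0)) =
        (\<lambda>y. (if x = y then 0 else a x y) * \<phi> y)"
      by (auto simp: fun_eq_iff a_diag)
    ultimately have h: "((\<lambda>y. (if x = y then 0 else a x y) * \<phi> y) has_sum (walk_operator a \<phi> x +
        hold * \<phi> x)) UNIV" by (simp only:)
    have nn: "0 \<le> (if x = y then 0 else a x y) * \<phi> y" for y using a_nonneg \<phi>nn by auto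
    have "(\<Sum>\<^sub>+ y. ennreal ((if x = y then 0 else a x y) * \<phi> y)) = ennreal (walk_operator a \<phi> x +
        hold * \<phi> x)"
      by (rule nn_integral_count_space_has_sum[OF h nn])
    then have "mapp Q (\<lambda>x. ennreal (\<phi> x)) x = ennreal (walk_operator a \<phi> x + hold * \<phi> x)"
      unfolding mapp_def Q_def using a_nonneg \<phi>nn by (simp add: ennreal_mult'' )
    moreover have "(if x = 0 then ennreal (beta_star b) * ennreal (\<phi> 0) else 0) =
        ennreal (beta_star b * Delta0 \<phi> x)"
      by (auto simp: Delta0_def ennreal_mult' beta_star_nonneg)
    ultimately have "mapp Q (\<lambda>x. ennreal (\<phi> x)) x + (if x = 0 then ennreal (beta_star b) *
        ennreal (\<phi> 0) else 0) =
        ennreal (walk_operator a \<phi> x + hold * \<phi> x + beta_star b * Delta0 \<phi> x)"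
      using has_sum_nonneg[OF h nn] \<phi>nn beta_star_nonneg by (subst ennreal_plus) (auto simp: Delta0_def)
    also have "walk_operator a \<phi> x + hold * \<phi> x + beta_star b * Delta0 \<phi> x = (l + hold) * \<phi> x"
      using eig'[of x] by (simp add: algebra_simps)
    also have "ennreal ((l + hold) * \<phi> x) = ennreal (l + hold) * ennreal (\<phi> x)"
      by (rule ennreal_mult''[OF \<phi>nn])
    finally show ?thesis .
  qed
  have swap: "mapp B u x = c * u x + ennreal split * u x"
    if "\<And>x. mapp Q u x + (if x = 0 then ennreal (beta_star b) * u 0 else 0) = c * u x" for u c x
    unfolding mapp_B that[symmetric] by (simp only: add_ac)
  define I where "I = (\<Sum>\<^sub>+ x. ennreal (\<psi> x) * ennreal (\<phi> x))"
  have "(\<Sum>\<^sub>+ x. ennreal (\<psi> x) * mapp B (\<lambda>x. ennreal (\<phi> x)) x) =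
      (\<Sum>\<^sub>+ x. mapp B (\<lambda>x. ennreal (\<psi> x)) x * ennreal (\<phi> x))"
    by (rule mapp_symmetric) (rule B_sym)
  also have "(\<Sum>\<^sub>+ x. ennreal (\<psi> x) * mapp B (\<lambda>x. ennreal (\<phi> x)) x) =
      (\<Sum>\<^sub>+ x. (ennreal (l + hold) + ennreal split) * (ennreal (\<psi> x) * ennreal (\<phi> x)))"
    unfolding swap[of "\<lambda>x. ennreal (\<phi> x)", OF eigphi] by (simp only: distrib_left distrib_right mult_ac)
  also have "\<dots> = (ennreal (l + hold) + ennreal split) * I"
    unfolding I_def by (rule nn_integral_cmult) simp
  also have "(\<Sum>\<^sub>+ x. mapp B (\<lambda>x. ennreal (\<psi> x)) x * ennreal (\<phi> x)) =
      (\<Sum>\<^sub>+ x. (ennreal \<theta> + ennreal split) * (ennreal (\<psi> x) * ennreal (\<phi> x)))"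
    unfolding swap[of "\<lambda>x. ennreal (\<psi> x)", OF eig] by (simp only: distrib_left distrib_right mult_ac)
  also have "\<dots> = (ennreal \<theta> + ennreal split) * I"
    unfolding I_def by (rule nn_integral_cmult) simp
  finally have "(ennreal (l + hold) + ennreal split) * I = (ennreal \<theta> + ennreal split) * I" .
  moreover have "I \<noteq> \<top>"
  proof -
    have "I \<le> (\<Sum>\<^sub>+ x. ennreal K * ennreal (\<psi> x))"
      unfolding I_def by (intro nn_integral_mono) (use K in \<open>simp add: mult.commute mult_right_mono
          ennreal_leI abs_le_iff\<close>)
    also have "\<dots> = ennreal K * ennreal (infsum \<psi> UNIV)"
      using nn_integral_count_space_has_sum[of \<psi> "infsum \<psi> UNIV"] \<psi>
          by (simp add: nn_integral_cmult less_imp_le)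
    also have "\<dots> < \<top>" by (simp add: ennreal_mult_less_top)
    finally show ?thesis by simp
  qed
  moreover have "I \<noteq> 0"
  proof
    assume "I = 0"
    then have "ennreal (\<psi> x0) * ennreal (\<phi> x0) = 0"
      unfolding I_def by (subst (asm) nn_integral_0_iff_AE) (auto simp: AE_count_space)
    then show False using \<psi>(1)[of x0] \<phi>(1) \<phi>nn[of x0] by (simp add: ennreal_eq_0_iff)
  qed
  ultimately have "ennreal (l + hold) + ennreal split = ennreal \<theta> + ennreal split"
    by (simp only: mult.commute[of _ I] ennreal_mult_cancel_left simp_thms)
  then show ?thesis
    using l hold_pos \<theta> split_nonneg by (simp flip: ennreal_plus)
qed

end

lemma summable_imp_square_summable:
  fixes f :: "'s \<Rightarrow> real"
  assumes "\<psi> summable_on UNIV" "\<And>x. 0 < \<psi> x"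
  shows "(\<lambda>x. (\<psi> x :: real)\<^sup>2) summable_on UNIV"
proof -
  have "(\<lambda>x. \<psi> x * infsum \<psi> UNIV) summable_on UNIV"
    by (rule summable_on_cmult_left[OF assms(1)])
  then show ?thesis
  proof (rule summable_on_comparison_test)
    fix x
    have "\<psi> x \<le> infsum \<psi> UNIV"
      by (rule le_infsum_single[OF assms(1)]) (rule less_imp_le[OF assms(2)])
    then show "(\<psi> x)\<^sup>2 \<le> \<psi> x * infsum \<psi> UNIV"
      unfolding power2_eq_square by (rule mult_left_mono) (rule less_imp_le[OF assms(2)])
  qed simp
qed

context branching_walk
begin

text \<open>
  An eigenvector that is negative at the origin is replaced by its negative.
\<close>

lemma lambda_0_principal:
  assumes \<psi>: "\<And>x. 0 < \<psi> x" "\<psi> summable_on UNIV"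
    and eig: "\<And>x. mapp Q (\<lambda>x. ennreal (\<psi> x)) x + (if x = 0 then ennreal (beta_star b) *
        ennreal (\<psi> 0) else 0) = ennreal \<theta> * ennreal (\<psi> x)"
    and \<theta>: "hold < \<theta>"
  shows "lambda_0 a b = \<theta> - hold"
proof -
  have \<theta>0: "0 < \<theta>" using \<theta> hold_pos by simp
  have "walk_operator a \<psi> x + beta_star b * Delta0 \<psi> x = (\<theta> - hold) * \<psi> x" for x
  proof -
    define S where "S = enn2real (mapp Q (\<lambda>x. ennreal (\<psi> x)) x)"
    have eig2: "mapp Q (\<lambda>x. ennreal (\<psi> x)) x + ennreal (beta_star b * Delta0 \<psi> x) = ennreal (\<theta> * \<psi> x)"
      using eig[of x] \<theta>0 \<psi>(1) beta_star_nonneg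
      by (cases "x = 0") (simp_all add: Delta0_def ennreal_mult' less_imp_le)
    have "mapp Q (\<lambda>x. ennreal (\<psi> x)) x \<le> ennreal (\<theta> * \<psi> x)"
      unfolding eig2[symmetric] by simp
    then have S: "mapp Q (\<lambda>x. ennreal (\<psi> x)) x = ennreal S" "0 \<le> S"
      unfolding S_def using le_less_trans[OF _ ennreal_less_top] by (auto simp: less_top)
    have D: "0 \<le> beta_star b * Delta0 \<psi> x"
      using beta_star_nonneg \<psi>(1)[of 0] by (simp add: Delta0_def)
    have "ennreal (S + beta_star b * Delta0 \<psi> x) = ennreal (\<theta> * \<psi> x)"
      using eig2 unfolding S(1) ennreal_plus[OF S(2) D] .
    then have S_eq: "S + beta_star b * Delta0 \<psi> x = \<theta> * \<psi> x"
      by (subst (asm) ennreal_inj) (use S(2) D \<theta>0 less_imp_le[OF \<psi>(1)] in auto)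
    have "(\<Sum>\<^sub>+ y. ennreal ((if x = y then 0 else a x y) * \<psi> y)) = ennreal S"
      unfolding S(1)[symmetric] mapp_def Q_def using a_nonneg less_imp_le[OF \<psi>(1)]
          by (simp add: ennreal_mult'')
    then have "((\<lambda>y. (if x = y then 0 else a x y) * \<psi> y) has_sum S) UNIV"
      by (rule has_sum_nn_integral) (use a_nonneg less_imp_le[OF \<psi>(1)] S(2) in auto)
    moreover have "((\<lambda>y. if y = x then - hold * \<psi> x else 0) has_sum - hold * \<psi> x) UNIV"
      by (rule iffD1[OF has_sum_cong_neutral has_sum_finiteI[of "{x}" "- hold * \<psi> x"
          "\<lambda>_. - hold * \<psi> x"]]) auto
    ultimately have "((\<lambda>y. (if x = y then 0 else a x y) * \<psi> y + (if y = x then - hold * \<psi> x else 0))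
        has_sum (S + - hold * \<psi> x)) UNIV"
      by (rule has_sum_add)
    moreover have "(\<lambda>y. (if x = y then 0 else a x y) * \<psi> y + (if y = x then - hold * \<psi> x else 0)) =
        (\<lambda>y. a x y * \<psi> y)"
      by (auto simp: fun_eq_iff a_diag)
    ultimately have "walk_operator a \<psi> x = S + - hold * \<psi> x"
      unfolding walk_operator_def by (simp only: infsumI)
    then show ?thesis using S_eq by (simp add: algebra_simps)
  qed
  then have ex: "l2_eigenvalue (\<lambda>\<phi> x. walk_operator a \<phi> x + beta_star b * Delta0 \<phi> x) (\<theta> - hold)"
    unfolding l2_eigenvalue_def
    using less_imp_neq[OF \<psi>(1)[of 0]] summable_imp_square_summable[OF \<psi>(2,1)]
        by (intro exI[of _ \<psi>]) metis
  show ?thesis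
    unfolding lambda_0_def
  proof (rule the_equality)
    show "0 < \<theta> - hold \<and> l2_eigenvalue (\<lambda>\<phi> x. walk_operator a \<phi> x + beta_star b * Delta0 \<phi> x)
        (\<theta> - hold)"
      using ex \<theta> by simp
  next
    fix l assume l: "0 < l \<and> l2_eigenvalue (\<lambda>\<phi> x. walk_operator a \<phi> x + beta_star b * Delta0 \<phi> x) l"
    then obtain \<phi> x0 where \<phi>: "\<phi> x0 \<noteq> 0" "(\<lambda>x. (\<phi> x)\<^sup>2) summable_on UNIV"
      "\<And>x. walk_operator a \<phi> x + beta_star b * Delta0 \<phi> x = l * \<phi> x"
      unfolding l2_eigenvalue_def by blast
    show "l = \<theta> - hold"
    proof (cases "0 \<le> \<phi> 0")
      case True
      show ?thesis
        by (rule nonneg_eigenvalue_unique[OF \<psi> eig \<theta>0 \<phi>(1,2) conjunct1[OF l] \<phi>(3) True])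
    next
      case False
      have "walk_operator a (\<lambda>x. - \<phi> x) x + beta_star b * Delta0 (\<lambda>x. - \<phi> x) x = l * - \<phi> x" for x
        using \<phi>(3)[of x] by (simp add: walk_operator_def infsum_uminus Delta0_def split: if_splits)
      then show ?thesis
        by (intro nonneg_eigenvalue_unique[OF \<psi> eig \<theta>0, of "\<lambda>x. - \<phi> x" x0 l]) (use False \<phi> l in auto)
    qed
  qed
qed

end

section \<open>The normalised mean semigroup\<close>

context branching_walk
begin

lemma iter_Q_le_B: "(mapp Q ^^ n) u x \<le> (mapp B ^^ n) u x"
proof (induction n arbitrary: x)
  case (Suc n)
  have "mapp Q ((mapp Q ^^ n) u) x \<le> mapp Q ((mapp B ^^ n) u) x"
    by (rule mapp_mono) (rule Suc)
  also have "\<dots> \<le> mapp B ((mapp B ^^ n) u) x"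
    unfolding mapp_B by (simp add: add_increasing2 add.assoc)
  finally show ?case by simp
qed simp

lemma mexp_B_pos: "0 < mexp B 1 (delta y) x"
proof -
  obtain n where n: "0 < (mapp Q ^^ n) (delta y) x" using irreducible_iter by blast
  have "0 < ennreal (1 ^ n / fact n) * (mapp B ^^ n) (delta y) x"
    using less_le_trans[OF n iter_Q_le_B] by (simp add: ennreal_zero_less_mult_iff)
  also have "\<dots> \<le> mexp B 1 (delta y) x"
    unfolding mexp_def using sum_le_suminf[of "\<lambda>n. ennreal (1 ^ n / fact n) * (mapp B ^^ n)
        (delta y) x" "{n}"] by simp
  finally show ?thesis .
qed

end

text \<open>
  Here \<open>\<theta> - hold\<close> is \<open>\<lambda>\<^sub>0\<close>, and \<open>\<theta> + split\<close> is the corresponding eigenvalue of the shifted matrix \<open>B\<close>.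
\<close>

locale branching_walk_eigen = branching_walk a b P for a :: "int ^ 'd::finite \<Rightarrow> int ^ 'd \<Rightarrow> real" and
    b P +
  fixes \<theta> :: real and \<psi> :: "int ^ 'd \<Rightarrow> real"
  assumes hold_less: "hold < \<theta>" and psi_pos: "0 < \<psi> x" and psi_summable: "\<psi> summable_on UNIV"
    and eigen: "mapp B (\<lambda>x. ennreal (\<psi> x)) x = ennreal (\<theta> + split) * ennreal (\<psi> x)"
begin

lemma theta_pos: "0 < \<theta> + split"
  using hold_less hold_pos split_nonneg by simp

text \<open>
  The mean semigroup normalised so that it fixes \<open>\<psi>\<close>; this is \<open>e\<^bsup>-\<lambda>\<^sub>0t\<^esup> e\<^bsup>tH\<^esup>\<close> with
  \<open>H = A + \<beta>\<^sup>* \<Delta>\<^sub>0\<close>, as the shift cancels.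
\<close>

definition kern :: "real \<Rightarrow> int ^ 'd \<Rightarrow> int ^ 'd \<Rightarrow> ennreal" where
  "kern t x y = ennreal (exp (- (\<theta> + split) * t)) * mexp B t (delta y) x"

lemma kern_apply:
  "ennreal (exp (- (\<theta> + split) * t)) * mexp B t u x = (\<Sum>\<^sub>+ y. kern t x y * u y)"
  unfolding kern_def by (subst mexp_kernel) (simp add: nn_integral_cmult mult.assoc)

lemma kern_inv:
  assumes "0 \<le> t"
  shows "(\<Sum>\<^sub>+ y. kern t x y * ennreal (\<psi> y)) = ennreal (\<psi> x)"
proof -
  have "(\<Sum>\<^sub>+ y. kern t x y * ennreal (\<psi> y)) =
      ennreal (exp (- (\<theta> + split) * t)) * (ennreal (exp ((\<theta> + split) * t)) * ennreal (\<psi> x))"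
    unfolding kern_apply[symmetric]
    by (simp only: mexp_eigenvector[of B "\<lambda>x. ennreal (\<psi> x)", OF eigen less_imp_le[OF theta_pos] assms])
  also have "\<dots> = ennreal (exp (- (\<theta> + split) * t) * exp ((\<theta> + split) * t)) * ennreal (\<psi> x)"
    by (simp only: ennreal_mult' exp_ge_zero mult.assoc)
  also have "exp (- (\<theta> + split) * t) * exp ((\<theta> + split) * t) = 1"
      by (simp add: algebra_simps flip: exp_add)
  finally show ?thesis by simp
qed

text \<open>
  A single term of the sum \<open>\<Sum>\<^sub>z kern t x z \<psi> z = \<psi> x\<close>.
\<close>

lemma kern_le:
  assumes "0 \<le> t"
  shows "kern t x y \<le> ennreal (\<psi> x / \<psi> y)"
proof -
  have "kern t x y * ennreal (\<psi> y) = (\<Sum>\<^sub>+ z. kern t x z * ennreal (\<psi> z) * delta y z)"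
    by (subst nn_integral_count_space_single[where x=y]) auto
  also have "\<dots> \<le> (\<Sum>\<^sub>+ z. kern t x z * ennreal (\<psi> z))"
    by (intro nn_integral_mono) (simp add: indicator_def)
  finally have "kern t x y * ennreal (\<psi> y) \<le> ennreal (\<psi> x)" unfolding kern_inv[OF assms] .
  then have "kern t x y * ennreal (\<psi> y) * ennreal (1 / \<psi> y) \<le> ennreal (\<psi> x) * ennreal (1 / \<psi> y)"
    by (rule mult_right_mono) simp
  moreover have "ennreal (\<psi> y) * ennreal (1 / \<psi> y) = 1"
    using psi_pos[of y] by (simp add: ennreal_mult'[symmetric])
  moreover have "ennreal (\<psi> x) * ennreal (1 / \<psi> y) = ennreal (\<psi> x / \<psi> y)"
    using psi_pos[of x] psi_pos[of y] by (simp add: ennreal_mult'[symmetric])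
  ultimately show ?thesis by (simp add: mult.assoc)
qed

lemma kern_sym: "kern t x y = kern t y x"
  unfolding kern_def by (subst mexp_delta_symmetric[OF B_sym]) (rule refl)

lemma kern_semigroup:
  assumes "0 \<le> s" "0 \<le> t"
  shows "(\<Sum>\<^sub>+ z. kern s x z * kern t z y) = kern (s + t) x y"
proof -
  have "(\<Sum>\<^sub>+ z. kern s x z * kern t z y) = ennreal (exp (- (\<theta> + split) * s)) *
      (ennreal (exp (- (\<theta> + split) * t)) * mexp B s (mexp B t (delta y)) x)"
    unfolding kern_apply[symmetric] kern_def[of t] mexp_cmult ..
  also have "\<dots> = ennreal (exp (- (\<theta> + split) * s) * exp (- (\<theta> + split) * t)) * mexp B (s +
      t) (delta y) x"
    by (simp only: mexp_add[OF assms] ennreal_mult' exp_ge_zero mult.assoc)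
  also have "exp (- (\<theta> + split) * s) * exp (- (\<theta> + split) * t) = exp (- (\<theta> + split) * (s + t))"
    by (simp add: exp_add[symmetric] algebra_simps)
  finally show ?thesis unfolding kern_def .
qed

lemma ennreal_kern: "0 \<le> t \<Longrightarrow> ennreal (enn2real (kern t x y)) = kern t x y"
  by (intro ennreal_enn2real) (rule le_less_trans[OF kern_le ennreal_less_top])

lemma kern_converges: "\<exists>L>0. ((\<lambda>t. enn2real (kern t x y)) \<longlongrightarrow> L) at_top"
proof (rule symmetric_semigroup_converges[where \<psi>=\<psi>])
  show "enn2real (kern t x y) = enn2real (kern t y x)" for t x y
    by (subst kern_sym) (rule refl)
  show "((\<lambda>z. enn2real (kern s x z) * enn2real (kern t z y)) has_sum enn2real (kern (s + t) x y)) UNIV"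
    if "0 \<le> s" "0 \<le> t" for s t x y
    by (rule has_sum_nn_integral)
       (use that kern_semigroup[OF that] in \<open>auto simp: ennreal_mult' ennreal_kern\<close>)
  show "((\<lambda>z. enn2real (kern t x z) * \<psi> z) has_sum \<psi> x) UNIV" if "0 \<le> t" for t x
    by (rule has_sum_nn_integral)
       (use that kern_inv[OF that] less_imp_le[OF psi_pos] in \<open>auto simp: ennreal_mult' ennreal_kern\<close>)
  show "(\<lambda>x. (\<psi> x)\<^sup>2) summable_on UNIV"
    by (rule summable_imp_square_summable[OF psi_summable psi_pos])
  show "\<exists>t\<ge>0. 0 < enn2real (kern t x y)" for x y
  proof (intro exI[of _ 1] conjI)
    have "0 < kern 1 x y" using mexp_B_pos unfolding kern_def by (simp add: ennreal_zero_less_mult_iff)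
    then show "0 < enn2real (kern 1 x y)" by (subst (asm) ennreal_kern[symmetric]) auto
  qed simp
qed (auto intro: psi_pos)

end

section \<open>Convolutions with the semigroup and its total mass\<close>

text \<open>
  Dominated convergence with the bound \<open>M w\<close>.
\<close>

lemma convolution_limit:
  fixes k :: "real \<Rightarrow> real" and w :: "real \<Rightarrow> ennreal"
  assumes [measurable]: "k \<in> borel_measurable borel" "w \<in> borel_measurable borel"
    and k: "\<And>t. 0 \<le> t \<Longrightarrow> k t \<le> M" "(k \<longlongrightarrow> L) at_top"
    and w: "\<And>r. 0 \<le> r \<Longrightarrow> w r < \<top>" "(\<integral>\<^sup>+ r\<in>{0..}. w r \<partial>lborel) < \<top>"
  shows "((\<lambda>t. \<integral>\<^sup>+ r\<in>{0..t}. ennreal (k (t - r)) * w r \<partial>lborel) \<longlongrightarrow>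
    ennreal L * (\<integral>\<^sup>+ r\<in>{0..}. w r \<partial>lborel)) at_top"
proof (rule tendsto_at_topI_sequentially)
  fix X :: "nat \<Rightarrow> real" assume X: "filterlim X at_top sequentially"
  have "(\<lambda>n. \<integral>\<^sup>+ r\<in>{0..X n}. ennreal (k (X n - r)) * w r \<partial>lborel) \<longlonglongrightarrow>
      (\<integral>\<^sup>+ r. ennreal L * (w r * indicator {0..} r) \<partial>lborel)"
  proof (rule nn_integral_dominated_convergence[where w="\<lambda>r. ennreal M * (w r * indicator {0..} r)"])
    show "AE r in lborel. ennreal (k (X n - r)) * w r * indicator {0..X n} r \<le>
        ennreal M * (w r * indicator {0..} r)" for n
    proof (rule AE_I2)
      fix r
      show "ennreal (k (X n - r)) * w r * indicator {0..X n} r \<le> ennreal M * (w r * indicator {0..} r)"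
      proof (cases "r \<in> {0..X n}")
        case True
        then show ?thesis using k(1)[of "X n - r"] by (auto intro!: mult_right_mono ennreal_leI)
      qed simp
    qed
    show "(\<integral>\<^sup>+ r. ennreal M * (w r * indicator {0..} r) \<partial>lborel) < \<infinity>"
      using w(2) by (simp add: nn_integral_cmult ennreal_mult_less_top)
    show "AE r in lborel. (\<lambda>n. ennreal (k (X n - r)) * w r * indicator {0..X n} r) \<longlonglongrightarrow> ennreal L *
        (w r * indicator {0..} r)"
    proof (rule AE_I2)
      fix r
      show "(\<lambda>n. ennreal (k (X n - r)) * w r * indicator {0..X n} r) \<longlonglongrightarrow> ennreal L *
          (w r * indicator {0..} r)"
      proof (cases "0 \<le> r")
        case True
        have "filterlim (\<lambda>n. - r + X n) at_top sequentially"
          using filterlim_tendsto_add_at_top[OF tendsto_const X] .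
        then have "(\<lambda>n. k (X n - r)) \<longlonglongrightarrow> L"
          using filterlim_compose[OF k(2)] by (simp add: add.commute)
        then have "(\<lambda>n. ennreal (k (X n - r)) * w r) \<longlonglongrightarrow> ennreal L * w r"
          using w(1)[OF True] by (intro tendsto_mult_ennreal tendsto_ennrealI tendsto_const) auto
        moreover have "\<forall>\<^sub>F n in sequentially. ennreal (k (X n - r)) * w r = ennreal (k (X n - r)) *
            w r * indicator {0..X n} r"
          using X[unfolded filterlim_at_top, rule_format, of r] by eventually_elim (use True in simp)
        ultimately show ?thesis using True by (auto intro: Lim_transform_eventually)
      qed simp
    qed
  qed measurable
  then show "(\<lambda>n. \<integral>\<^sup>+ r\<in>{0..X n}. ennreal (k (X n - r)) * w r \<partial>lborel) \<longlonglongrightarrow>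
      ennreal L * (\<integral>\<^sup>+ r\<in>{0..}. w r \<partial>lborel)"
    by (simp add: nn_integral_cmult)
qed

lemma nn_integral_convolution_commute:
  fixes f g :: "real \<Rightarrow> ennreal"
  assumes [measurable]: "f \<in> borel_measurable borel" "g \<in> borel_measurable borel"
  shows "(\<integral>\<^sup>+ r\<in>{0..t}. f (t - r) * g r \<partial>lborel) = (\<integral>\<^sup>+ r\<in>{0..t}. g (t - r) * f r \<partial>lborel)"
proof -
  have "(\<integral>\<^sup>+ r\<in>{0..t}. f (t - r) * g r \<partial>lborel) =
      (\<integral>\<^sup>+ r. f (t - (t + (- 1) * r)) * g (t + (- 1) * r) * indicator {0..t} (t + (- 1) * r) \<partial>lborel)"
    by (subst nn_integral_real_affine[where c="-1" and t=t]) auto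
  also have "\<dots> = (\<integral>\<^sup>+ r\<in>{0..t}. g (t - r) * f r \<partial>lborel)"
    by (intro nn_integral_cong) (auto simp: indicator_def mult.commute)
  finally show ?thesis .
qed

lemma iter_add: "(mapp B ^^ n) (\<lambda>x. u x + v x) x = (mapp B ^^ n) u x + (mapp B ^^ n) v x"
proof (induction n arbitrary: x)
  case (Suc n)
  then have "(mapp B ^^ n) (\<lambda>x. u x + v x) = (\<lambda>x. (mapp B ^^ n) u x + (mapp B ^^ n) v x)" by blast
  then show ?case by (simp add: mapp_add)
qed simp

text \<open>
  The function \<open>U t = e\<^bsup>tB\<^esup> 1\<close> satisfies \<open>U' = e\<^bsup>tB\<^esup> B 1 = \<sigma> U + e\<^bsup>tB\<^esup> v\<close>. Its integrated form is solved by
  variation of constants with the diagonal matrix \<open>\<sigma>\<close> in the role of \<open>B\<close>.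
\<close>

lemma mexp_affine_row_sums:
  fixes B :: "'s::countable \<Rightarrow> 's \<Rightarrow> ennreal"
  assumes rows: "\<And>x. mapp B (\<lambda>_. 1) x = ennreal \<sigma> + v x" and \<sigma>: "0 \<le> \<sigma>"
    and v: "\<And>x. v x \<le> ennreal V" "0 \<le> V"
    and t: "0 \<le> t"
  shows "mexp B t (\<lambda>_. 1) x = ennreal (exp (\<sigma> * t)) +
    (\<integral>\<^sup>+ r\<in>{0..t}. ennreal (exp (\<sigma> * (t - r))) * mexp B r v x \<partial>lborel)"
proof -
  define U where "U s x = mexp B s (\<lambda>_. 1) x" for s x
  define f where "f s x = mexp B s v x" for s x
  define D where "D x y = ennreal \<sigma> * delta x y" for x y :: 's
  have D: "mapp D u x = ennreal \<sigma> * u x" for u x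
    unfolding mapp_def D_def by (subst nn_integral_count_space_single[where x=x]) auto
  have Um: "(\<lambda>s. U s x) \<in> borel_measurable borel" for x unfolding U_def by measurable
  have fm: "(\<lambda>s. f s x) \<in> borel_measurable borel" for x unfolding f_def by measurable
  have iter_Suc: "(mapp B ^^ Suc n) (\<lambda>_. 1) x = ennreal \<sigma> * (mapp B ^^ n) (\<lambda>_. 1) x +
      (mapp B ^^ n) v x" for n x
  proof -
    have "(mapp B ^^ Suc n) (\<lambda>_. 1) x = (mapp B ^^ n) (mapp B (\<lambda>_. 1)) x"
      by (simp only: funpow_Suc_right comp_def)
    also have "mapp B (\<lambda>_. 1) = (\<lambda>x. ennreal \<sigma> * 1 + v x)" using rows by auto
    finally show ?thesis by (simp only: iter_add iter_cmult)
  qed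
  have Ueq: "U t x = 1 + (\<integral>\<^sup>+ s\<in>{0..t}. (mapp D (U s) x + f s x) \<partial>lborel)" if t: "0 \<le> t" for t x
  proof -
    let ?s = "\<lambda>n. (mapp B ^^ n) (\<lambda>_. 1) x"
    have "mapp D (U s) x + f s x = (\<Sum>n. ennreal (s ^ n / fact n) * ?s (Suc n))" for s
    proof -
      have "mapp D (U s) x + f s x = (\<Sum>n. ennreal \<sigma> * (ennreal (s ^ n / fact n) * ?s n)) +
          (\<Sum>n. ennreal (s ^ n / fact n) * (mapp B ^^ n) v x)"
        unfolding D U_def f_def mexp_def by (simp only: ennreal_suminf_cmult)
      also have "\<dots> = (\<Sum>n. ennreal \<sigma> * (ennreal (s ^ n / fact n) * ?s n) + ennreal (s ^ n / fact n) *
          (mapp B ^^ n) v x)"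
        by (rule suminf_add[OF summableI summableI])
      finally show ?thesis unfolding iter_Suc by (simp only: distrib_left mult_ac)
    qed
    then have "(mapp D (U s) x + f s x) * indicator {0..t} s =
        (\<Sum>n. ennreal (s ^ n / fact n) * indicator {0..t} s * ?s (Suc n))" for s
      by (simp only: ennreal_suminf_multc[symmetric]) (simp only: mult_ac)
    then have "(\<integral>\<^sup>+ s\<in>{0..t}. (mapp D (U s) x + f s x) \<partial>lborel) =
        (\<integral>\<^sup>+ s. (\<Sum>n. ennreal (s ^ n / fact n) * indicator {0..t} s * ?s (Suc n)) \<partial>lborel)"
      by (simp only:)
    also have "\<dots> = (\<Sum>n. \<integral>\<^sup>+ s. ennreal (s ^ n / fact n) * indicator {0..t} s * ?s (Suc n) \<partial>lborel)"
      by (rule nn_integral_suminf) measurable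
    also have "\<dots> = (\<Sum>n. ennreal (t ^ Suc n / fact (Suc n)) * ?s (Suc n))"
    proof (rule suminf_cong)
      fix n
      have "(\<lambda>s. ennreal (s ^ n / fact n) * indicator {0..t} s) \<in> borel_measurable lborel" by measurable
      then show "(\<integral>\<^sup>+ s. ennreal (s ^ n / fact n) * indicator {0..t} s * ?s (Suc n) \<partial>lborel) =
          ennreal (t ^ Suc n / fact (Suc n)) * ?s (Suc n)"
        by (simp only: nn_integral_multc nn_integral_power_Icc[OF t])
    qed
    finally have I: "(\<integral>\<^sup>+ s\<in>{0..t}. (mapp D (U s) x + f s x) \<partial>lborel) =
        (\<Sum>n. ennreal (t ^ Suc n / fact (Suc n)) * ?s (Suc n))" .
    have "U t x = ennreal (t ^ 0 / fact 0) * ?s 0 + (\<Sum>n. ennreal (t ^ Suc n / fact (Suc n)) *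
        ?s (Suc n))"
      unfolding U_def mexp_def using suminf_offset[of "\<lambda>n. ennreal (t ^ n / fact n) * ?s n" 1]
      by (simp add: add.commute del: funpow.simps fact_Suc power_Suc)
    then show ?thesis unfolding I by simp
  qed
  have Ubd: "U s x \<le> ennreal (exp ((\<sigma> + V) * t))" if "0 \<le> s" "s \<le> t" for s x
  proof -
    have row: "mapp B (\<lambda>_. 1) x \<le> ennreal (\<sigma> + V)" for x
      unfolding rows using v \<sigma> by (simp add: ennreal_plus add_left_mono)
    have "U s x \<le> (\<Sum>n. ennreal (((\<sigma> + V) * s) ^ n / fact n))"
      unfolding U_def mexp_def
    proof (rule suminf_le[OF _ summableI summableI])
      fix n
      have "ennreal (s ^ n / fact n) * (mapp B ^^ n) (\<lambda>_. 1) x \<le> ennreal (s ^ n / fact n) *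
          ennreal ((\<sigma> + V) ^ n)"
        by (intro mult_left_mono iter_const_le row) (use \<sigma> v in auto)
      also have "\<dots> = ennreal (s ^ n / fact n * (\<sigma> + V) ^ n)"
        using that by (intro ennreal_mult'[symmetric]) auto
      also have "s ^ n / fact n * (\<sigma> + V) ^ n = ((\<sigma> + V) * s) ^ n / fact n"
        by (simp add: power_mult_distrib mult.commute)
      finally show "ennreal (s ^ n / fact n) * (mapp B ^^ n) (\<lambda>_. 1) x \<le>
          ennreal (((\<sigma> + V) * s) ^ n / fact n)" .
    qed
    also have "\<dots> = ennreal (exp ((\<sigma> + V) * s))"
      using that \<sigma> v by (intro suminf_exp_ennreal) auto
    also have "\<dots> \<le> ennreal (exp ((\<sigma> + V) * t))"
      using that \<sigma> v by (intro ennreal_leI) (simp add: mult_left_mono)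
    finally show ?thesis .
  qed
  have expD: "mexp D s u x = ennreal (exp (\<sigma> * s)) * u x" if "0 \<le> s" for s u x
    by (rule mexp_eigenvector[OF D \<sigma> that])
  define R where "R = mexp D t (\<lambda>_. 1) x + (\<integral>\<^sup>+ r\<in>{0..t}. mexp D (t - r) (f r) x \<partial>lborel)"
  have "U t x \<le> R"
    unfolding R_def
    by (rule duhamel_upper_bound[where f=f and U=U and B=D and T=t and R=\<sigma> and K="exp ((\<sigma> +
        V) * t)", OF Um fm _ Ubd _ _ \<sigma> t order_refl])
       (simp_all only: Ueq D mult_1_right order_refl exp_ge_zero)
  moreover have "R \<le> U t x"
    unfolding R_def
    by (rule duhamel_lower_bound[where f=f and U=U and B=D, OF Um fm _ t]) (simp only: Ueq order_refl)
  ultimately have "U t x = R" by (rule antisym)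
  also have "R = ennreal (exp (\<sigma> * t)) + (\<integral>\<^sup>+ r\<in>{0..t}. ennreal (exp (\<sigma> * (t - r))) * f r x \<partial>lborel)"
    unfolding R_def expD[OF t] mult_1_right
    by (intro arg_cong2[where f="(+)"] refl nn_integral_cong) (auto simp: expD indicator_def)
  finally show ?thesis unfolding U_def f_def .
qed

lemma nn_integral_exp_decay:
  assumes "0 < l"
  shows "(\<integral>\<^sup>+ r\<in>{0..}. ennreal (exp (- l * r)) \<partial>lborel) = ennreal (1 / l)"
  using nn_integral_exp_power[OF assms, of 0] by simp

context branching_walk_eigen
begin

lemma kern_measurable [measurable]: "(\<lambda>t. kern t x y) \<in> borel_measurable borel"
  unfolding kern_def by measurable

text \<open>
  The row sums of \<open>B\<close> equal \<open>hold + split\<close> off the origin and exceed this by \<open>\<beta>\<^sup>*\<close> at the origin.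
\<close>

lemma total_mass_formula:
  assumes t: "0 \<le> t"
  shows "ennreal (exp (- (\<theta> + split) * t)) * mexp B t (\<lambda>_. 1) x = ennreal (exp (- (\<theta> - hold) * t)) +
    (\<integral>\<^sup>+ r\<in>{0..t}. kern (t - r) x 0 * (ennreal (beta_star b) * ennreal (exp (- (\<theta> - hold) * r)))
        \<partial>lborel)"
proof -
  define v where "v x = (if x = 0 then ennreal (beta_star b) else 0)" for x :: "int ^ 'd"
  have rows: "mapp B (\<lambda>_. 1) x = ennreal (hold + split) + v x" for x
  proof -
    have "mapp B (\<lambda>_. 1) x = ennreal hold + ennreal split + v x"
      unfolding mapp_B v_def by (simp add: mapp_def Q_row)
    then show ?thesis using ennreal_plus[OF less_imp_le[OF hold_pos] split_nonneg] by (simp only:)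
  qed
  have v_eq: "mexp B r v x = ennreal (beta_star b) * mexp B r (delta 0) x" for r
  proof -
    have "v = (\<lambda>x. ennreal (beta_star b) * delta 0 x)" by (auto simp: v_def fun_eq_iff)
    then show ?thesis by (simp only: mexp_cmult)
  qed
  let ?E = "\<lambda>s. ennreal (exp s)"
  have E: "?E s * ?E s' = ?E (s + s')" for s s' by (simp add: exp_add ennreal_mult')
  have "?E (- (\<theta> + split) * t) * mexp B t (\<lambda>_. 1) x = ?E (- (\<theta> + split) * t) * (?E ((hold + split) *
      t) +
     (\<integral>\<^sup>+ r\<in>{0..t}. ?E ((hold + split) * (t - r)) * mexp B r v x \<partial>lborel))"
    by (subst mexp_affine_row_sums[of B "hold + split" v "beta_star b", OF rows])
       (use hold_pos split_nonneg beta_star_nonneg t in \<open>auto simp: v_def\<close>)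
  also have "\<dots> = ?E (- (\<theta> - hold) * t) +
     (\<integral>\<^sup>+ r. ?E (- (\<theta> + split) * t) * (?E ((hold + split) * (t - r)) * mexp B r v x * indicator
         {0..t} r) \<partial>lborel)"
  proof -
    have m: "(\<lambda>r. ?E ((hold + split) * (t - r)) * mexp B r v x * indicator {0..t} r) \<in>
        borel_measurable lborel"
      by measurable
    have "- (\<theta> + split) * t + (hold + split) * t = - (\<theta> - hold) * t" by (simp add: algebra_simps)
    then show ?thesis by (simp only: distrib_left E nn_integral_cmult[OF m])
  qed
  also have "(\<integral>\<^sup>+ r. ?E (- (\<theta> + split) * t) * (?E ((hold + split) * (t - r)) * mexp B r v x *
      indicator {0..t} r) \<partial>lborel) =
     (\<integral>\<^sup>+ r\<in>{0..t}. (ennreal (beta_star b) * ?E (- (\<theta> - hold) * (t - r))) * kern r x 0 \<partial>lborel)"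
  proof (rule nn_integral_cong)
    fix r
    have "- (\<theta> + split) * t + (hold + split) * (t - r) = - (\<theta> - hold) * (t - r) + - (\<theta> + split) * r"
      by (simp add: algebra_simps)
    then have eq: "?E (- (\<theta> + split) * t) * ?E ((hold + split) * (t - r)) =
        ?E (- (\<theta> - hold) * (t - r)) * ?E (- (\<theta> + split) * r)"
      by (simp only: E)
    have "?E (- (\<theta> + split) * t) * (?E ((hold + split) * (t - r)) * mexp B r v x * indicator {0..t} r) =
        (?E (- (\<theta> + split) * t) * ?E ((hold + split) * (t - r))) * mexp B r v x * indicator {0..t} r"
      by (simp only: mult.assoc)
    also have "\<dots> = (ennreal (beta_star b) * ?E (- (\<theta> - hold) * (t - r))) * kern r x 0 * indicator
        {0..t} r"
      unfolding eq v_eq kern_def by (simp only: mult_ac)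
    finally show "?E (- (\<theta> + split) * t) * (?E ((hold + split) * (t - r)) * mexp B r v x * indicator
        {0..t} r) =
        (ennreal (beta_star b) * ?E (- (\<theta> - hold) * (t - r))) * kern r x 0 * indicator {0..t} r" .
  qed
  also have "\<dots> = (\<integral>\<^sup>+ r\<in>{0..t}. kern (t - r) x 0 * (ennreal (beta_star b) * ?E (- (\<theta> - hold) * r))
      \<partial>lborel)"
    by (rule nn_integral_convolution_commute) measurable
  finally show ?thesis .
qed

lemma total_mass_limit:
  assumes \<beta>: "0 < beta_star b"
  shows "\<exists>A>0. ((\<lambda>t. ennreal (exp (- (\<theta> + split) * t)) * mexp B t (\<lambda>_. 1) x) \<longlongrightarrow> ennreal A) at_top"
    and "\<exists>M. \<forall>t\<ge>0. ennreal (exp (- (\<theta> + split) * t)) * mexp B t (\<lambda>_. 1) x \<le> ennreal M"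
proof -
  define l where "l = \<theta> - hold"
  have l: "0 < l" using hold_less by (simp add: l_def)
  obtain L where L: "0 < L" "((\<lambda>t. enn2real (kern t x 0)) \<longlongrightarrow> L) at_top" using kern_converges by blast
  let ?w = "\<lambda>r. ennreal (beta_star b) * ennreal (exp (- l * r))"
  have W: "(\<integral>\<^sup>+ r\<in>{0..}. ?w r \<partial>lborel) = ennreal (beta_star b / l)"
  proof -
    have "(\<integral>\<^sup>+ r\<in>{0..}. ?w r \<partial>lborel) = (\<integral>\<^sup>+ r. ennreal (beta_star b) * (ennreal (exp (- l * r)) *
        indicator {0..} r) \<partial>lborel)"
      by (simp only: mult.assoc)
    also have "\<dots> = ennreal (beta_star b) * ennreal (1 / l)"
      by (subst nn_integral_cmult) (measurable, simp only: nn_integral_exp_decay[OF l])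
    finally show ?thesis using \<beta> by (simp add: ennreal_mult'[symmetric])
  qed
  have formula: "ennreal (exp (- (\<theta> + split) * t)) * mexp B t (\<lambda>_. 1) x = ennreal (exp (- l * t)) +
      (\<integral>\<^sup>+ r\<in>{0..t}. ennreal (enn2real (kern (t - r) x 0)) * ?w r \<partial>lborel)" if "0 \<le> t" for t
    unfolding total_mass_formula[OF that] l_def
    by (intro arg_cong2[where f="(+)"] refl nn_integral_cong) (auto simp: ennreal_kern indicator_def)
  have kle: "enn2real (kern t x 0) \<le> \<psi> x / \<psi> 0" if "0 \<le> t" for t
    using kern_le[OF that, of x 0] psi_pos[of x] psi_pos[of 0] by (intro enn2real_leI) auto
  have "((\<lambda>t. \<integral>\<^sup>+ r\<in>{0..t}. ennreal (enn2real (kern (t - r) x 0)) * ?w r \<partial>lborel) \<longlongrightarrow> ennreal L *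
      ennreal (beta_star b / l)) at_top"
    unfolding W[symmetric]
    by (rule convolution_limit[where M="\<psi> x / \<psi> 0"])
       (use kle L(2) W in \<open>auto simp: ennreal_mult_less_top\<close>)
  moreover have "((\<lambda>t. ennreal (exp (- l * t))) \<longlongrightarrow> ennreal 0) at_top"
  proof (rule tendsto_ennrealI)
    show "((\<lambda>t. exp (- l * t)) \<longlongrightarrow> 0) at_top"
      by (rule filterlim_compose[OF exp_at_bot filterlim_tendsto_neg_mult_at_bot[OF tendsto_const _
          filterlim_ident]])
         (use l in simp)
  qed
  ultimately have "((\<lambda>t. ennreal (exp (- l * t)) + (\<integral>\<^sup>+ r\<in>{0..t}. ennreal (enn2real (kern (t - r) x
      0)) * ?w r \<partial>lborel)) \<longlongrightarrow>
      ennreal 0 + ennreal L * ennreal (beta_star b / l)) at_top"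
    by (intro tendsto_add)
  then have "((\<lambda>t. ennreal (exp (- (\<theta> + split) * t)) * mexp B t (\<lambda>_. 1) x) \<longlongrightarrow> ennreal 0 +
      ennreal L * ennreal (beta_star b / l)) at_top"
    by (rule Lim_transform_eventually) (rule eventually_at_top_linorderI[of 0], rule formula[symmetric])
  moreover have "ennreal 0 + ennreal L * ennreal (beta_star b / l) = ennreal (L * (beta_star b / l))"
    using ennreal_mult'[OF less_imp_le[OF L(1)], of "beta_star b / l"]
        by (simp only: ennreal_0 add_0_left)
  ultimately show "\<exists>A>0. ((\<lambda>t. ennreal (exp (- (\<theta> + split) * t)) * mexp B t (\<lambda>_. 1) x) \<longlongrightarrow> ennreal A)
      at_top"
    using L(1) \<beta> l by (intro exI[of _ "L * (beta_star b / l)"]) simp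
  show "\<exists>M. \<forall>t\<ge>0. ennreal (exp (- (\<theta> + split) * t)) * mexp B t (\<lambda>_. 1) x \<le> ennreal M"
  proof (intro exI allI impI)
    fix t :: real assume t: "0 \<le> t"
    have "(\<integral>\<^sup>+ r\<in>{0..t}. ennreal (enn2real (kern (t - r) x 0)) * ?w r \<partial>lborel) \<le>
        (\<integral>\<^sup>+ r. ennreal (\<psi> x / \<psi> 0) * (?w r * indicator {0..} r) \<partial>lborel)"
      by (intro nn_integral_mono) (auto simp: indicator_def intro!: mult_right_mono ennreal_leI kle)
    also have "\<dots> = ennreal (\<psi> x / \<psi> 0) * ennreal (beta_star b / l)"
      by (subst nn_integral_cmult) (measurable, simp only: W)
    also have "\<dots> = ennreal (\<psi> x / \<psi> 0 * (beta_star b / l))"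
      using psi_pos[of x] psi_pos[of 0] by (simp only: ennreal_mult' divide_nonneg_pos less_imp_le)
    finally have "ennreal (exp (- (\<theta> + split) * t)) * mexp B t (\<lambda>_. 1) x \<le> ennreal 1 +
        ennreal (\<psi> x / \<psi> 0 * (beta_star b / l))"
      unfolding formula[OF t] using t l by (intro add_mono ennreal_leI) auto
    also have "\<dots> = ennreal (1 + \<psi> x / \<psi> 0 * (beta_star b / l))"
      using psi_pos[of x] psi_pos[of 0] \<beta> l by (intro ennreal_plus[symmetric]) auto
    finally show "ennreal (exp (- (\<theta> + split) * t)) * mexp B t (\<lambda>_. 1) x \<le> ennreal (1 +
        \<psi> x / \<psi> 0 * (beta_star b / l))" .
  qed
qed

end

section \<open>Decay of the source term\<close>

context additive_functional
begin

text \<open>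
  Every term of \<open>cross\<close> has two factors of lower order, each at most a multiple of \<open>e t\<close>, and its
  growth in \<open>k\<close> is polynomial.
\<close>

lemma cross_bound:
  fixes e :: "real \<Rightarrow> ennreal"
  assumes e1: "\<And>t. 0 \<le> t \<Longrightarrow> e t \<le> 1"
    and moment: "\<And>j. 1 \<le> j \<Longrightarrow> j < n \<Longrightarrow> \<exists>c<\<top>. \<forall>t\<ge>0. moment j t {#0#} \<le> c * e t"
  shows "\<exists>c<\<top>. \<forall>t\<ge>0. \<forall>k. cross n t k \<le> c * of_nat k ^ n * (e t * e t)"
  using moment
proof (induction n rule: less_induct)
  case (less n)
  have e2: "e t * e t \<le> e t" if "0 \<le> t" for t
    using mult_right_mono[OF e1[OF that], of "e t"] by simp
  have "\<exists>d<\<top>. \<forall>t\<ge>0. \<forall>k. moment j t (replicate_mset k 0) \<le> d * of_nat k ^ j * e t" if j: "1 \<le>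
      j" "j < n" for j
  proof -
    obtain c0 where c0: "c0 < \<top>" "\<And>t. 0 \<le> t \<Longrightarrow> moment j t {#0#} \<le> c0 * e t"
      using less.prems[OF j] by blast
    obtain c1 where c1: "c1 < \<top>" "\<And>t k. 0 \<le> t \<Longrightarrow> cross j t k \<le> c1 * of_nat k ^ j * (e t * e t)"
      using less.IH[OF j(2)] less.prems j(2) by (meson less_trans)
    show ?thesis
    proof (intro exI[of _ "c0 + c1"] conjI allI impI)
      show "c0 + c1 < \<top>" using c0(1) c1(1) by (simp add: less_top[symmetric])
      fix t :: real and k :: nat assume t: "0 \<le> t"
      have "k \<le> k ^ j" using j(1) by (cases "k = 0") (auto intro: self_le_power)
      then have k: "(of_nat k :: ennreal) \<le> of_nat k ^ j"
        using of_nat_mono[of k "k ^ j", where 'a=ennreal] by simp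
      have "moment j t (replicate_mset k 0) = of_nat k * moment j t {#0#} + cross j t k"
        by (rule moment_replicate[OF j(1)])
      also have "\<dots> \<le> of_nat k ^ j * (c0 * e t) + c1 * of_nat k ^ j * e t"
        by (intro add_mono mult_mono k c0(2) t order_trans[OF c1(2)[OF t]] mult_left_mono e2) auto
      also have "\<dots> = (c0 + c1) * of_nat k ^ j * e t"
        by (simp add: distrib_right distrib_left mult_ac)
      finally show "moment j t (replicate_mset k 0) \<le> (c0 + c1) * of_nat k ^ j * e t" .
    qed
  qed
  then obtain d where d: "\<And>j. 1 \<le> j \<Longrightarrow> j < n \<Longrightarrow> d j < \<top>"
    "\<And>j t k. 1 \<le> j \<Longrightarrow> j < n \<Longrightarrow> 0 \<le> t \<Longrightarrow> moment j t (replicate_mset k 0) \<le> d j * of_nat k ^ j * e t"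
    by metis
  obtain c where c: "\<And>j. 1 \<le> j \<Longrightarrow> j < n \<Longrightarrow> c j < \<top>"
    "\<And>j t. 1 \<le> j \<Longrightarrow> j < n \<Longrightarrow> 0 \<le> t \<Longrightarrow> moment j t {#0#} \<le> c j * e t"
    using less.prems by metis
  define K where "K = (\<Sum>j\<in>{1..<n}. of_nat (n choose j) * d j * c (n - j))"
  show ?case
  proof (intro exI[of _ K] conjI allI impI)
    have "of_nat (n choose j) * d j * c (n - j) < \<top>" if "j \<in> {1..<n}" for j
    proof -
      have "d j < \<top>" "c (n - j) < \<top>" using that by (auto intro!: d(1) c(1))
      then show ?thesis by (simp add: ennreal_mult_less_top of_nat_less_top)
    qed
    then show "K < \<top>" unfolding K_def by simp
    fix t :: real and k :: nat assume t: "0 \<le> t"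
    have "cross n t k \<le> (\<Sum>i<k. K * of_nat k ^ (n - 1) * (e t * e t))"
      unfolding cross_def
    proof (rule sum_mono)
      fix i assume i: "i \<in> {..<k}"
      have "of_nat (n choose j) * moment j t (replicate_mset i 0) * moment (n - j) t {#0#} \<le>
         (of_nat (n choose j) * d j * c (n - j)) * (of_nat k ^ (n - 1) * (e t * e t))" if j: "j \<in>
             {1..<n}" for j
      proof -
        have "i ^ j \<le> k ^ (n - 1)"
          using i j by (intro order_trans[OF power_mono[of i k j] power_increasing]) auto
        then have p: "(of_nat i ^ j :: ennreal) \<le> of_nat k ^ (n - 1)"
          using of_nat_mono[of "i ^ j" "k ^ (n - 1)", where 'a=ennreal] by simp
        have "of_nat (n choose j) * moment j t (replicate_mset i 0) * moment (n - j) t {#0#} \<le>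
           of_nat (n choose j) * (d j * of_nat k ^ (n - 1) * e t) * (c (n - j) * e t)"
          using j t by (intro mult_mono order_refl order_trans[OF d(2)[of j t i]] c(2) p) auto
        then show ?thesis by (simp only: mult_ac)
      qed
      then have "(\<Sum>j\<in>{1..<n}. of_nat (n choose j) * moment j t (replicate_mset i 0) * moment (n - j)
          t {#0#}) \<le>
        (\<Sum>j\<in>{1..<n}. (of_nat (n choose j) * d j * c (n - j)) * (of_nat k ^ (n - 1) * (e t * e t)))"
        by (rule sum_mono)
      also have "\<dots> = K * of_nat k ^ (n - 1) * (e t * e t)"
        unfolding K_def sum_distrib_right[symmetric] by (simp only: mult.assoc)
      finally show "(\<Sum>j\<in>{1..<n}. of_nat (n choose j) * moment j t (replicate_mset i 0) *
          moment (n - j) t {#0#}) \<le> K * of_nat k ^ (n - 1) * (e t * e t)" .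
    qed
    also have "\<dots> = K * (of_nat k * of_nat k ^ (n - 1)) * (e t * e t)" by (simp add: mult_ac)
    also have "\<dots> \<le> K * of_nat k ^ n * (e t * e t)"
    proof (cases "n = 0")
      case True
      then show ?thesis by (simp add: K_def)
    next
      case False
      then have "(of_nat k * of_nat k ^ (n - 1) :: ennreal) = of_nat k ^ n" by (cases n) auto
      then show ?thesis by simp
    qed
    finally show "cross n t k \<le> K * of_nat k ^ n * (e t * e t)" .
  qed
qed

lemma source_bound:
  fixes e :: "real \<Rightarrow> ennreal"
  assumes e1: "\<And>t. 0 \<le> t \<Longrightarrow> e t \<le> 1"
    and moment: "\<And>j. 1 \<le> j \<Longrightarrow> j < n \<Longrightarrow> \<exists>c<\<top>. \<forall>t\<ge>0. moment j t {#0#} \<le> c * e t"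
  shows "\<exists>c<\<top>. \<forall>t\<ge>0. source n t \<le> c * (e t * e t)"
proof -
  obtain c where c: "c < \<top>" "\<And>t k. 0 \<le> t \<Longrightarrow> cross n t k \<le> c * of_nat k ^ n * (e t * e t)"
    using cross_bound[OF e1 moment] by blast
  define S where "S = (\<Sum>k. ennreal (b (k + 2)) * of_nat (k + 2) ^ n)"
  have "summable (\<lambda>k. real (k + 2) ^ n * b (k + 2))"
    using offspring_moments_summable[OF offspring, of n] by (subst summable_iff_shift)
  then have "(\<Sum>k. ennreal (real (k + 2) ^ n * b (k + 2))) < \<top>"
    using b_nonneg by (subst suminf_ennreal_eq[OF _ summable_sums]) auto
  moreover have "ennreal (real (k + 2) ^ n * b (k + 2)) = ennreal (b (k + 2)) * of_nat (k +
      2) ^ n" for k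
  proof -
    have "ennreal (real (k + 2) ^ n * b (k + 2)) = ennreal (real (k + 2) ^ n) * ennreal (b (k + 2))"
      by (rule ennreal_mult') simp
    also have "ennreal (real (k + 2) ^ n) = of_nat (k + 2) ^ n"
      by (simp only: ennreal_of_nat_eq_real_of_nat ennreal_power of_nat_0_le_iff)
    finally show ?thesis by (simp only: mult.commute)
  qed
  ultimately have S: "S < \<top>" by (simp only: S_def)
  show ?thesis
  proof (intro exI[of _ "c * S"] conjI allI impI)
    show "c * S < \<top>" using c(1) S by (simp add: ennreal_mult_less_top)
    fix t :: real assume t: "0 \<le> t"
    have "source n t \<le> (\<Sum>k. ennreal (b (k + 2)) * of_nat (k + 2) ^ n * (c * (e t * e t)))"
      unfolding source_def
    proof (rule suminf_le[OF _ summableI summableI])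
      fix k
      have "ennreal (b (k + 2)) * cross n t (k + 2) \<le> ennreal (b (k + 2)) * (c * of_nat (k +
          2) ^ n * (e t * e t))"
        by (intro mult_left_mono c(2) t) simp
      then show "ennreal (b (k + 2)) * cross n t (k + 2) \<le> ennreal (b (k + 2)) * of_nat (k +
          2) ^ n * (c * (e t * e t))"
        by (simp only: mult_ac)
    qed
    also have "\<dots> = c * S * (e t * e t)" by (subst ennreal_suminf_multc) (simp only: S_def[symmetric]
        mult_ac)
    finally show "source n t \<le> c * S * (e t * e t)" .
  qed
qed

end

section \<open>Asymptotics of the moments\<close>

text \<open>
  The functional takes only the values 0 and 1 on single particles, so all moments have the same
  initial function. The inequality \<open>decay\<close> is \<open>\<lambda>\<^sub>\<E> < 0\<close>.
\<close>

locale moment_asymptotics = branching_walk_eigen a b P \<theta> \<psi> + additive_functional a b P phi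
  for a :: "int ^ 'd::finite \<Rightarrow> int ^ 'd \<Rightarrow> real" and b P \<theta> \<psi> phi +
  assumes phi_le: "phi {#x#} \<le> 1" and decay: "\<theta> - hold - b 0 < 0"
begin

text \<open>
  This is \<open>\<lambda>\<^sub>\<E>\<close>.
\<close>

definition rho :: real where "rho = \<theta> - hold - b 0"

text \<open>
  The normalised contribution of the initial function to the moments.
\<close>

definition base :: "real \<Rightarrow> int ^ 'd \<Rightarrow> ennreal" where
  "base t x = ennreal (exp (- (\<theta> + split) * t)) * mexp B t (\<lambda>x. of_nat (phi {#x#})) x"

lemma rho_neg: "rho < 0"
  using decay by (simp add: rho_def)

text \<open>
  The exponents combine since \<open>- (\<theta> + split) + exit = - rho\<close>.
\<close>

lemma normalized_moment:
  assumes n: "1 \<le> n" and t: "0 \<le> t"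
  shows "ennreal (exp (- rho * t)) * moment n t {#x#} = base t x +
    (\<integral>\<^sup>+ r\<in>{0..t}. kern (t - r) x 0 * (ennreal (exp (- rho * r)) * source n r) \<partial>lborel)"
proof -
  let ?E = "\<lambda>s. ennreal (exp s)"
  have E: "?E s * ?E s' = ?E (s + s')" for s s' by (simp add: exp_add ennreal_mult')
  have phi_pow: "(\<lambda>x. of_nat (phi {#x#}) ^ n :: ennreal) = (\<lambda>x. of_nat (phi {#x#}))"
  proof
    fix x
    have "phi {#x#} = 0 \<or> phi {#x#} = 1" using phi_le[of x] by linarith
    then show "of_nat (phi {#x#}) ^ n = (of_nat (phi {#x#}) :: ennreal)" using n
        by (auto simp: power_0_left)
  qed
  have x1: "- (\<theta> + split) * r + exit * r = - rho * r" for r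
    by (simp add: exit_def split_def rho_def algebra_simps)
  have "?E (- rho * t) * moment n t {#x#} = ?E (- (\<theta> + split) * t) * (?E (exit * t) * moment n t {#x#})"
    by (simp only: mult.assoc[symmetric] E x1)
  also have "\<dots> = base t x + ?E (- (\<theta> + split) * t) *
      (\<integral>\<^sup>+ r\<in>{0..t}. mexp B (t - r) (delta 0) x * (?E (exit * r) * source n r) \<partial>lborel)"
    unfolding moment_formula[OF n t] base_def phi_pow by (rule distrib_left)
  also have "?E (- (\<theta> + split) * t) *
      (\<integral>\<^sup>+ r\<in>{0..t}. mexp B (t - r) (delta 0) x * (?E (exit * r) * source n r) \<partial>lborel) =
      (\<integral>\<^sup>+ r. ?E (- (\<theta> + split) * t) * (mexp B (t - r) (delta 0) x * (?E (exit * r) * source n r) *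
          indicator {0..t} r) \<partial>lborel)"
    by (rule nn_integral_cmult[symmetric]) measurable
  also have "\<dots> = (\<integral>\<^sup>+ r\<in>{0..t}. kern (t - r) x 0 * (?E (- rho * r) * source n r) \<partial>lborel)"
  proof (rule nn_integral_cong)
    fix r
    have "?E (- (\<theta> + split) * t) = ?E (- (\<theta> + split) * (t - r)) * ?E (- (\<theta> + split) * r)"
      unfolding E by (simp add: algebra_simps)
    then have "?E (- (\<theta> + split) * t) * (mexp B (t - r) (delta 0) x * (?E (exit * r) * source n r) *
        indicator {0..t} r) =
        kern (t - r) x 0 * ((?E (- (\<theta> + split) * r) * ?E (exit * r)) * source n r) * indicator {0..t} r"
      unfolding kern_def by (simp only: mult_ac)
    then show "?E (- (\<theta> + split) * t) * (mexp B (t - r) (delta 0) x * (?E (exit * r) * source n r) *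
        indicator {0..t} r) =
        kern (t - r) x 0 * (?E (- rho * r) * source n r) * indicator {0..t} r"
      by (simp only: E x1)
  qed
  finally show ?thesis .
qed

text \<open>
  The source is \<open>O(e\<^bsup>2 rho t\<^esup>)\<close> and \<open>rho < 0\<close>, so that one factor \<open>e\<^bsup>rho t\<^esup>\<close> remains after
  normalisation and makes it integrable.
\<close>

lemma source_decay:
  assumes "\<And>j. 1 \<le> j \<Longrightarrow> j < n \<Longrightarrow> \<exists>c<\<top>. \<forall>t\<ge>0. moment j t {#0#} \<le> c * ennreal (exp (rho * t))"
  shows "\<exists>c<\<top>. (\<forall>t\<ge>0. ennreal (exp (- rho * t)) * source n t \<le> c * ennreal (exp (rho * t))) \<and>
    (\<integral>\<^sup>+ t\<in>{0..}. ennreal (exp (- rho * t)) * source n t \<partial>lborel) \<le> c * ennreal (1 / - rho)"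
proof -
  let ?E = "\<lambda>s. ennreal (exp s)"
  have E: "?E s * ?E s' = ?E (s + s')" for s s' by (simp add: exp_add ennreal_mult')
  have "?E (rho * t) \<le> 1" if "0 \<le> t" for t
    using that rho_neg by (simp add: mult_nonpos_nonneg)
  from source_bound[of "\<lambda>t. ?E (rho * t)" n, OF this assms]
  obtain c where c: "c < \<top>" "\<And>t. 0 \<le> t \<Longrightarrow> source n t \<le> c * (?E (rho * t) * ?E (rho * t))"
    by blast
  have le: "?E (- rho * t) * source n t \<le> c * ?E (rho * t)" if "0 \<le> t" for t
  proof -
    have "?E (- rho * t) * source n t \<le> ?E (- rho * t) * (c * (?E (rho * t) * ?E (rho * t)))"
      by (intro mult_left_mono c(2) that) simp
    also have "\<dots> = c * (?E (- rho * t) * ?E (rho * t) * ?E (rho * t))" by (simp only: mult_ac)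
    also have "?E (- rho * t) * ?E (rho * t) * ?E (rho * t) = ?E (rho * t)" unfolding E by simp
    finally show ?thesis .
  qed
  have "(\<integral>\<^sup>+ t\<in>{0..}. ?E (- rho * t) * source n t \<partial>lborel) \<le>
      (\<integral>\<^sup>+ t. c * (?E (- (- rho) * t) * indicator {0..} t) \<partial>lborel)"
    by (intro nn_integral_mono) (use le in \<open>simp add: indicator_def\<close>)
  also have "\<dots> = c * ennreal (1 / - rho)"
    using nn_integral_exp_decay[of "- rho"] rho_neg by (subst nn_integral_cmult) auto
  finally show ?thesis using c(1) le by blast
qed

text \<open>
  The source sits at the origin and is built from the moments there, so the induction on the order
  can be carried out at the origin.
\<close>

lemma moment_decay_at_origin:
  assumes base: "\<And>t. 0 \<le> t \<Longrightarrow> base t 0 \<le> ennreal M"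
  shows "1 \<le> n \<Longrightarrow> \<exists>c<\<top>. \<forall>t\<ge>0. moment n t {#0#} \<le> c * ennreal (exp (rho * t))"
proof (induction n rule: less_induct)
  case (less n)
  let ?E = "\<lambda>s. ennreal (exp s)"
  have E: "?E s * ?E s' = ?E (s + s')" for s s' by (simp add: exp_add ennreal_mult')
  obtain c where c: "c < \<top>" "\<And>t. 0 \<le> t \<Longrightarrow> ?E (- rho * t) * source n t \<le> c * ?E (rho * t)"
    "(\<integral>\<^sup>+ t\<in>{0..}. ?E (- rho * t) * source n t \<partial>lborel) \<le> c * ennreal (1 / - rho)"
  proof -
    have "\<exists>c<\<top>. \<forall>t\<ge>0. moment j t {#0#} \<le> c * ?E (rho * t)" if "1 \<le> j" "j < n" for j
      by (rule less.IH[OF that(2,1)])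
    from source_decay[OF this] show thesis using that by blast
  qed
  show ?case
  proof (intro exI[of _ "ennreal M + c * ennreal (1 / - rho)"] conjI allI impI)
    show "ennreal M + c * ennreal (1 / - rho) < \<top>" using c(1) by (simp add: ennreal_mult_less_top)
    fix t :: real assume t: "0 \<le> t"
    have "(\<integral>\<^sup>+ r\<in>{0..t}. kern (t - r) 0 0 * (?E (- rho * r) * source n r) \<partial>lborel) \<le>
        (\<integral>\<^sup>+ r\<in>{0..}. ?E (- rho * r) * source n r \<partial>lborel)"
    proof (rule nn_integral_mono)
      fix r
      show "kern (t - r) 0 0 * (?E (- rho * r) * source n r) * indicator {0..t} r \<le> ?E (- rho * r) *
          source n r * indicator {0..} r"
      proof (cases "r \<in> {0..t}")
        case True
        then have "kern (t - r) 0 0 \<le> 1" using kern_le[of "t - r" 0 0] psi_pos[of 0] by simp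
        then have "kern (t - r) 0 0 * (?E (- rho * r) * source n r) \<le> 1 * (?E (- rho * r) * source n r)"
          by (rule mult_right_mono) simp
        then show ?thesis using True by simp
      qed simp
    qed
    then have "?E (- rho * t) * moment n t {#0#} \<le> ennreal M + c * ennreal (1 / - rho)"
      unfolding normalized_moment[OF less.prems t] using c(3)
          by (intro add_mono base t) (rule order_trans)
    then have "?E (rho * t) * (?E (- rho * t) * moment n t {#0#}) \<le> ?E (rho * t) * (ennreal M +
        c * ennreal (1 / - rho))"
      by (rule mult_left_mono) simp
    moreover have "?E (rho * t) * (?E (- rho * t) * moment n t {#0#}) = moment n t {#0#}"
      unfolding mult.assoc[symmetric] E by simp
    ultimately show "moment n t {#0#} \<le> (ennreal M + c * ennreal (1 / - rho)) * ?E (rho * t)"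
      by (simp only: mult.commute)
  qed
qed

text \<open>
  The limit is at least the limit \<open>A\<close> of the first term, hence positive.
\<close>

lemma moment_limit:
  assumes base: "\<And>t. 0 \<le> t \<Longrightarrow> base t 0 \<le> ennreal M"
    and lim: "0 < A" "((\<lambda>t. base t x) \<longlongrightarrow> ennreal A) at_top"
    and n: "1 \<le> n"
  shows "\<exists>D>0. ((\<lambda>t. exp (- rho * t) * enn2real (moment n t {#x#})) \<longlongrightarrow> D) at_top"
proof -
  define w where "w r = ennreal (exp (- rho * r)) * source n r" for r
  obtain c where c: "c < \<top>" "\<And>t. 0 \<le> t \<Longrightarrow> w t \<le> c * ennreal (exp (rho * t))"
    "(\<integral>\<^sup>+ t\<in>{0..}. w t \<partial>lborel) \<le> c * ennreal (1 / - rho)"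
    using source_decay[OF moment_decay_at_origin[OF base], of n] unfolding w_def by blast
  define W where "W = (\<integral>\<^sup>+ t\<in>{0..}. w t \<partial>lborel)"
  have W: "W < \<top>"
    unfolding W_def by (rule le_less_trans[OF c(3)]) (use c(1) in \<open>simp add: ennreal_mult_less_top\<close>)
  have w_fin: "w t < \<top>" if "0 \<le> t" for t
    by (rule le_less_trans[OF c(2)[OF that]]) (use c(1) in \<open>simp add: ennreal_mult_less_top\<close>)
  obtain L where L: "0 < L" "((\<lambda>t. enn2real (kern t x 0)) \<longlongrightarrow> L) at_top" using kern_converges by blast
  have kle: "enn2real (kern t x 0) \<le> \<psi> x / \<psi> 0" if "0 \<le> t" for t
    using kern_le[OF that, of x 0] psi_pos[of x] psi_pos[of 0] by (intro enn2real_leI) auto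
  have km: "(\<lambda>t. enn2real (kern t x 0)) \<in> borel_measurable borel" by measurable
  have wm: "w \<in> borel_measurable borel" unfolding w_def[abs_def] by measurable
  have conv: "((\<lambda>t. \<integral>\<^sup>+ r\<in>{0..t}. ennreal (enn2real (kern (t - r) x 0)) * w r \<partial>lborel) \<longlongrightarrow> ennreal L *
      W) at_top"
    unfolding W_def
    by (rule convolution_limit[OF km wm kle L(2) w_fin W[unfolded W_def]])
  have "((\<lambda>t. base t x + (\<integral>\<^sup>+ r\<in>{0..t}. ennreal (enn2real (kern (t - r) x 0)) * w r \<partial>lborel)) \<longlongrightarrow>
      ennreal A + ennreal L * W) at_top"
    by (rule tendsto_add[OF lim(2) conv])
  then have l: "((\<lambda>t. ennreal (exp (- rho * t)) * moment n t {#x#}) \<longlongrightarrow> ennreal A + ennreal L * W) at_top"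
  proof (rule Lim_transform_eventually, intro eventually_at_top_linorderI[of 0])
    fix t :: real assume t: "0 \<le> t"
    show "base t x + (\<integral>\<^sup>+ r\<in>{0..t}. ennreal (enn2real (kern (t - r) x 0)) * w r \<partial>lborel) =
        ennreal (exp (- rho * t)) * moment n t {#x#}"
      unfolding normalized_moment[OF n t] w_def
      by (intro arg_cong2[where f="(+)"] refl nn_integral_cong) (auto simp: ennreal_kern indicator_def)
  qed
  have "ennreal L * W = ennreal (L * enn2real W)"
    using W L(1) by (simp add: ennreal_mult' less_imp_le)
  then have "ennreal A + ennreal L * W = ennreal (A + L * enn2real W)"
    using lim(1) L(1) by (simp add: ennreal_plus less_imp_le)
  moreover have D: "0 < A + L * enn2real W"
    using lim(1) L(1) by (intro add_pos_nonneg mult_nonneg_nonneg) auto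
  ultimately have "((\<lambda>t. enn2real (ennreal (exp (- rho * t)) * moment n t {#x#})) \<longlongrightarrow> A +
      L * enn2real W) at_top"
    using l by (intro tendsto_enn2real) auto
  then show ?thesis using D by (intro exI[of _ "A + L * enn2real W"]) (simp add: enn2real_mult)
qed

end

text \<open>
  The Markov property between time 0 and time \<open>t\<close>, with a deterministic initial state.
\<close>

lemma law_at_time:
  fixes X :: "real \<Rightarrow> 'w \<Rightarrow> 's::countable"
  assumes "prob_space M" and X: "\<And>t. 0 \<le> t \<Longrightarrow> X t \<in> measurable M (count_space UNIV)"
    and start: "AE w in M. X 0 w = C0"
    and markov: "\<And>C'. \<P>(w in M. X 0 w = C0 \<and> X t w = C') = \<P>(w in M. X 0 w = C0) * pmf Q C'"
    and t: "0 \<le> t"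
  shows "distr M (count_space UNIV) (X t) = measure_pmf Q"
proof (rule measure_eqI_countable[where A=UNIV])
  interpret prob_space M by fact
  note [measurable] = X[OF t] X[of 0, simplified]
  fix C'
  have "\<P>(w in M. X 0 w = C0) = 1"
    using start by (intro prob_Collect_eq_1[THEN iffD2]) measurable
  moreover have "\<P>(w in M. X 0 w = C0 \<and> X t w = C') = \<P>(w in M. X t w = C')"
    by (rule finite_measure_eq_AE) (use start in \<open>auto, measurable\<close>)
  ultimately have "\<P>(w in M. X t w = C') = pmf Q C'" using markov[of C'] by simp
  then show "emeasure (distr M (count_space UNIV) (X t)) {C'} = emeasure (measure_pmf Q) {C'}"
    by (subst emeasure_distr) (auto simp: emeasure_eq_measure emeasure_pmf_single vimage_def Int_def
        conj_commute X t)
qed auto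

lemma normalized_limit_imp_asymp_equiv:
  fixes f :: "real \<Rightarrow> real"
  assumes "((\<lambda>t. exp (- r * t) * f t) \<longlongrightarrow> D) at_top" "0 < D"
  shows "f \<sim>[at_top] (\<lambda>t. D * exp (r * t))"
proof (rule asymp_equivI')
  have "((\<lambda>t. exp (- r * t) * f t / D) \<longlongrightarrow> D / D) at_top"
    using assms by (intro tendsto_intros) auto
  moreover have "exp (- r * t) * f t / D = f t / (D * exp (r * t))" for t
    by (simp add: exp_minus field_simps)
  ultimately show "((\<lambda>t. f t / (D * exp (r * t))) \<longlongrightarrow> 1) at_top"
    using assms(2) by simp
qed

theorem theorem7p1:
  fixes a :: "int ^ 'd::finite \<Rightarrow> int ^ 'd \<Rightarrow> real"
    and p :: "real \<Rightarrow> int ^ 'd \<Rightarrow> (int ^ 'd) pmf"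
    and b :: "nat \<Rightarrow> real"
    and M :: "int ^ 'd \<Rightarrow> 'w measure"
    and X :: "real \<Rightarrow> 'w \<Rightarrow> 'd config"
  assumes "walk_intensity a"
    and "walk_transition a p"
    and "offspring_rates b"
    and "branching_random_walk a b M X"
    and "beta_star b > 0"
    and "beta_star b > beta_c p"
    and "lambda_E a b < 0"
  shows "(\<forall>n\<ge>1. \<forall>x y. \<exists>D>0.
            (\<lambda>t. local_moment M X n t x y) \<sim>[at_top] (\<lambda>t. D * exp (lambda_E a b * t))) \<and>
         (\<forall>n\<ge>1. \<forall>x. \<exists>D>0.
            (\<lambda>t. total_moment M X n t x) \<sim>[at_top] (\<lambda>t. D * exp (lambda_E a b * t)))"
proof -
  from assms(4) obtain P where P: "brw_transition a b P" and process: "\<forall>x. prob_space (M x) \<and>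
          (\<forall>t\<ge>0. X t \<in> measurable (M x) (count_space UNIV)) \<and>
          (AE w in M x. X 0 w = {#x#}) \<and>
          (\<forall>T s h g C C'. finite T \<and> T \<subseteq> {0..s} \<and> 0 \<le> s \<and> 0 \<le> h \<longrightarrow>
             \<P>(w in M x. (\<forall>r\<in>T. X r w = g r) \<and> X s w = C \<and> X (s + h) w = C') =
             \<P>(w in M x. (\<forall>r\<in>T. X r w = g r) \<and> X s w = C) * pmf (P h C) C')"
    unfolding branching_random_walk_def by (elim exE conjE)
  note process_at = process[THEN spec]
  have M: "prob_space (M x)" "AE w in M x. X 0 w = {#x#}" for x
    by (rule process_at[of x, THEN conjunct1], rule process_at[of x, THEN conjunct2, THEN conjunct2,
        THEN conjunct1])
  have X: "X t \<in> measurable (M x) (count_space UNIV)" if "0 \<le> t" for x t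
    using process_at[of x, THEN conjunct2, THEN conjunct1] that by blast
  have markov: "\<P>(w in M x. X 0 w = C \<and> X t w = C') = \<P>(w in M x. X 0 w = C) * pmf (P t C) C'"
    if "0 \<le> t" for x t C C'
    using process_at[of x, THEN conjunct2, THEN conjunct2, THEN conjunct2, rule_format, of "{}" 0 t
        "\<lambda>_. {#}" C C'] that
    by simp
  interpret branching_walk a b P
    by unfold_locales fact+
  obtain \<theta> \<psi> where eig: "hold < \<theta>" "\<And>x. 0 < \<psi> x" "\<psi> summable_on UNIV"
    "\<And>x. mapp B (\<lambda>x. ennreal (\<psi> x)) x = ennreal (\<theta> + split) * ennreal (\<psi> x)"
    "\<And>x. mapp Q (\<lambda>x. ennreal (\<psi> x)) x + (if x = 0 then ennreal (beta_star b) * ennreal (\<psi> 0) else 0)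
        = ennreal \<theta> * ennreal (\<psi> x)"
    using principal_eigenvector[OF assms(2,5,6)] by metis
  have lE: "lambda_E a b = \<theta> - hold - b 0"
    unfolding lambda_E_def lambda_0_principal[OF eig(2,3,5,1)] ..
  interpret branching_walk_eigen a b P \<theta> \<psi>
    by unfold_locales (use eig in auto)
  have law: "(\<integral>w. real (phi (X t w)) ^ n \<partial>M x) = enn2real (\<integral>\<^sup>+ w. of_nat (phi w) ^ n \<partial>P (max 0 t)
      {#x#})"
    if t: "0 \<le> t" for phi :: "'d config \<Rightarrow> nat" and n t x
  proof -
    have d: "distr (M x) (count_space UNIV) (X t) = measure_pmf (P t {#x#})"
      by (rule law_at_time[OF M(1) X M(2) markov[OF t] t])
    have [measurable]: "X t \<in> measurable (M x) (count_space UNIV)" by (rule X[OF t])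
    have "(\<integral>w. real (phi (X t w)) ^ n \<partial>M x) = enn2real (\<integral>\<^sup>+ w. ennreal (real (phi (X t w)) ^ n) \<partial>M x)"
      by (rule integral_eq_nn_integral) auto
    also have "(\<integral>\<^sup>+ w. ennreal (real (phi (X t w)) ^ n) \<partial>M x) = (\<integral>\<^sup>+ C. ennreal (real (phi C) ^ n)
        \<partial>distr (M x) (count_space UNIV) (X t))"
      by (subst nn_integral_distr) auto
    also have "\<dots> = (\<integral>\<^sup>+ w. of_nat (phi w) ^ n \<partial>P (max 0 t) {#x#})"
      unfolding d using t by (simp add: ennreal_power[symmetric] ennreal_of_nat_eq_real_of_nat)
    finally show ?thesis .
  qed
  have asymp: "\<exists>D>0. (\<lambda>t. \<integral>w. real (phi (X t w)) ^ n \<partial>M x) \<sim>[at_top] (\<lambda>t. D * exp (lambda_E a b * t))"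
    if phi: "\<And>C C'. phi (C + C') = phi C + phi C'" "\<And>x. phi {#x#} \<le> 1" and n: "1 \<le> n"
      and base: "\<exists>M. \<forall>t\<ge>0. ennreal (exp (- (\<theta> + split) * t)) * mexp B t (\<lambda>x. of_nat (phi {#x#})) 0 \<le>
          ennreal M"
        "\<exists>A>0. ((\<lambda>t. ennreal (exp (- (\<theta> + split) * t)) * mexp B t (\<lambda>x. of_nat (phi {#x#})) x) \<longlongrightarrow>
            ennreal A) at_top"
    for phi :: "'d config \<Rightarrow> nat" and n x
  proof -
    interpret moment_asymptotics a b P \<theta> \<psi> phi
      by unfold_locales (use phi assms(7) lE in auto)
    obtain M' A where MA: "\<And>t. 0 \<le> t \<Longrightarrow> base t 0 \<le> ennreal M'" "0 < A" "((\<lambda>t. base t x) \<longlongrightarrow> ennreal A)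
        at_top"
      using base unfolding base_def by blast
    obtain D where D: "0 < D" "((\<lambda>t. exp (- rho * t) * enn2real (moment n t {#x#})) \<longlongrightarrow> D) at_top"
      using moment_limit[OF MA n] by blast
    have "((\<lambda>t. exp (- rho * t) * (\<integral>w. real (phi (X t w)) ^ n \<partial>M x)) \<longlongrightarrow> D) at_top"
      by (rule Lim_transform_eventually[OF D(2)])
         (rule eventually_at_top_linorderI[of 0], simp add: law moment_def)
    then have "(\<lambda>t. \<integral>w. real (phi (X t w)) ^ n \<partial>M x) \<sim>[at_top] (\<lambda>t. D * exp (rho * t))"
      by (rule normalized_limit_imp_asymp_equiv) (rule D(1))
    then show ?thesis using D(1) unfolding lE rho_def by blast
  qed
  have "\<exists>D>0. (\<lambda>t. local_moment M X n t x y) \<sim>[at_top] (\<lambda>t. D * exp (lambda_E a b * t))" if n: "1 \<le>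
      n" for n x y
    unfolding local_moment_def
  proof (rule asymp[of "\<lambda>C. count C y", OF _ _ n])
    have "(\<lambda>x. of_nat (count {#x#} y) :: ennreal) = delta y" by (auto simp: fun_eq_iff indicator_def)
    then have k: "ennreal (exp (- (\<theta> + split) * t)) * mexp B t (\<lambda>x. of_nat (count {#x#} y)) x =
        kern t x y" for t x
      unfolding kern_def by simp
    show "\<exists>M. \<forall>t\<ge>0. ennreal (exp (- (\<theta> + split) * t)) * mexp B t (\<lambda>x. of_nat (count {#x#} y)) 0 \<le>
        ennreal M"
      unfolding k using kern_le by blast
    obtain L where L: "0 < L" "((\<lambda>t. enn2real (kern t x y)) \<longlongrightarrow> L) at_top" using kern_converges by blast
    have "((\<lambda>t. kern t x y) \<longlongrightarrow> ennreal L) at_top"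
      by (rule Lim_transform_eventually[OF tendsto_ennrealI[OF L(2)]])
         (rule eventually_at_top_linorderI[of 0], rule ennreal_kern)
    then show "\<exists>A>0. ((\<lambda>t. ennreal (exp (- (\<theta> + split) * t)) * mexp B t (\<lambda>x. of_nat (count {#x#} y))
        x) \<longlongrightarrow> ennreal A) at_top"
      unfolding k using L(1) by blast
  qed auto
  moreover have "\<exists>D>0. (\<lambda>t. total_moment M X n t x) \<sim>[at_top] (\<lambda>t. D * exp (lambda_E a b * t))" if
      n: "1 \<le> n" for n x
    unfolding total_moment_def
    by (rule asymp[of size, OF _ _ n]) (use total_mass_limit[OF assms(5)] in auto)
  ultimately show ?thesis by blast
qed

end
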